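(* Let $n>3$ be a prime, $q$ a prime power, and let $T$ be a Coxeter torus of $\mathrm{SL}_n(q)$. Let $\mathtt x\in T$ be an irreducible element. Then the conjugacy class $\mathcal O$ of the image $x$ of $\mathtt x$ in $\mathrm{PSL}_n(q)$ is kthulhu.
   Context: A matrix in $\mathrm{GL}_n(q)$ is irreducible if its characteristic polynomial is irreducible over $\mathbb F_q$. A Coxeter torus of $\mathrm{GL}_n(q)$ is a subgroup $\mathbb T_w^F$, the $\mathbb F_q$-points of an $F$-stable maximal torus of $\mathrm{GL}_n(\overline{\mathbb F_q})$ corresponding to the $n$-cycle $w$ in the Weyl group $\mathbb S_n$; concretely it is a cyclic subgroup of order $q^n-1$, isomorphic to $\mathbb F_{q^n}^\times$, and all such subgroups are conjugate. The corresponding Coxeter torus of $\mathrm{SL}_n(q)$ is $T=\mathbb T_w^F\cap\mathrm{SL}_n(q)$, of order $(q^n-1)/(q-1)$. For a finite group $G$ and $x\in G$, $\mathcal O_x^G$ is the conjugacy class of $x$ in $G$. A conjugacy class $\mathcal O$ of $G$ is: - of type C if there are $H\le G$ and $r,s\in H\cap\mathcal O$ such that $rs\ne sr$, $\mathcal O_r^H\neq\mathcal O_s^H$, $H=\langle \mathcal O_r^H,\mathcal O_s^H\rangle$, and $\min\{|\mathcal O_r^H|,|\mathcal O_s^H|\}>2$ or $\max\{|\mathcal O_r^H|,|\mathcal O_s^H|\}>4$; - of type D if there are $r,s\in\mathcal O$ with $\mathcal O_r^{\langle r,s\rangle}\ne\mathcal O_s^{\langle r,s\rangle}$ and $(rs)^2\neq(sr)^2$;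 - of type F if there are $r_1,r_2,r_3,r_4\in\mathcal O$ such that, with $K=\langle r_1,r_2,r_3,r_4\rangle$, for all $a\ne b$: $\mathcal O_{r_a}^K\neq\mathcal O_{r_b}^K$ and $r_ar_b\ne r_br_a$. $\mathcal O$ is kthulhu if it is of none of the types C, D, F. *)

theory Defs
  imports
    "Jordan_Normal_Form.Char_Poly"
    "HOL-Algebra.Algebraic_Closure_Type"
    "HOL-Algebra.Generated_Groups"
    "HOL-Combinatorics.Orbits"
    "HOL-Library.Cardinality"
begin

section \<open>Conjugacy classes and kthulhu classes\<close>

text \<open>The orbit of \<open>r\<close> under conjugation by the elements of \<open>H\<close>; the class of \<open>r\<close> in the
  whole group is obtained for \<open>H = carrier G\<close>.\<close>

definition conj_class :: "('g, 'b) monoid_scheme \<Rightarrow> 'g set \<Rightarrow> 'g \<Rightarrow> 'g set" where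
  "conj_class G H r = {h \<otimes>\<^bsub>G\<^esub> r \<otimes>\<^bsub>G\<^esub> inv\<^bsub>G\<^esub> h | h. h \<in> H}"

definition type_C :: "('g, 'b) monoid_scheme \<Rightarrow> 'g set \<Rightarrow> bool" where
  "type_C G C \<longleftrightarrow> (\<exists>H r s. subgroup H G \<and> r \<in> H \<inter> C \<and> s \<in> H \<inter> C \<and>
     r \<otimes>\<^bsub>G\<^esub> s \<noteq> s \<otimes>\<^bsub>G\<^esub> r \<and>
     conj_class G H r \<noteq> conj_class G H s \<and>
     H = generate G (conj_class G H r \<union> conj_class G H s) \<and>
     (min (card (conj_class G H r)) (card (conj_class G H s)) > 2 \<or>
      max (card (conj_class G H r)) (card (conj_class G H s)) > 4))"

definition type_D :: "('g, 'b) monoid_scheme \<Rightarrow> 'g set \<Rightarrow> bool" where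
  "type_D G C \<longleftrightarrow> (\<exists>r\<in>C. \<exists>s\<in>C.
     conj_class G (generate G {r, s}) r \<noteq> conj_class G (generate G {r, s}) s \<and>
     (r \<otimes>\<^bsub>G\<^esub> s) [^]\<^bsub>G\<^esub> (2::nat) \<noteq> (s \<otimes>\<^bsub>G\<^esub> r) [^]\<^bsub>G\<^esub> (2::nat))"

definition type_F :: "('g, 'b) monoid_scheme \<Rightarrow> 'g set \<Rightarrow> bool" where
  "type_F G C \<longleftrightarrow> (\<exists>r :: nat \<Rightarrow> 'g. r ` {1..4} \<subseteq> C \<and>
     (\<forall>a\<in>{1..4}. \<forall>b\<in>{1..4}. a \<noteq> b \<longrightarrow>
        conj_class G (generate G (r ` {1..4})) (r a) \<noteq>
        conj_class G (generate G (r ` {1..4})) (r b) \<and>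
        r a \<otimes>\<^bsub>G\<^esub> r b \<noteq> r b \<otimes>\<^bsub>G\<^esub> r a))"

definition kthulhu :: "('g, 'b) monoid_scheme \<Rightarrow> 'g set \<Rightarrow> bool" where
  "kthulhu G C \<longleftrightarrow> \<not> type_C G C \<and> \<not> type_D G C \<and> \<not> type_F G C"


section \<open>The linear groups\<close>

definition GL :: "nat \<Rightarrow> 'a :: field mat monoid" where
  "GL n = units_of (ring_mat TYPE('a) n ())"

definition SL :: "nat \<Rightarrow> 'a :: field mat monoid" where
  "SL n = (GL n)\<lparr>carrier := {A \<in> carrier (GL n). det A = 1}\<rparr>"

definition center :: "('g, 'b) monoid_scheme \<Rightarrow> 'g set" where
  "center G = {z \<in> carrier G. \<forall>g\<in>carrier G. z \<otimes>\<^bsub>G\<^esub> g = g \<otimes>\<^bsub>G\<^esub> z}"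

definition PSL :: "nat \<Rightarrow> 'a :: field mat set monoid" where
  "PSL n = SL n Mod center (SL n)"

definition PSL_image :: "nat \<Rightarrow> 'a :: field mat \<Rightarrow> 'a mat set" where
  "PSL_image n A = center (SL n) #>\<^bsub>SL n\<^esub> A"

definition irreducible_matrix :: "'a :: field mat \<Rightarrow> bool" where
  "irreducible_matrix A \<longleftrightarrow> Factorial_Ring.irreducible (char_poly A)"


section \<open>Coxeter tori\<close>

text \<open>Here \<open>'a\<close> is the finite field with \<open>q = CARD('a)\<close> elements, and \<open>'a alg_closure\<close> its
  algebraic closure, into which \<open>'a\<close> embeds by \<^const>\<open>to_ac\<close>.\<close>

definition frobenius ::
  "'a :: {finite, field} alg_closure mat \<Rightarrow> 'a alg_closure mat" where
  "frobenius = map_mat (\<lambda>c. c ^ CARD('a))"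

definition diagonal_torus :: "nat \<Rightarrow> 'a :: field mat set" where
  "diagonal_torus n = {D \<in> carrier (GL n). diagonal_mat D}"

text \<open>The maximal tori of \<open>GL\<^sub>n\<close> over an algebraically closed field are the conjugates of the
  diagonal torus.\<close>

definition conj_torus :: "nat \<Rightarrow> 'a :: field mat \<Rightarrow> 'a mat set" where
  "conj_torus n g = (\<lambda>t. g \<otimes>\<^bsub>GL n\<^esub> t \<otimes>\<^bsub>GL n\<^esub> inv\<^bsub>GL n\<^esub> g) ` diagonal_torus n"

text \<open>The normalizer of the diagonal torus consists of the monomial matrices, and the Weyl group
  is identified with the symmetric group on \<open>{..<n}\<close> by sending a monomial matrix to the
  permutation \<open>w\<close> with \<open>e\<^sub>j \<mapsto> c\<^sub>j e\<^bsub>w j\<^esub>\<close>.\<close>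

definition monomial_mat :: "nat \<Rightarrow> (nat \<Rightarrow> nat) \<Rightarrow> 'a :: field mat \<Rightarrow> bool" where
  "monomial_mat n w A \<longleftrightarrow> A \<in> carrier_mat n n \<and>
     (\<forall>i<n. \<forall>j<n. A $$ (i, j) \<noteq> 0 \<longleftrightarrow> i = w j)"

text \<open>\<open>S = gDg\<inverse>\<close> is an F-stable maximal torus corresponding to \<open>w\<close>: the element
  \<open>g\<inverse> F(g)\<close> normalizes the diagonal torus \<open>D\<close> and represents \<open>w\<close>.\<close>

definition F_stable_torus_of_type ::
  "nat \<Rightarrow> (nat \<Rightarrow> nat) \<Rightarrow> 'a :: {finite, field} alg_closure mat set \<Rightarrow> bool" where
  "F_stable_torus_of_type n w S \<longleftrightarrow> frobenius ` S = S \<and>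
     (\<exists>g\<in>carrier (GL n). S = conj_torus n g \<and>
        monomial_mat n w (inv\<^bsub>GL n\<^esub> g \<otimes>\<^bsub>GL n\<^esub> frobenius g))"

text \<open>The fixed points of F in \<open>S\<close> are the elements of \<open>S\<close> with entries in the base field; they
  are regarded as matrices over that field.\<close>

definition rational_points ::
  "nat \<Rightarrow> 'a :: {finite, field} alg_closure mat set \<Rightarrow> 'a mat set" where
  "rational_points n S = {A \<in> carrier (GL n). map_mat to_ac A \<in> S}"

definition n_cycle :: "nat \<Rightarrow> (nat \<Rightarrow> nat) \<Rightarrow> bool" where
  "n_cycle n w \<longleftrightarrow> w permutes {..<n} \<and> cyclic_on w {..<n}"

definition coxeter_torus_GL :: "nat \<Rightarrow> 'a :: {finite, field} mat set \<Rightarrow> bool" where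
  "coxeter_torus_GL n T \<longleftrightarrow>
     (\<exists>w S. n_cycle n w \<and> F_stable_torus_of_type n w S \<and> T = rational_points n S)"

definition coxeter_torus_SL :: "nat \<Rightarrow> 'a :: {finite, field} mat set \<Rightarrow> bool" where
  "coxeter_torus_SL n T \<longleftrightarrow> (\<exists>T'. coxeter_torus_GL n T' \<and> T = T' \<inter> carrier (SL n))"

end

theory Submission
  imports
    Defs
    "HOL-Algebra.Sylow"
    "HOL-Algebra.Group_Action"
    "HOL-Algebra.Elementary_Groups"
    "HOL-Number_Theory.Number_Theory"
begin

text \<open>An irreducible \<open>x\<close> in the torus has eigenvalues \<open>\<mu>, \<mu>\<^sup>q, \<mu>\<^sup>q\<^sup>\<cdot>\<^sup>q, \<dots>\<close> with Frobenius conjugate eigenvectors, so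
  that its centralizer in \<open>PSL\<^sub>n(q)\<close> is the abelian image of the torus, and this group is also the centralizer
  of each of its nontrivial elements. None of the types C, D, F can occur once we know that two conjugates
  \<open>r, s\<close> of \<open>x\<close> in a subgroup \<open>H\<close> of \<open>PSL\<^sub>n(q)\<close> are conjugate in \<open>H\<close> or commute. If they are not conjugate in
  \<open>H\<close>, then the centralizer \<open>A\<close> of \<open>r\<close> in \<open>H\<close> is malnormal and \<open>H\<close> is a Frobenius group with complement \<open>A\<close>,
  unless \<open>H = A\<close>. Its kernel contains a nontrivial abelian \<open>l\<close>-group \<open>B\<close> on which an element \<open>a \<in> A\<close> of prime
  order \<open>p > n + 1\<close> acts without fixed points. Lifting \<open>B\<close> to \<open>SL\<^sub>n(q)\<close>, one finds \<open>l = n\<close> and \<open>card B \<le> n\<^sup>2\<close>, which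
  contradicts \<open>card B \<equiv> 1\<close> modulo \<open>p\<close>.\<close>

section \<open>Fixed points of groups of prime power order\<close>

text \<open>Each of the three types asks for two non-commuting elements of the class in different
  classes of a common subgroup, so the dichotomy excludes all of them. The obstacle is the passage
  from PSL to SL: lifts of commuting elements commute only up to a scalar z with z^n = 1. If one
  lift is in the torus with eigenvalue \<mu>, a twist z \<noteq> 1 gives z \<mu> = \<mu>^(q^i) with
  0 < i < n, hence \<mu>^n is in the base field; as \<mu> has norm 1 and n is an odd prime, \<mu> is
  in the base field too (\<open>norm_one_fixed\<close>), which is excluded. Since the complement is
  abelian, the transfer yields its kernel and no characters enter. The bound on p has this origin: q
  has order n modulo p, so n divides p - 1, and p = n + 1 fails by parity. It is used because n^2 -
  1 = (n - 1)(n + 1), so that neither n nor n^2 is 1 modulo p. The prime l is n because a commutator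
  z in the lifted group satisfies both z^n = 1 and z^(l^k) = 1, and n^2 is the dimension of the
  matrix algebra, in which lifts of the elements of B are linearly independent.\<close>

lemma (in group) p_group_fixed_points:
  assumes P: "subgroup P G" "card P = p ^ k" and p: "Factorial_Ring.prime (p::nat)" and E: "finite E"
    and closed: "\<And>g x. g \<in> P \<Longrightarrow> x \<in> E \<Longrightarrow> f g x \<in> E"
    and one: "\<And>x. x \<in> E \<Longrightarrow> f \<one> x = x"
    and mult: "\<And>g h x. g \<in> P \<Longrightarrow> h \<in> P \<Longrightarrow> x \<in> E \<Longrightarrow> f (g \<otimes> h) x = f g (f h x)"
  shows "card {x \<in> E. \<forall>g\<in>P. f g x = x} mod p = card E mod p"
proof -
  \<comment> \<open>Restricting each \<open>f g\<close> to \<open>E\<close> gives an extensional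
    permutation, as the elements of \<open>BijGroup E\<close> have to be.\<close>
  let ?P = "G\<lparr>carrier := P\<rparr>" and ?\<phi> = "\<lambda>g. restrict (f g) E"
  interpret P: group ?P
    by (rule subgroup_imp_group[OF P(1)])
  have inv: "inv g \<in> P" "inv g \<otimes> g = \<one>" "g \<otimes> inv g = \<one>" if "g \<in> P" for g
    using that P(1) subgroup.mem_carrier[OF P(1)] by (auto intro: subgroup.m_inv_closed)
  have bij: "bij_betw (f g) E E" if "g \<in> P" for g
  proof (rule bij_betw_byWitness[where f' = "f (inv g)"])
    show "\<forall>x\<in>E. f (inv g) (f g x) = x" "\<forall>x\<in>E. f g (f (inv g) x) = x"
      using inv[OF that] that one mult by metis+
  qed (use closed inv that in auto)
  interpret group_action ?P E ?\<phi>
  proof (unfold group_action_def group_hom_def group_hom_axioms_def, intro conjI)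
    show "?\<phi> \<in> hom ?P (BijGroup E)"
    proof (rule homI)
      fix g assume g: "g \<in> carrier ?P"
      show "?\<phi> g \<in> carrier (BijGroup E)"
        using bij[of g] g by (auto simp: BijGroup_def Bij_def)
      fix h assume h: "h \<in> carrier ?P"
      show "?\<phi> (g \<otimes>\<^bsub>?P\<^esub> h) = ?\<phi> g \<otimes>\<^bsub>BijGroup E\<^esub> ?\<phi> h"
        using bij[of g] bij[of h] g h mult closed
        by (auto simp: BijGroup_def Bij_def compose_def fun_eq_iff)
    qed
  qed (use P.is_group group_BijGroup in auto)
  let ?F = "{x \<in> E. \<forall>g\<in>P. f g x = x}" and ?O = "orbits ?P E ?\<phi>"
  \<comment> \<open>Orbit sizes divide \<open>p ^ k\<close>. An orbit with a fixed point is a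
    singleton and counts 1 on both sides; any other has size divisible by \<open>p\<close> and
    counts 0 modulo \<open>p\<close> on both sides.\<close>
  have "(\<Sum>x\<in>orb. 1) mod p = (\<Sum>x\<in>orb. if x \<in> ?F then 1 else 0) mod p" if orbO: "orb \<in> ?O" for orb
  proof -
    obtain x where x: "x \<in> E" and orb: "orb = orbit ?P ?\<phi> x"
      using orbO by (auto simp: orbits_def)
    have orb': "orb = (\<lambda>g. f g x) ` P"
      using x by (auto simp: orb orbit_def)
    have fixed: "orb = {y}" if y: "y \<in> orb \<inter> ?F" for y
    proof -
      have "orb = orbit ?P ?\<phi> y"
        using disjoint_union[of orb "orbit ?P ?\<phi> y"] orbit_refl[of y] y orbO
        by (auto simp: orbits_def)
      also have "\<dots> = {y}"
        using y subgroup.one_closed[OF P(1)] by (auto simp: orbit_def intro!: exI[of _ \<one>])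
      finally show ?thesis .
    qed
    show ?thesis
    proof (cases "orb \<inter> ?F = {}")
      case False
      then obtain y where "y \<in> ?F" "orb = {y}"
        using fixed by blast
      then show ?thesis by simp
    next
      case True
      have "p ^ k = card orb * card (stabilizer ?P ?\<phi> x)"
        using orbit_stabilizer_theorem[OF x] P(2) by (simp add: order_def orb)
      then have "card orb dvd p ^ k" by simp
      then obtain i where i: "card orb = p ^ i"
        using p by (auto simp: divides_primepow_nat)
      have "i \<noteq> 0"
      proof
        assume "i = 0"
        then obtain y where y: "orb = {y}"
          using i by (auto simp: card_1_singleton_iff)
        have "x \<in> orb"
          using one[OF x] subgroup.one_closed[OF P(1)] by (force simp: orb')
        then have "\<forall>g\<in>P. f g x = x"
          using y orb' by blast
        with True x \<open>x \<in> orb\<close> show False by auto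
      qed
      then have "p dvd card orb"
        using i by (auto intro: dvd_power)
      moreover have "(\<Sum>x\<in>orb. if x \<in> ?F then 1 else 0) = (0::nat)"
        using True by (intro sum.neutral) auto
      ultimately show ?thesis by simp
    qed
  qed
  then have "(\<Sum>orb\<in>?O. (\<Sum>x\<in>orb. 1)) mod p = (\<Sum>orb\<in>?O. (\<Sum>x\<in>orb. if x \<in> ?F then 1 else 0)) mod p"
    by (subst (1 2) mod_sum_eq[symmetric]) (auto intro!: arg_cong[where f = "\<lambda>n. n mod p"] sum.cong)
  then have "(\<Sum>x\<in>E. 1) mod p = (\<Sum>x\<in>E. if x \<in> ?F then 1 else 0) mod p"
    by (simp only: disjoint_sum[OF E])
  moreover have "(\<Sum>x\<in>E. if x \<in> ?F then 1 else (0::nat)) = card ?F"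
    using E by (simp flip: sum.inter_filter)
  ultimately show ?thesis by simp
qed

text \<open>The iterates of \<open>f\<close> form an action of Z/p, because \<open>f ^^ p\<close> is
  the identity on \<open>E\<close>. In this form the congruence applies to a single map: a
  conjugation, a translation of cosets or a permutation of Sylow subgroups.\<close>

lemma funpow_prime_fixed_points:
  assumes p: "Factorial_Ring.prime (p::nat)" and E: "finite E"
    and closed: "\<And>x. x \<in> E \<Longrightarrow> f x \<in> E" and per: "\<And>x. x \<in> E \<Longrightarrow> (f ^^ p) x = x"
  shows "card {x \<in> E. f x = x} mod p = card E mod p"
proof -
  interpret Z: group "integer_mod_group p" by simp
  have closed': "(f ^^ k) x \<in> E" if "x \<in> E" for k x
    by (induction k) (use that closed in auto)
  have "card {x \<in> E. \<forall>i\<in>carrier (integer_mod_group p). (f ^^ nat i) x = x} mod p = card E mod p"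
  proof (rule Z.p_group_fixed_points[where k = 1])
    show "card (carrier (integer_mod_group p)) = p ^ 1"
      using p by (simp add: carrier_integer_mod_group)
    fix i j x assume ij: "i \<in> carrier (integer_mod_group p)" "j \<in> carrier (integer_mod_group p)" and x: "x \<in> E"
    have "nat ((i + j) mod int p) = (nat i + nat j) mod p"
      using ij p by (auto simp: carrier_integer_mod_group nat_mod_distrib nat_add_distrib split: if_splits)
    then have "(f ^^ nat (i \<otimes>\<^bsub>integer_mod_group p\<^esub> j)) x = (f ^^ (nat i + nat j)) x"
      by (simp add: mult_integer_mod_group funpow_mod_eq[OF per[OF x]])
    then show "(f ^^ nat (i \<otimes>\<^bsub>integer_mod_group p\<^esub> j)) x = (f ^^ nat i) ((f ^^ nat j) x)"
      by (simp add: funpow_add)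
  qed (use p E closed' Z.subgroup_self in auto)
  moreover have "(\<forall>i\<in>carrier (integer_mod_group p). (f ^^ nat i) x = x) \<longleftrightarrow> f x = x" if "x \<in> E" for x
  proof
    have "1 \<in> carrier (integer_mod_group p)"
      using prime_gt_1_nat[OF p] by (simp add: carrier_integer_mod_group)
    moreover assume "\<forall>i\<in>carrier (integer_mod_group p). (f ^^ nat i) x = x"
    ultimately have "(f ^^ nat 1) x = x" by blast
    then show "f x = x" by simp
  next
    assume "f x = x"
    then have "(f ^^ k) x = x" for k by (induction k) auto
    then show "\<forall>i\<in>carrier (integer_mod_group p). (f ^^ nat i) x = x" by blast
  qed
  then have "{x \<in> E. \<forall>i\<in>carrier (integer_mod_group p). (f ^^ nat i) x = x} = {x \<in> E. f x = x}"
    by blast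
  ultimately show ?thesis by simp
qed

section \<open>Conjugation and Sylow subgroups\<close>

lemma (in group) inv_mult_cancel_left:
  assumes "x \<in> carrier G" "y \<in> carrier G"
  shows "inv x \<otimes> (x \<otimes> y) = y" "x \<otimes> (inv x \<otimes> y) = y"
  using assms m_assoc[of "inv x" x y, symmetric] m_assoc[of x "inv x" y, symmetric] by simp_all

lemma (in group) conj_mult:
  assumes "a \<in> carrier G" "x \<in> carrier G" "y \<in> carrier G"
  shows "a \<otimes> (x \<otimes> y) \<otimes> inv a = (a \<otimes> x \<otimes> inv a) \<otimes> (a \<otimes> y \<otimes> inv a)"
  using assms by (simp add: m_assoc inv_mult_cancel_left)

lemma (in group) conj_conj:
  assumes "a \<in> carrier G" "b \<in> carrier G" "x \<in> carrier G"
  shows "a \<otimes> (b \<otimes> x \<otimes> inv b) \<otimes> inv a = (a \<otimes> b) \<otimes> x \<otimes> inv (a \<otimes> b)"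
  using assms by (simp add: m_assoc inv_mult_group)

lemma (in group) conj_nat_pow:
  assumes "a \<in> carrier G" "x \<in> carrier G"
  shows "(a \<otimes> x \<otimes> inv a) [^] (k::nat) = a \<otimes> x [^] k \<otimes> inv a"
proof (induction k)
  case (Suc k)
  then show ?case using conj_mult[of a "x [^] k" x] assms by simp
qed (use assms in simp)

lemma (in group) conj_inj:
  assumes "a \<in> carrier G" "x \<in> carrier G" "y \<in> carrier G" "a \<otimes> x \<otimes> inv a = a \<otimes> y \<otimes> inv a"
  shows "x = y"
  using assms by simp

lemma (in group) conj_eq_self_iff:
  assumes "a \<in> carrier G" "x \<in> carrier G"
  shows "a \<otimes> x \<otimes> inv a = x \<longleftrightarrow> a \<otimes> x = x \<otimes> a"
proof -
  have "a \<otimes> x = (a \<otimes> x \<otimes> inv a) \<otimes> a"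
    using assms by (simp add: m_assoc)
  moreover have "(x \<otimes> a) \<otimes> inv a = x"
    using assms by (simp add: m_assoc)
  ultimately show ?thesis by metis
qed

lemma (in group) funpow_conj:
  assumes "a \<in> carrier G" "x \<in> carrier G"
  shows "((\<lambda>x. a \<otimes> x \<otimes> inv a) ^^ k) x = a [^] k \<otimes> x \<otimes> inv (a [^] k)"
proof (induction k)
  case (Suc k)
  have "a [^] Suc k = a \<otimes> a [^] k"
    by (rule nat_pow_Suc2[OF assms(1)])
  then show ?case using Suc conj_conj[of a "a [^] k" x] assms by (simp del: nat_pow_Suc)
qed (use assms in simp)

text \<open>\<open>L\<close> acts on itself by conjugation with its centre as the set of fixed
  points, so the order of the centre is 0 modulo \<open>p\<close> and cannot be 1.\<close>

lemma (in group) p_subgroup_center_nontrivial: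
  assumes L: "subgroup L G" "card L = p ^ k" and k: "k > 0" and p: "Factorial_Ring.prime (p::nat)"
  shows "\<exists>z\<in>L. z \<noteq> \<one> \<and> (\<forall>g\<in>L. g \<otimes> z = z \<otimes> g)"
proof -
  have carr: "g \<in> carrier G" if "g \<in> L" for g
    using that subgroup.mem_carrier[OF L(1)] by blast
  have fin: "finite L"
    using L(2) p card.infinite[of L] by (auto simp: prime_gt_0_nat)
  let ?F = "{z \<in> L. \<forall>g\<in>L. g \<otimes> z \<otimes> inv g = z}"
  have "card ?F mod p = card L mod p"
    using L p fin carr
    by (intro p_group_fixed_points[where k = k])
       (auto simp: conj_conj intro: subgroup.m_closed subgroup.m_inv_closed)
  also have "card L mod p = 0"
    using L(2) k by (simp add: power_eq_if)
  finally have "card ?F \<noteq> 1"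
    using prime_gt_1_nat[OF p] by auto
  moreover have "\<one> \<in> ?F"
    using carr subgroup.one_closed[OF L(1)] by auto
  ultimately obtain z where "z \<in> ?F" "z \<noteq> \<one>"
    by (metis (no_types, lifting) card_1_singleton_iff is_singletonI' is_singleton_def empty_iff One_nat_def)
  then show ?thesis
    using carr conj_eq_self_iff by (auto intro!: bexI[of _ z])
qed

lemma (in group) conj_subgroup:
  assumes M: "subgroup M G" and x: "x \<in> carrier G"
  shows "subgroup ((\<lambda>y. x \<otimes> y \<otimes> inv x) ` M) G"
proof (rule subgroupI)
  have carr: "y \<in> carrier G" if "y \<in> M" for y
    using that subgroup.mem_carrier[OF M] by blast
  show "(\<lambda>y. x \<otimes> y \<otimes> inv x) ` M \<subseteq> carrier G"
    using carr x by auto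
  show "(\<lambda>y. x \<otimes> y \<otimes> inv x) ` M \<noteq> {}"
    using subgroup.one_closed[OF M] by auto
  fix u assume "u \<in> (\<lambda>y. x \<otimes> y \<otimes> inv x) ` M"
  then obtain y where y: "y \<in> M" "u = x \<otimes> y \<otimes> inv x" by auto
  have "inv u = x \<otimes> inv y \<otimes> inv x"
    using y carr x by (simp add: inv_mult_group m_assoc)
  then show "inv u \<in> (\<lambda>y. x \<otimes> y \<otimes> inv x) ` M"
    using y subgroup.m_inv_closed[OF M] by auto
  fix v assume "v \<in> (\<lambda>y. x \<otimes> y \<otimes> inv x) ` M"
  then obtain z where z: "z \<in> M" "v = x \<otimes> z \<otimes> inv x" by auto
  have "u \<otimes> v = x \<otimes> (y \<otimes> z) \<otimes> inv x"
    using y z carr x conj_mult by simp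
  then show "u \<otimes> v \<in> (\<lambda>y. x \<otimes> y \<otimes> inv x) ` M"
    using y z subgroup.m_closed[OF M] by auto
qed

lemma (in group) card_conj_image:
  assumes "M \<subseteq> carrier G" and "x \<in> carrier G"
  shows "card ((\<lambda>y. x \<otimes> y \<otimes> inv x) ` M) = card M"
  using assms by (intro card_image inj_onI) (auto dest: conj_inj)

text \<open>\<open>M\<close> acts by translation on the cosets of \<open>L\<close>, whose number
  \<open>m\<close> is prime to \<open>p\<close>, so some coset \<open>L #> x\<close> is fixed. This
  means that \<open>x\<close> conjugates \<open>M\<close> into \<open>L\<close>, and the orders
  agree.\<close>

lemma (in group) sylow_conjugate:
  assumes p: "Factorial_Ring.prime p" and fin: "finite (carrier G)"
    and ord: "order G = p ^ k * m" and m: "\<not> p dvd m"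
    and L: "subgroup L G" "card L = p ^ k" and M: "subgroup M G" "card M = p ^ k"
  shows "\<exists>x\<in>carrier G. (\<lambda>y. x \<otimes> y \<otimes> inv x) ` M = L"
proof -
  have carr: "g \<in> carrier G" if "g \<in> M" for g
    using that subgroup.mem_carrier[OF M(1)] by blast
  have sub: "L \<subseteq> carrier G"
    by (rule subgroup.subset[OF L(1)])
  have "card (rcosets L) * p ^ k = p ^ k * m"
    using lagrange[OF L(1)] L(2) ord by simp
  then have card_E: "card (rcosets L) = m"
    using p by auto
  \<comment> \<open>The inverse turns right translation into a left action.\<close>
  let ?F = "{C \<in> rcosets L. \<forall>g\<in>M. C #> inv g = C}"
  have "card ?F mod p = card (rcosets L) mod p"
  proof (rule p_group_fixed_points[OF M p])
    show "finite (rcosets L)"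
      using fin sub by (metis cosets_finite rcosets_subset_PowG finite_Pow_iff finite_subset L(1))
  next
    fix g C assume "g \<in> M" "C \<in> rcosets L"
    then show "C #> inv g \<in> rcosets L"
      using sub carr by (auto simp: RCOSETS_def coset_mult_assoc)
  next
    fix C assume "C \<in> rcosets L"
    then show "C #> inv \<one> = C"
      using sub by (auto simp: RCOSETS_def coset_mult_assoc)
  next
    fix g h C assume "g \<in> M" "h \<in> M" "C \<in> rcosets L"
    then show "C #> inv (g \<otimes> h) = C #> inv h #> inv g"
      using sub carr by (auto simp: RCOSETS_def coset_mult_assoc inv_mult_group m_assoc)
  qed
  then have "card ?F \<noteq> 0"
    using m card_E by (metis dvd_eq_mod_eq_0 mod_0)
  then have "?F \<noteq> {}" by (metis card.empty)
  then obtain C where C: "C \<in> ?F" by blast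
  then obtain x where x: "x \<in> carrier G" "C = L #> x"
    by (auto simp: RCOSETS_def)
  have "x \<otimes> y \<otimes> inv x \<in> L" if y: "y \<in> M" for y
  proof -
    have "L #> x #> inv (inv y) = L #> x"
      using C x y subgroup.m_inv_closed[OF M(1)] by blast
    then have "L #> (x \<otimes> y) = L #> x"
      using x carr[OF y] sub by (simp add: coset_mult_assoc)
    then have "x \<otimes> y \<in> L #> x"
      using x carr[OF y] L(1) by (metis m_closed rcos_self)
    then obtain l where "l \<in> L" "x \<otimes> y = l \<otimes> x"
      by (auto simp: r_coset_def)
    then show ?thesis
      using x sub by (simp add: m_assoc subsetD)
  qed
  then have "(\<lambda>y. x \<otimes> y \<otimes> inv x) ` M \<subseteq> L" by auto
  moreover have "card ((\<lambda>y. x \<otimes> y \<otimes> inv x) ` M) = card L"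
    using card_conj_image[OF subgroup.subset[OF M(1)] x(1)] L M by simp
  ultimately show ?thesis
    using x(1) card_subset_eq[OF finite_subset[OF sub fin]] by blast
qed

text \<open>Conjugation by \<open>a\<close> permutes the Sylow \<open>l\<close>-subgroups of
  \<open>K\<close>. Their number divides \<open>card K\<close>, so it is not 0 modulo
  \<open>p\<close>, and one of them is fixed by \<open>a\<close>.\<close>

lemma (in group) prime_automorphism_invariant_sylow:
  assumes fin: "finite (carrier G)" and K: "K \<lhd> G" and l: "Factorial_Ring.prime (l::nat)" "l dvd card K"
    and a: "a \<in> carrier G" "a [^] p = \<one>" and p: "Factorial_Ring.prime (p::nat)" "\<not> p dvd card K"
  obtains L k where "subgroup L G" "L \<subseteq> K" "card L = l ^ k" "k > 0" "(\<lambda>y. a \<otimes> y \<otimes> inv a) ` L = L"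
proof -
  interpret K: normal K G by (rule K)
  let ?K = "G\<lparr>carrier := K\<rparr>" and ?c = "\<lambda>x M. (\<lambda>y. x \<otimes> y \<otimes> inv x) ` M"
  interpret K': group ?K by (rule subgroup_imp_group[OF K.subgroup_axioms])
  have finK: "finite K"
    using fin K.subset finite_subset by blast
  have "card K \<noteq> 0"
    using finK K.one_closed by (metis card_0_eq empty_iff)
  then obtain m k where m: "card K = l ^ k * m" "\<not> l dvd m"
    using multiplicity_decompose'[of "card K" l] l(1) by (metis not_prime_unit)
  have k: "k > 0"
    using m l by (cases k) auto
  obtain L where L: "subgroup L ?K" "card L = l ^ k"
    using sylow_thm[OF l(1) K'.is_group, of k m] m finK by (auto simp: order_def)
  have conjK: "x \<otimes> y \<otimes> inv x \<in> K" if "x \<in> carrier G" "y \<in> K" for x y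
    using that K.inv_op_closed2 by blast
  have LK: "L \<subseteq> K"
    using subgroup.subset[OF L(1)] by simp
  have cc: "?c x (?c y M) = ?c (x \<otimes> y) M" if "x \<in> carrier G" "y \<in> carrier G" "M \<subseteq> carrier G" for x y M
    using that by (auto simp: image_image conj_conj subset_iff intro!: image_cong)
  have c1: "?c \<one> M = M" if "M \<subseteq> carrier G" for M
  proof -
    have "?c \<one> M = id ` M" using that by (intro image_cong) auto
    then show ?thesis by simp
  qed
  \<comment> \<open>The \<open>K\<close>-orbit of \<open>L\<close>; orbit-stabilizer shows that its
    size divides \<open>card K\<close>. It is stable under \<open>a\<close> because a conjugate by
    \<open>a\<close> of a member is again a Sylow subgroup of \<open>K\<close> and hence conjugate
    to \<open>L\<close> within \<open>K\<close>.\<close>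
  let ?E = "(\<lambda>x. ?c x L) ` K"
  have subE: "M \<subseteq> carrier G" if "M \<in> ?E" for M
    using that LK K.subset by auto
  let ?\<phi> = "\<lambda>g. \<lambda>H\<in>{H. subgroup H ?K}. g <#\<^bsub>?K\<^esub> H #>\<^bsub>?K\<^esub> inv\<^bsub>?K\<^esub> g"
  have "g <#\<^bsub>?K\<^esub> L #>\<^bsub>?K\<^esub> inv\<^bsub>?K\<^esub> g = ?c g L" if "g \<in> K" for g
    using that m_inv_consistent[OF K.subgroup_axioms that] by (auto simp: l_coset_def r_coset_def image_def)
  then have orb: "Group_Action.orbit ?K ?\<phi> L = ?E"
    using L(1) by (auto simp: Group_Action.orbit_def)
  have "card ?E dvd card K"
    using group_action.orbit_stabilizer_theorem[OF K'.action_by_conjugation_on_subgroups_set, of L] L(1)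
    unfolding orb by (auto simp: order_def intro: dvdI[OF sym])
  then have pE: "\<not> p dvd card ?E"
    using p(2) dvd_trans by blast
  have finE: "finite ?E"
    using finK by simp
  have pow: "(?c a ^^ i) M = ?c (a [^] i) M" if "M \<in> ?E" for i M
  proof (induction i)
    case 0
    then show ?case using c1[OF subE[OF that]] by simp
  next
    case (Suc i)
    have "a [^] Suc i = a \<otimes> a [^] i"
      by (rule nat_pow_Suc2[OF a(1)])
    then show ?case using Suc a cc[of a "a [^] i" M] subE[OF that] by (simp del: nat_pow_Suc)
  qed
  have "card {M \<in> ?E. ?c a M = M} mod p = card ?E mod p"
  proof (rule funpow_prime_fixed_points[OF p(1) finE])
    fix M assume M: "M \<in> ?E"
    show "(?c a ^^ p) M = M"
      using pow[OF M] a c1[OF subE[OF M]] by simp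
    obtain x where x: "x \<in> K" "M = ?c x L"
      using M by blast
    have LG: "subgroup L G"
      using incl_subgroup[OF K.subgroup_axioms L(1)] .
    have xG: "x \<in> carrier G" and LsubG: "L \<subseteq> carrier G"
      using x K.subset LK by auto
    have eq: "?c a M = ?c (a \<otimes> x) L"
      using cc[of a x L] a xG LsubG x(2) by simp
    have "subgroup (?c (a \<otimes> x) L) G"
      using conj_subgroup[OF LG] a xG by simp
    moreover have "?c (a \<otimes> x) L \<subseteq> K"
      using conjK a xG LK by auto
    ultimately have "subgroup (?c a M) ?K"
      using subgroup_incl[OF _ K.subgroup_axioms] eq by simp
    moreover have "card (?c a M) = l ^ k"
      using card_conj_image[OF LsubG, of "a \<otimes> x"] a xG L(2) eq by simp
    ultimately obtain z where z: "z \<in> K" "(\<lambda>y. z \<otimes>\<^bsub>?K\<^esub> y \<otimes>\<^bsub>?K\<^esub> inv\<^bsub>?K\<^esub> z) ` ?c a M = L"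
      using K'.sylow_conjugate[OF l(1) _ _ m(2) L, of "?c a M"] m(1) finK by (auto simp: order_def)
    have zG: "z \<in> carrier G"
      using z(1) K.subset by blast
    have "?c z (?c a M) = L"
      using z m_inv_consistent[OF K.subgroup_axioms z(1)] by simp
    then have "?c (inv z) L = ?c (inv z) (?c z (?c a M))"
      by simp
    also have "\<dots> = ?c a M"
      using cc[of "inv z" z "?c a M"] zG c1[of "?c a M"] \<open>?c (a \<otimes> x) L \<subseteq> K\<close> K.subset eq by simp
    finally show "?c a M \<in> ?E"
      using z(1) K.m_inv_closed by blast
  qed
  then have "card {M \<in> ?E. ?c a M = M} \<noteq> 0"
    using pE by (intro notI) (simp add: dvd_eq_mod_eq_0)
  then have "{M \<in> ?E. ?c a M = M} \<noteq> {}" by (metis card.empty)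
  then obtain M where M: "M \<in> ?E" "?c a M = M" by blast
  then obtain x where x: "x \<in> K" "M = ?c x L" by blast
  have xG: "x \<in> carrier G" and LsubG: "L \<subseteq> carrier G"
    using x K.subset LK by auto
  have "subgroup M G"
    using conj_subgroup[OF incl_subgroup[OF K.subgroup_axioms L(1)] xG] x(2) by simp
  moreover have "M \<subseteq> K"
    using x conjK xG LK by auto
  moreover have "card M = l ^ k"
    using card_conj_image[OF LsubG xG] L(2) x(2) by simp
  ultimately show ?thesis
    using that k M(2) by blast
qed

section \<open>Transfer into a malnormal abelian subgroup\<close>

text \<open>In a double coset \<open>A u A\<close> outside \<open>A\<close> the coordinates
  \<open>b\<close>, \<open>c\<close> of an element \<open>b u c\<close> are unique: two expressions
  for one element give some \<open>y\<close> in \<open>A\<close> whose conjugate by \<open>u\<close>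
  is in \<open>A\<close>, and malnormality yields \<open>y = \<one>\<close>. The section reads off
  \<open>b\<close>, so outside \<open>A\<close> it ignores right multiplication by \<open>A\<close>.
  The transfer is computed from it.\<close>

lemma (in group) malnormal_abelian_double_coset_section:
  assumes A: "subgroup A G"
    and TI: "\<forall>t\<in>carrier G - A. \<forall>y\<in>A. t \<otimes> y \<otimes> inv t \<in> A \<longrightarrow> y = \<one>"
  shows "\<exists>\<tau>. (\<forall>t\<in>carrier G. \<tau> t \<in> A) \<and> (\<forall>t\<in>A. \<tau> t = t) \<and>
    (\<forall>t\<in>carrier G - A. \<forall>x\<in>A. \<forall>y\<in>A. \<tau> (x \<otimes> t \<otimes> y) = x \<otimes> \<tau> t)"
proof -
  interpret A: subgroup A G by (rule A)
  \<comment> \<open>\<open>D t\<close> is the double coset of \<open>t\<close>. The representative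
    \<open>u t\<close> is chosen from the set \<open>D t\<close> alone, so by \<open>D_eq\<close> it
    is constant on the double coset.\<close>
  define D where "D t = {b \<otimes> t \<otimes> c | b c. b \<in> A \<and> c \<in> A}" for t
  define u where "u t = (SOME z. z \<in> D t)" for t
  define \<tau> where "\<tau> t = (if t \<in> A then t else THE b. b \<in> A \<and> (\<exists>c\<in>A. t = b \<otimes> u t \<otimes> c))" for t
  have D_self: "t \<in> D t" if "t \<in> carrier G" for t
    using that A.one_closed unfolding D_def by (auto intro!: exI[of _ \<one>])
  have D_sub: "D (x \<otimes> t \<otimes> y) \<subseteq> D t" if "t \<in> carrier G" "x \<in> A" "y \<in> A" for t x y
  proof
    fix z assume "z \<in> D (x \<otimes> t \<otimes> y)"
    then obtain b c where "b \<in> A" "c \<in> A" "z = b \<otimes> (x \<otimes> t \<otimes> y) \<otimes> c"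
      by (auto simp: D_def)
    then have "z = (b \<otimes> x) \<otimes> t \<otimes> (y \<otimes> c)" "b \<otimes> x \<in> A" "y \<otimes> c \<in> A"
      using that by (auto simp: m_assoc)
    then show "z \<in> D t" by (auto simp: D_def)
  qed
  have D_eq: "D (x \<otimes> t \<otimes> y) = D t" if t: "t \<in> carrier G" "x \<in> A" "y \<in> A" for t x y
  proof
    have "t = inv x \<otimes> (x \<otimes> t \<otimes> y) \<otimes> inv y"
      using t by (simp add: m_assoc inv_mult_cancel_left)
    then show "D t \<subseteq> D (x \<otimes> t \<otimes> y)"
      using D_sub[of "x \<otimes> t \<otimes> y" "inv x" "inv y"] t by simp
  qed (rule D_sub[OF t])
  have u_D: "u t \<in> D t" if "t \<in> carrier G" for t
    using D_self[OF that] by (auto simp: u_def intro: someI)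
  have mem: "x \<otimes> t \<otimes> y \<in> A \<longleftrightarrow> t \<in> A" if t: "t \<in> carrier G" "x \<in> A" "y \<in> A" for t x y
  proof
    assume "x \<otimes> t \<otimes> y \<in> A"
    then have "inv x \<otimes> (x \<otimes> t \<otimes> y) \<otimes> inv y \<in> A"
      using t by blast
    then show "t \<in> A" using t by (simp add: m_assoc inv_mult_cancel_left)
  qed (use t in auto)
  have ex: "\<exists>b\<in>A. \<exists>c\<in>A. t = b \<otimes> u t \<otimes> c" and uA: "t \<notin> A \<Longrightarrow> u t \<notin> A" and uG: "u t \<in> carrier G"
    if t: "t \<in> carrier G" for t
  proof -
    obtain b c where bc: "b \<in> A" "c \<in> A" "u t = b \<otimes> t \<otimes> c"
      using u_D[OF t] by (auto simp: D_def)
    then have "t = inv b \<otimes> u t \<otimes> inv c"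
      using t by (simp add: m_assoc inv_mult_cancel_left)
    then show "\<exists>b\<in>A. \<exists>c\<in>A. t = b \<otimes> u t \<otimes> c" using bc by blast
    show "t \<notin> A \<Longrightarrow> u t \<notin> A" "u t \<in> carrier G" using bc t mem by auto
  qed
  have uniq: "b = b'" if t: "t \<in> carrier G" "t \<notin> A" and "b \<in> A" "b' \<in> A" "c \<in> A" "c' \<in> A"
    and eq: "b \<otimes> u t \<otimes> c = b' \<otimes> u t \<otimes> c'" for t b b' c c'
  proof -
    have "u t \<otimes> (c \<otimes> inv c') \<otimes> inv (u t) = inv b \<otimes> (b \<otimes> u t \<otimes> c) \<otimes> inv c' \<otimes> inv (u t)"
      using that(3-6) uG[OF t(1)] by (simp add: m_assoc inv_mult_cancel_left)
    also have "\<dots> = inv b \<otimes> b'"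
      unfolding eq using that uG[OF t(1)] by (simp add: m_assoc inv_mult_cancel_left)
    finally have *: "u t \<otimes> (c \<otimes> inv c') \<otimes> inv (u t) = inv b \<otimes> b'" .
    then have "c \<otimes> inv c' = \<one>"
      using TI uG[OF t(1)] uA[OF t] that by auto
    then have "inv b \<otimes> b' = \<one>" using * uG[OF t(1)] by simp
    then have "b \<otimes> (inv b \<otimes> b') = b" using that by simp
    then show "b = b'" using that by (simp add: inv_mult_cancel_left)
  qed
  have \<tau>: "\<tau> t = b" if "t \<in> carrier G" "t \<notin> A" "b \<in> A" "c \<in> A" "t = b \<otimes> u t \<otimes> c" for t b c
    unfolding \<tau>_def using that uniq[OF that(1,2)] by (auto intro!: the_equality)
  show ?thesis
  proof (intro exI[of _ \<tau>] conjI ballI)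
    fix t assume t: "t \<in> carrier G"
    show "\<tau> t \<in> A"
    proof (cases "t \<in> A")
      case False
      then show ?thesis using ex[OF t] \<tau>[OF t False] by metis
    qed (simp add: \<tau>_def)
  next
    fix t x y assume "t \<in> carrier G - A" and x: "x \<in> A" and y: "y \<in> A"
    then have t: "t \<in> carrier G" and tA: "t \<notin> A" by auto
    obtain b c where bc: "b \<in> A" "c \<in> A" "t = b \<otimes> u t \<otimes> c" using ex[OF t] by blast
    have u_eq: "u (x \<otimes> t \<otimes> y) = u t"
      using D_eq[OF t x y] by (simp add: u_def)
    have "x \<otimes> t \<otimes> y = x \<otimes> (b \<otimes> u t \<otimes> c) \<otimes> y"
      by (subst bc(3)[symmetric]) (rule refl)
    also have "\<dots> = (x \<otimes> b) \<otimes> u (x \<otimes> t \<otimes> y) \<otimes> (c \<otimes> y)"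
      using bc(1,2) x y uG[OF t] by (simp add: m_assoc u_eq)
    finally have "\<tau> (x \<otimes> t \<otimes> y) = x \<otimes> b"
      using bc(1,2) x y t tA mem[OF t x y] by (intro \<tau>[where c = "c \<otimes> y"]) auto
    then show "\<tau> (x \<otimes> t \<otimes> y) = x \<otimes> \<tau> t"
      using \<tau>[OF t tA bc] by simp
  qed (simp add: \<tau>_def)
qed

text \<open>The transfer of \<open>g\<close> is the product over all cosets \<open>A #> t\<close> of
  \<open>\<tau> (t \<otimes> g) \<otimes> inv (\<tau> t)\<close>. On \<open>A\<close> it is the
  identity: the coset \<open>A\<close> contributes the element itself and every other coset
  contributes \<open>\<one>\<close>, as \<open>\<tau>\<close> ignores right multiplication there.
  Its kernel is therefore a normal complement of \<open>A\<close>.\<close>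

lemma (in group) malnormal_abelian_normal_complement:
  assumes fin: "finite (carrier G)" and A: "subgroup A G"
    and comm: "\<And>x y. x \<in> A \<Longrightarrow> y \<in> A \<Longrightarrow> x \<otimes> y = y \<otimes> x"
    and TI: "\<forall>t\<in>carrier G - A. \<forall>y\<in>A. t \<otimes> y \<otimes> inv t \<in> A \<longrightarrow> y = \<one>"
  obtains K where "K \<lhd> G" "K \<inter> A = {\<one>}" "\<And>g. g \<in> carrier G \<Longrightarrow> \<exists>b\<in>A. g \<otimes> inv b \<in> K"
proof -
  obtain \<tau> where \<tau>: "\<forall>t\<in>carrier G. \<tau> t \<in> A" "\<forall>t\<in>A. \<tau> t = t"
      "\<forall>t\<in>carrier G - A. \<forall>x\<in>A. \<forall>y\<in>A. \<tau> (x \<otimes> t \<otimes> y) = x \<otimes> \<tau> t"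
    using malnormal_abelian_double_coset_section[OF A TI] by blast
  then have \<tau>_closed: "\<And>t. t \<in> carrier G \<Longrightarrow> \<tau> t \<in> A" and \<tau>_A: "\<And>t. t \<in> A \<Longrightarrow> \<tau> t = t"
    and \<tau>_mult: "\<And>x t y. t \<in> carrier G \<Longrightarrow> t \<notin> A \<Longrightarrow> x \<in> A \<Longrightarrow> y \<in> A \<Longrightarrow> \<tau> (x \<otimes> t \<otimes> y) = x \<otimes> \<tau> t"
    by auto
  interpret A: subgroup A G by (rule A)
  let ?A = "G\<lparr>carrier := A\<rparr>"
  interpret A': comm_group ?A
    by (rule group.group_comm_groupI[OF subgroup_imp_group[OF A]]) (simp add: comm)
  have \<tau>_left: "\<tau> (x \<otimes> t) = x \<otimes> \<tau> t" if t: "t \<in> carrier G" and x: "x \<in> A" for x t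
  proof (cases "t \<in> A")
    case True
    then show ?thesis using x \<tau>_A by simp
  next
    case False
    then show ?thesis using \<tau>_mult[OF t False x A.one_closed] t x by simp
  qed
  \<comment> \<open>The chosen representative is immaterial: replacing \<open>t\<close> by
    \<open>b \<otimes> t\<close> multiplies both values of \<open>\<tau>\<close> by
    \<open>b\<close>, which cancels as \<open>A\<close> is abelian.\<close>
  define \<phi> where "\<phi> g C = (let t = SOME t. t \<in> C in \<tau> (t \<otimes> g) \<otimes> inv (\<tau> t))" for g C
  have \<phi>: "\<phi> g (A #> t) = \<tau> (t \<otimes> g) \<otimes> inv (\<tau> t)" if g: "g \<in> carrier G" and t: "t \<in> carrier G" for g t
  proof -
    define s where "s = (SOME s. s \<in> A #> t)"
    have "s \<in> A #> t"
      unfolding s_def using rcos_self[OF t A] by (rule someI)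
    then obtain b where b: "b \<in> A" "s = b \<otimes> t" by (auto simp: r_coset_def)
    have "\<phi> g (A #> t) = \<tau> (b \<otimes> (t \<otimes> g)) \<otimes> inv (\<tau> (b \<otimes> t))"
      using b t g by (simp add: \<phi>_def s_def[symmetric] m_assoc)
    also have "\<dots> = (b \<otimes> \<tau> (t \<otimes> g)) \<otimes> inv (b \<otimes> \<tau> t)"
      using b t g \<tau>_left by simp
    also have "\<dots> = (\<tau> (t \<otimes> g) \<otimes> b) \<otimes> inv (\<tau> t \<otimes> b)"
      using comm b \<tau>_closed t g by simp
    also have "\<dots> = \<tau> (t \<otimes> g) \<otimes> inv (\<tau> t)"
      using b \<tau>_closed[of "t \<otimes> g"] \<tau>_closed[of t] t g by (simp add: m_assoc inv_mult_group inv_mult_cancel_left)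
    finally show ?thesis .
  qed
  have \<phi>_closed: "\<phi> g C \<in> A" if g: "g \<in> carrier G" and C: "C \<in> rcosets A" for g C
    using C \<phi>[OF g] \<tau>_closed g by (auto simp: RCOSETS_def)
  have finE: "finite (rcosets A)"
    using fin by (metis rcosets_subset_PowG finite_Pow_iff finite_subset A)
  define tr :: "'a \<Rightarrow> 'a" where "tr g = finprod ?A (\<phi> g) (rcosets A)" for g
  have tr_closed: "tr g \<in> A" if "g \<in> carrier G" for g
    using A'.finprod_closed[of "\<phi> g" "rcosets A"] \<phi>_closed[OF that] by (auto simp: tr_def)
  have tr_mult: "tr (g \<otimes> h) = tr g \<otimes> tr h" if g: "g \<in> carrier G" and h: "h \<in> carrier G" for g h
  proof -
    \<comment> \<open>Translation by \<open>g\<close> permutes the cosets; once the product for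
      \<open>h\<close> is reindexed in this way, the factors of \<open>tr g\<close> and
      \<open>tr h\<close> telescope.\<close>
    have img: "(\<lambda>C. C #> g) ` (rcosets A) = rcosets A"
    proof (intro equalityI subsetI)
      fix C assume "C \<in> rcosets A"
      then obtain t where t: "t \<in> carrier G" "C = A #> t" by (auto simp: RCOSETS_def)
      then have "C = (A #> (t \<otimes> inv g)) #> g"
        using g A.subset by (simp add: coset_mult_assoc m_assoc)
      then show "C \<in> (\<lambda>C. C #> g) ` (rcosets A)"
        using t(1) g by (intro image_eqI[of _ _ "A #> (t \<otimes> inv g)"]) (auto simp: RCOSETS_def)
    next
      fix C assume "C \<in> (\<lambda>C. C #> g) ` (rcosets A)"
      then show "C \<in> rcosets A"
        using g A.subset by (auto simp: RCOSETS_def coset_mult_assoc)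
    qed
    have inj: "inj_on (\<lambda>C. C #> g) (rcosets A)"
      using img finE by (simp add: eq_card_imp_inj_on)
    have "tr h = finprod ?A (\<phi> h) ((\<lambda>C. C #> g) ` (rcosets A))"
      by (simp add: tr_def img)
    also have "\<dots> = finprod ?A (\<lambda>C. \<phi> h (C #> g)) (rcosets A)"
      using \<phi>_closed[OF h] img inj by (intro A'.finprod_reindex) auto
    finally have "tr g \<otimes> tr h = finprod ?A (\<phi> g) (rcosets A) \<otimes>\<^bsub>?A\<^esub> finprod ?A (\<lambda>C. \<phi> h (C #> g)) (rcosets A)"
      by (simp add: tr_def)
    also have "\<dots> = finprod ?A (\<lambda>C. \<phi> g C \<otimes>\<^bsub>?A\<^esub> \<phi> h (C #> g)) (rcosets A)"
      using \<phi>_closed[OF h] \<phi>_closed[OF g] img by (intro A'.finprod_multf[symmetric]) auto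
    also have "\<dots> = tr (g \<otimes> h)"
      unfolding tr_def
    proof (rule A'.finprod_cong')
      fix C assume "C \<in> rcosets A"
      then obtain t where t: "t \<in> carrier G" "C = A #> t" by (auto simp: RCOSETS_def)
      have "\<phi> g C \<otimes> \<phi> h (C #> g) = (\<tau> (t \<otimes> g) \<otimes> inv (\<tau> t)) \<otimes> (\<tau> (t \<otimes> g \<otimes> h) \<otimes> inv (\<tau> (t \<otimes> g)))"
        using t g h A.subset \<phi>[of g t] \<phi>[of h "t \<otimes> g"] by (simp add: coset_mult_assoc)
      also have "\<dots> = (\<tau> (t \<otimes> g \<otimes> h) \<otimes> inv (\<tau> (t \<otimes> g))) \<otimes> (\<tau> (t \<otimes> g) \<otimes> inv (\<tau> t))"
        using t g h \<tau>_closed by (intro comm) auto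
      also have "\<dots> = \<tau> (t \<otimes> g \<otimes> h) \<otimes> inv (\<tau> t)"
        using \<tau>_closed[of "t \<otimes> g \<otimes> h"] \<tau>_closed[of "t \<otimes> g"] \<tau>_closed[of t] t g h
        by (simp add: m_assoc inv_mult_cancel_left)
      also have "\<dots> = \<phi> (g \<otimes> h) C"
        using t g h \<phi>[of "g \<otimes> h" t] by (simp add: m_assoc)
      finally show "\<phi> g C \<otimes>\<^bsub>?A\<^esub> \<phi> h (C #> g) = \<phi> (g \<otimes> h) C" by simp
    next
      show "\<phi> (g \<otimes> h) \<in> rcosets A \<rightarrow> carrier ?A" using \<phi>_closed g h by simp
    qed simp
    finally show ?thesis by simp
  qed
  have tr_A: "tr a = a" if a: "a \<in> A" for a
  proof -
    have AE: "A \<in> rcosets A"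
      using A.subset by (auto simp: RCOSETS_def intro!: bexI[of _ \<one>])
    have "\<phi> a C = (if A = C then a else \<one>)" if C: "C \<in> rcosets A" for C
    proof -
      obtain t where t: "t \<in> carrier G" "C = A #> t" using C by (auto simp: RCOSETS_def)
      have "A = C \<longleftrightarrow> t \<in> A"
        using t by (metis A coset_join1 coset_join2)
      moreover have "\<tau> (t \<otimes> a) \<otimes> inv (\<tau> t) = a" if "t \<in> A"
        using that a comm[of t a] \<tau>_A by (simp add: m_assoc)
      moreover have "\<tau> (t \<otimes> a) = \<tau> t" if "t \<notin> A"
        using \<tau>_mult[OF t(1) that A.one_closed a] t \<tau>_closed a by simp
      ultimately show ?thesis using t a \<phi>[of a t] \<tau>_closed[of t] by auto
    qed
    then have "tr a = finprod ?A (\<lambda>C. if A = C then a else \<one>\<^bsub>?A\<^esub>) (rcosets A)"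
      unfolding tr_def using a by (intro A'.finprod_cong') auto
    also have "\<dots> = a"
      using A'.finprod_singleton[OF AE finE, of "\<lambda>_. a"] a by auto
    finally show ?thesis .
  qed
  have hom: "group_hom G ?A tr"
    using tr_closed tr_mult by (auto intro!: group_hom.intro group_hom_axioms.intro homI is_group A'.is_group)
  show ?thesis
  proof
    show "kernel G ?A tr \<lhd> G"
      using group_hom.normal_kernel[OF hom] .
    show "kernel G ?A tr \<inter> A = {\<one>}"
      using tr_A by (auto simp: kernel_def)
    fix g assume g: "g \<in> carrier G"
    have "tr (inv (tr g)) = inv (tr g)"
      using tr_closed[OF g] tr_A by blast
    then have "g \<otimes> inv (tr g) \<in> kernel G ?A tr"
      using g tr_closed[OF g] tr_mult[of g "inv (tr g)"] by (simp add: kernel_def)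
    then show "\<exists>b\<in>A. g \<otimes> inv b \<in> kernel G ?A tr"
      using tr_closed[OF g] by blast
  qed
qed

section \<open>Cosets of a centralizer and the dichotomy in an abstract finite group\<close>

lemma (in group) commute_inv:
  assumes "z \<in> carrier G" "g \<in> carrier G" "g \<otimes> z = z \<otimes> g"
  shows "g \<otimes> inv z = inv z \<otimes> g"
proof -
  have "inv z \<otimes> g = inv z \<otimes> (g \<otimes> z) \<otimes> inv z"
    using assms(1,2) by (simp add: m_assoc)
  also have "\<dots> = g \<otimes> inv z"
    unfolding assms(3) using assms(1,2) by (simp add: m_assoc inv_mult_cancel_left)
  finally show ?thesis by simp
qed

lemma (in group) commute_mult:
  assumes "z \<in> carrier G" "w \<in> carrier G" "g \<in> carrier G" "g \<otimes> z = z \<otimes> g" "g \<otimes> w = w \<otimes> g"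
  shows "g \<otimes> (z \<otimes> w) = (z \<otimes> w) \<otimes> g"
proof -
  have "g \<otimes> (z \<otimes> w) = (z \<otimes> g) \<otimes> w"
    using assms by (simp flip: m_assoc)
  also have "\<dots> = z \<otimes> (w \<otimes> g)"
    using assms by (simp add: m_assoc)
  finally show ?thesis using assms by (simp add: m_assoc)
qed

lemma (in group) card_subgroup_dvd:
  assumes "subgroup H G" "subgroup K G" "H \<subseteq> K"
  shows "card H dvd card K"
proof -
  have "card H * card (rcosets\<^bsub>G\<lparr>carrier := K\<rparr>\<^esub> H) = card K"
    using group.lagrange[OF subgroup_imp_group[OF assms(2)] subgroup_incl[OF assms]]
    by (simp add: order_def mult.commute)
  then show ?thesis by (metis dvd_triv_left)
qed

lemma (in group) finite_rcosets:
  assumes "finite (carrier G)" "subgroup H G"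
  shows "finite (rcosets H)"
  by (rule finite_subset[OF rcosets_subset_PowG[OF assms(2)]]) (use assms in simp)

text \<open>By \<open>rcoset_mult_eq_iff\<close> the fixed cosets \<open>A #> x\<close> are those
  for which \<open>x\<close> conjugates \<open>a\<close> into \<open>A\<close>, so the index of
  \<open>A\<close> controls modulo \<open>p\<close> how often this happens.\<close>

lemma (in group) rcosets_prime_fixed_points:
  assumes fin: "finite (carrier G)" and A: "subgroup A G"
    and a: "a \<in> carrier G" "a [^] p = \<one>" and p: "Factorial_Ring.prime (p::nat)"
  shows "card {C \<in> rcosets A. C #> a = C} mod p = card (rcosets A) mod p"
proof (rule funpow_prime_fixed_points[OF p finite_rcosets[OF fin A]])
  have sub: "A \<subseteq> carrier G" by (rule subgroup.subset[OF A])
  fix C assume "C \<in> rcosets A"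
  then obtain x where x: "x \<in> carrier G" "C = A #> x" by (auto simp: RCOSETS_def)
  show "C #> a \<in> rcosets A"
    using x a sub by (auto simp: RCOSETS_def coset_mult_assoc)
  have "((\<lambda>C. C #> a) ^^ k) C = C #> (a [^] k)" for k
  proof (induction k)
    case (Suc k)
    then show ?case using x a sub by (simp add: coset_mult_assoc m_assoc)
  qed (use x sub in \<open>simp add: coset_mult_assoc\<close>)
  then show "((\<lambda>C. C #> a) ^^ p) C = C"
    using a x sub by (simp add: coset_mult_assoc)
qed

lemma (in group) rcoset_mult_eq_iff:
  assumes A: "subgroup A G" and "x \<in> carrier G" "a \<in> carrier G"
  shows "A #> x #> a = A #> x \<longleftrightarrow> x \<otimes> a \<otimes> inv x \<in> A"
proof -
  have sub: "A \<subseteq> carrier G" by (rule subgroup.subset[OF A])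
  have "A #> x #> a = A #> x \<longleftrightarrow> A #> (x \<otimes> a) = A #> x"
    using assms sub by (simp add: coset_mult_assoc)
  also have "\<dots> \<longleftrightarrow> x \<otimes> a \<in> A #> x"
    using assms by (metis m_closed rcos_self repr_independence)
  also have "\<dots> \<longleftrightarrow> x \<otimes> a \<otimes> inv x \<in> A"
  proof
    assume "x \<otimes> a \<in> A #> x"
    then obtain l where "l \<in> A" "x \<otimes> a = l \<otimes> x" by (auto simp: r_coset_def)
    then show "x \<otimes> a \<otimes> inv x \<in> A" using assms sub by (simp add: m_assoc subsetD)
  next
    assume *: "x \<otimes> a \<otimes> inv x \<in> A"
    have "x \<otimes> a = (x \<otimes> a \<otimes> inv x) \<otimes> x" using assms by (simp add: m_assoc)
    then show "x \<otimes> a \<in> A #> x" using * by (auto simp: r_coset_def)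
  qed
  finally show ?thesis .
qed

text \<open>The situation of a Frobenius group with an abelian complement: the transfer into the
  complement yields the kernel, whose Sylow subgroups can be chosen invariant under \<open>a\<close>.\<close>

lemma (in group) malnormal_centralizer_invariant_p_subgroup:
  assumes fin: "finite (carrier G)" and p: "Factorial_Ring.prime (p::nat)"
    and A: "subgroup A G" and comm: "\<And>x y. x \<in> A \<Longrightarrow> y \<in> A \<Longrightarrow> x \<otimes> y = y \<otimes> x"
    and TI: "\<forall>t\<in>carrier G - A. \<forall>y\<in>A. t \<otimes> y \<otimes> inv t \<in> A \<longrightarrow> y = \<one>"
    and a: "a \<in> A" "a \<noteq> \<one>" "a [^] p = \<one>"
    and proper: "A \<noteq> carrier G"
  obtains B l k where "Factorial_Ring.prime (l::nat)" "subgroup B G" "card B = l ^ k" "k > 0"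
    "\<forall>x\<in>B. \<forall>y\<in>B. x \<otimes> y = y \<otimes> x" "(\<lambda>y. a \<otimes> y \<otimes> inv a) ` B \<subseteq> B"
    "\<forall>y\<in>B. a \<otimes> y = y \<otimes> a \<longrightarrow> y = \<one>"
proof -
  interpret A: subgroup A G by (rule A)
  obtain K where K: "K \<lhd> G" "K \<inter> A = {\<one>}" and KA: "\<And>g. g \<in> carrier G \<Longrightarrow> \<exists>b\<in>A. g \<otimes> inv b \<in> K"
    using malnormal_abelian_normal_complement[OF fin A comm TI] by metis
  interpret K: normal K G by (rule K(1))
  have aG: "a \<in> carrier G" using a by simp
  \<comment> \<open>A nontrivial \<open>y\<close> of this kind lies outside \<open>A\<close> and
    conjugates \<open>a\<close> to itself, hence into \<open>A\<close>, against
    malnormality.\<close>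
  have fpf: "y = \<one>" if "y \<in> K" "a \<otimes> y = y \<otimes> a" for y
  proof (rule ccontr)
    assume "y \<noteq> \<one>"
    then have "y \<in> carrier G - A"
      using that K(2) K.subset by blast
    moreover have "y \<otimes> a \<otimes> inv y = a"
      using conj_eq_self_iff[of y a] aG that K.subset by auto
    ultimately show False using TI a by metis
  qed
  have "K \<noteq> {\<one>}"
  proof
    assume K1: "K = {\<one>}"
    have "g \<in> A" if g: "g \<in> carrier G" for g
    proof -
      obtain b where "b \<in> A" "g \<otimes> inv b = \<one>" using KA[OF g] K1 by auto
      then show ?thesis using g by (metis A.mem_carrier inv_closed inv_equality inv_inv)
    qed
    then show False using proper A.subset by blast
  qed
  have finK: "finite K"
    using fin K.subset finite_subset by blast
  have "card K \<noteq> 1"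
    using \<open>K \<noteq> {\<one>}\<close> K.one_closed by (metis card_1_singletonE singletonD)
  then obtain l where l: "Factorial_Ring.prime l" "l dvd card K"
    by (metis prime_factor_nat)
  \<comment> \<open>Conjugation by \<open>a\<close> fixes only \<open>\<one>\<close> in
    \<open>K\<close>, so \<open>card K\<close> is 1 modulo \<open>p\<close>. This is the coprimality
    required for an invariant Sylow subgroup.\<close>
  have "card {y \<in> K. a \<otimes> y \<otimes> inv a = y} mod p = card K mod p"
  proof (rule funpow_prime_fixed_points[OF p finK])
    fix y assume y: "y \<in> K"
    then show "a \<otimes> y \<otimes> inv a \<in> K" using K.inv_op_closed2 aG by blast
    show "((\<lambda>y. a \<otimes> y \<otimes> inv a) ^^ p) y = y"
      using funpow_conj[OF aG, of y p] y a K.subset by auto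
  qed
  moreover have "{y \<in> K. a \<otimes> y \<otimes> inv a = y} = {\<one>}"
    using fpf conj_eq_self_iff[OF aG] K.subset K.one_closed aG by (auto simp: subset_iff)
  ultimately have "\<not> p dvd card K"
    using prime_gt_1_nat[OF p] by (simp add: dvd_eq_mod_eq_0)
  then obtain L k where L: "subgroup L G" "L \<subseteq> K" "card L = l ^ k" "k > 0" "(\<lambda>y. a \<otimes> y \<otimes> inv a) ` L = L"
    using prime_automorphism_invariant_sylow[OF fin K(1) l aG a(3) p] by metis
  interpret L: subgroup L G by (rule L(1))
  \<comment> \<open>The centre of \<open>L\<close> is abelian and nontrivial, and it inherits
    invariance under \<open>a\<close> from \<open>L\<close>.\<close>
  define B where "B = {z \<in> L. \<forall>g\<in>L. g \<otimes> z = z \<otimes> g}"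
  have BL: "B \<subseteq> L" and BD: "\<And>g z. z \<in> B \<Longrightarrow> g \<in> L \<Longrightarrow> g \<otimes> z = z \<otimes> g"
    unfolding B_def by blast+
  have subB: "subgroup B G"
  proof (rule subgroupI)
    have "\<one> \<in> B" using L.one_closed by (auto simp: B_def)
    then show "B \<noteq> {}" by blast
    fix z assume z: "z \<in> B"
    show "inv z \<in> B"
      using z commute_inv by (auto simp: B_def)
    fix w assume w: "w \<in> B"
    show "z \<otimes> w \<in> B"
      unfolding B_def
    proof (intro CollectI conjI ballI)
      fix g assume "g \<in> L"
      then show "g \<otimes> (z \<otimes> w) = z \<otimes> w \<otimes> g"
        using z w BL L.subset by (intro commute_mult BD) blast+
    next
      show "z \<otimes> w \<in> L" using z w BL by blast
    qed
  qed (use BL L.subset in blast)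
  have "card B dvd l ^ k"
    using card_subgroup_dvd[OF subB L(1) BL] L(3) by simp
  then obtain j where j: "card B = l ^ j"
    using divides_primepow_nat[OF l(1)] by blast
  obtain z where z: "z \<in> B" "z \<noteq> \<one>"
    using p_subgroup_center_nontrivial[OF L(1,3,4) l(1)] unfolding B_def by blast
  have "j > 0"
  proof (rule ccontr)
    assume "\<not> j > 0"
    then have "card B = 1" using j by simp
    moreover have "\<one> \<in> B" using subB by (rule subgroup.one_closed)
    ultimately show False using z by (metis card_1_singletonE singletonD)
  qed
  moreover have "(\<lambda>y. a \<otimes> y \<otimes> inv a) ` B \<subseteq> B"
  proof (rule image_subsetI)
    fix y assume y: "y \<in> B"
    have "g \<otimes> (a \<otimes> y \<otimes> inv a) = (a \<otimes> y \<otimes> inv a) \<otimes> g" if g: "g \<in> L" for g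
    proof -
      obtain h where h: "h \<in> L" "g = a \<otimes> h \<otimes> inv a" using L(5) g by blast
      have "h \<in> carrier G" "y \<in> carrier G" using h y BL by auto
      then show ?thesis
        unfolding h(2) using conj_mult[OF aG, of h y] conj_mult[OF aG, of y h] BD[OF y h(1)] by simp
    qed
    moreover have "a \<otimes> y \<otimes> inv a \<in> L" using L(5) y BL by blast
    ultimately show "a \<otimes> y \<otimes> inv a \<in> B" unfolding B_def by blast
  qed
  moreover have "\<forall>y\<in>B. a \<otimes> y = y \<otimes> a \<longrightarrow> y = \<one>"
    using fpf L(2) BL by blast
  moreover have "\<forall>x\<in>B. \<forall>y\<in>B. x \<otimes> y = y \<otimes> x"
    using BD BL by blast
  ultimately show ?thesis using that l(1) subB j by blast
qed

text \<open>The power of \<open>r\<close> with exponent \<open>q ^ i\<close> depends only on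
  \<open>i\<close> modulo \<open>n\<close>, as with powers of the Frobenius map.\<close>

lemma (in group) pow_power_periodic:
  assumes r: "r \<in> carrier G" and per: "r [^] ((q::nat) ^ n) = r"
  shows "r [^] (q ^ (i + n * c)) = r [^] (q ^ i)"
proof (induction c)
  case (Suc c)
  have "r [^] (q ^ (i + n * Suc c)) = (r [^] (q ^ n)) [^] (q ^ (i + n * c))"
    using r by (simp add: nat_pow_pow flip: power_add) (simp add: algebra_simps)
  then show ?case using Suc per by simp
qed simp

text \<open>At most \<open>n < p\<close> cosets of the centralizer \<open>A\<close> of \<open>r\<close> are fixed by \<open>a = r [^] m\<close>, so \<open>p\<close> does not
  divide the index of \<open>A\<close> and \<open>s\<close> is conjugate into \<open>A\<close>. Either the normalizer of \<open>A\<close> induces the full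
  group of \<open>n\<close> Frobenius powers, or \<open>A\<close> is malnormal.\<close>

lemma (in group) conjugate_or_commute:
  fixes n p q m :: nat
  assumes fin: "finite (carrier G)" and n: "Factorial_Ring.prime n" and p: "Factorial_Ring.prime p" "p > n"
    and r: "r \<in> carrier G" and s: "s \<in> carrier G"
    and cent: "\<And>y z. y \<in> carrier G \<Longrightarrow> z \<in> carrier G \<Longrightarrow> y \<noteq> \<one> \<Longrightarrow> y \<otimes> r = r \<otimes> y \<Longrightarrow>
      z \<otimes> y = y \<otimes> z \<longleftrightarrow> z \<otimes> r = r \<otimes> z"
    and conj_r: "\<And>t. t \<in> carrier G \<Longrightarrow> (t \<otimes> r \<otimes> inv t) \<otimes> r = r \<otimes> (t \<otimes> r \<otimes> inv t) \<Longrightarrow>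
      \<exists>i<n. t \<otimes> r \<otimes> inv t = r [^] (q ^ i)"
    and conj_s: "\<And>t. t \<in> carrier G \<Longrightarrow> (t \<otimes> s \<otimes> inv t) \<otimes> r = r \<otimes> (t \<otimes> s \<otimes> inv t) \<Longrightarrow>
      \<exists>i<n. t \<otimes> s \<otimes> inv t = r [^] (q ^ i)"
    and per: "r [^] (q ^ n) = r"
    and rm: "r [^] m \<noteq> \<one>" "(r [^] m) [^] p = \<one>"
    and sm: "s [^] m \<noteq> \<one>" "(s [^] m) [^] p = \<one>"
    and no_B: "\<And>B l k. Factorial_Ring.prime (l::nat) \<Longrightarrow> subgroup B G \<Longrightarrow> card B = l ^ k \<Longrightarrow> k > 0 \<Longrightarrow>
      \<forall>x\<in>B. \<forall>y\<in>B. x \<otimes> y = y \<otimes> x \<Longrightarrow> (\<lambda>y. r [^] m \<otimes> y \<otimes> inv (r [^] m)) ` B \<subseteq> B \<Longrightarrow>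
      \<forall>y\<in>B. r [^] m \<otimes> y = y \<otimes> r [^] m \<longrightarrow> y = \<one> \<Longrightarrow> False"
  shows "(\<exists>t\<in>carrier G. t \<otimes> r \<otimes> inv t = s) \<or> r \<otimes> s = s \<otimes> r"
proof -
  define A where "A = {z \<in> carrier G. z \<otimes> r = r \<otimes> z}"
  define a where "a = r [^] m"
  have aG: "a \<in> carrier G" using r by (simp add: a_def)
  have conj_rA: "\<exists>i<n. t \<otimes> r \<otimes> inv t = r [^] (q ^ i)" if "t \<in> carrier G" "t \<otimes> r \<otimes> inv t \<in> A" for t
    using conj_r[of t] that unfolding A_def by blast
  have conj_sA: "\<exists>i<n. t \<otimes> s \<otimes> inv t = r [^] (q ^ i)" if "t \<in> carrier G" "t \<otimes> s \<otimes> inv t \<in> A" for t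
    using conj_s[of t] that unfolding A_def by blast
  \<comment> \<open>Every nontrivial element of \<open>A\<close> has centralizer \<open>A\<close>.
    Commutativity of \<open>A\<close> and the transfer of conjugacy from \<open>r [^] m\<close> to
    \<open>r\<close> both rest on this.\<close>
  have memA: "z \<in> A \<longleftrightarrow> z \<otimes> y = y \<otimes> z" if "y \<in> A" "y \<noteq> \<one>" "z \<in> carrier G" for y z
    using cent[of y z] that by (auto simp: A_def)
  have rA: "r \<in> A" using r by (simp add: A_def)
  have comm: "x \<otimes> y = y \<otimes> x" if "x \<in> A" "y \<in> A" for x y
    using memA[of y x] that by (cases "y = \<one>") (auto simp: A_def)
  have A: "subgroup A G"
  proof (rule subgroupI)
    show "A \<noteq> {}" using rA by blast
    fix z assume z: "z \<in> A"
    show "inv z \<in> A"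
      using z r commute_inv[of z r] by (auto simp: A_def)
    fix w assume w: "w \<in> A"
    show "z \<otimes> w \<in> A"
      using z w r commute_mult[of z w r] by (auto simp: A_def)
  qed (auto simp: A_def)
  interpret A: subgroup A G by (rule A)
  have "r [^] k \<in> A" for k :: nat
    by (induction k) (use rA in auto)
  then have aA: "a \<in> A" by (simp add: a_def)
  have a1: "a \<noteq> \<one>" "a [^] p = \<one>" using rm by (auto simp: a_def)
  \<comment> \<open>The conjugate of \<open>u\<close> commutes with the conjugate of
    \<open>u [^] m\<close>, a nontrivial element of \<open>A\<close>, so \<open>memA\<close>
    applies.\<close>
  have conjA: "x \<otimes> u \<otimes> inv x \<in> A"
    if x: "x \<in> carrier G" and u: "u \<in> carrier G" and um: "u [^] m \<noteq> \<one>" and "x \<otimes> u [^] m \<otimes> inv x \<in> A" for x u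
  proof -
    have "x \<otimes> u [^] m \<otimes> inv x \<noteq> \<one>"
      using conj_inj[of x "u [^] m" \<one>] um x u by auto
    moreover have "(x \<otimes> u \<otimes> inv x) \<otimes> (x \<otimes> u [^] m \<otimes> inv x) = (x \<otimes> u [^] m \<otimes> inv x) \<otimes> (x \<otimes> u \<otimes> inv x)"
      using x u conj_mult[of x u "u [^] m"] conj_mult[of x "u [^] m" u] nat_pow_Suc2[of u m] by simp
    ultimately show ?thesis
      using memA[OF that(4)] x u by auto
  qed
  \<comment> \<open>Two elements \<open>x\<close> give the same
    \<open>inv x \<otimes> r \<otimes> x\<close> exactly when they lie in the same right coset of
    \<open>A\<close>, so the exponents obtained here tell the fixed cosets apart. The index is
    \<open>n - i\<close>, except that \<open>i = 0\<close> is kept as 0 in order to stay below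
    \<open>n\<close>.\<close>
  have conj_back: "\<exists>j<n. inv x \<otimes> r \<otimes> x = r [^] (q ^ j)"
    if x: "x \<in> carrier G" and "x \<otimes> a \<otimes> inv x \<in> A" for x
  proof -
    have "x \<otimes> r \<otimes> inv x \<in> A"
      using conjA[OF x r] that rm by (simp add: a_def)
    then obtain i where i: "i < n" "x \<otimes> r \<otimes> inv x = r [^] (q ^ i)"
      using conj_rA[OF x] by blast
    have "(inv x \<otimes> r \<otimes> inv (inv x)) [^] (q ^ i) = inv x \<otimes> r [^] (q ^ i) \<otimes> x"
      using conj_nat_pow[of "inv x" r "q ^ i"] x r by simp
    also have "\<dots> = r"
      unfolding i(2)[symmetric] using x r by (simp add: m_assoc inv_mult_cancel_left)
    finally have *: "(inv x \<otimes> r \<otimes> inv (inv x)) [^] (q ^ i) = r" .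
    have "inv x \<otimes> r \<otimes> x = inv x \<otimes> r [^] (q ^ n) \<otimes> x"
      unfolding per ..
    also have "\<dots> = (inv x \<otimes> r \<otimes> inv (inv x)) [^] (q ^ (i + (n - i)))"
      using conj_nat_pow[of "inv x" r "q ^ n"] x r i by simp
    also have "\<dots> = ((inv x \<otimes> r \<otimes> inv (inv x)) [^] (q ^ i)) [^] (q ^ (n - i))"
      using x r by (simp add: nat_pow_pow power_add)
    also have "\<dots> = r [^] (q ^ (n - i))" using * by simp
    finally have 1: "inv x \<otimes> r \<otimes> x = r [^] (q ^ (n - i))" .
    show ?thesis
    proof (cases "i = 0")
      case True
      then have "inv x \<otimes> r \<otimes> x = r [^] (q ^ 0)" using 1 per r by simp
      then show ?thesis using prime_gt_0_nat[OF n] by blast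
    next
      case False
      then show ?thesis using 1 i by (intro exI[of _ "n - i"]) auto
    qed
  qed
  let ?F = "{C \<in> rcosets A. C #> a = C}"
  have F: "\<exists>x j. x \<in> carrier G \<and> C = A #> x \<and> j < n \<and> inv x \<otimes> r \<otimes> x = r [^] (q ^ j)" if C: "C \<in> ?F" for C
  proof -
    obtain x where x: "x \<in> carrier G" "C = A #> x" using C by (auto simp: RCOSETS_def)
    then have "x \<otimes> a \<otimes> inv x \<in> A"
      using C rcoset_mult_eq_iff[OF A x(1) aG] by auto
    then show ?thesis using conj_back x by blast
  qed
  then have "\<forall>C\<in>?F. \<exists>x. \<exists>j. x \<in> carrier G \<and> C = A #> x \<and> j < n \<and> inv x \<otimes> r \<otimes> x = r [^] (q ^ j)"
    by blast
  from bchoice[OF this] obtain rep where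
    "\<forall>C\<in>?F. \<exists>j. rep C \<in> carrier G \<and> C = A #> rep C \<and> j < n \<and> inv (rep C) \<otimes> r \<otimes> rep C = r [^] (q ^ j)" ..
  from bchoice[OF this] obtain J where J:
    "\<forall>C\<in>?F. rep C \<in> carrier G \<and> C = A #> rep C \<and> J C < n \<and> inv (rep C) \<otimes> r \<otimes> rep C = r [^] (q ^ J C)" ..
  have XJ: "rep C \<in> carrier G" "A #> rep C = C" "J C < n" "inv (rep C) \<otimes> r \<otimes> rep C = r [^] (q ^ J C)"
    if "C \<in> ?F" for C
    using bspec[OF J that] by auto
  have finF: "finite ?F" using finite_rcosets[OF fin A] by simp
  have "inj_on J ?F"
  proof (rule inj_onI)
    fix C D assume C: "C \<in> ?F" and D: "D \<in> ?F" and eq: "J C = J D"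
    have XC: "rep C \<in> carrier G" and XD: "rep D \<in> carrier G" using XJ(1)[OF C] XJ(1)[OF D] by auto
    have e: "inv (rep C) \<otimes> r \<otimes> rep C = inv (rep D) \<otimes> r \<otimes> rep D"
      using XJ(4)[OF C] XJ(4)[OF D] eq by simp
    have "(rep D \<otimes> inv (rep C)) \<otimes> r = rep D \<otimes> (inv (rep C) \<otimes> r \<otimes> rep C) \<otimes> inv (rep C)"
      using XC XD r by (simp add: m_assoc)
    also have "\<dots> = r \<otimes> (rep D \<otimes> inv (rep C))"
      unfolding e using XC XD r by (simp add: m_assoc inv_mult_cancel_left)
    finally have "rep D \<otimes> inv (rep C) \<in> A" using XC XD unfolding A_def by blast
    moreover have "rep D = (rep D \<otimes> inv (rep C)) \<otimes> rep C" using XC XD by (simp add: m_assoc)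
    ultimately have "rep D \<in> A #> rep C" by (auto simp: r_coset_def)
    then have "A #> rep C = A #> rep D"
      using repr_independence XC A by metis
    then show "C = D" using XJ(2)[OF C] XJ(2)[OF D] by simp
  qed
  then have "card ?F \<le> card {..<n}"
    using XJ(3) by (intro card_inj_on_le[where f = J]) blast+
  moreover have "A \<in> ?F"
  proof -
    have "A = A #> \<one>" using A.subset by simp
    then show ?thesis
      using rcoset_mult_eq_iff[OF A one_closed aG] aA aG by (auto simp: RCOSETS_def)
  qed
  then have "card ?F > 0" using finF card_gt_0_iff by blast
  \<comment> \<open>The number of fixed cosets lies between 1 and \<open>n < p\<close>, so the index
    of \<open>A\<close> is not 0 modulo \<open>p\<close>; by the same congruence
    \<open>s [^] m\<close> must fix a coset as well.\<close>
  ultimately have ndvd: "card (rcosets A) mod p \<noteq> 0"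
    using rcosets_prime_fixed_points[OF fin A aG a1(2) p(1)] p(2) by simp
  have bG: "s [^] m \<in> carrier G" using s by simp
  have "card {C \<in> rcosets A. C #> s [^] m = C} \<noteq> 0"
    using rcosets_prime_fixed_points[OF fin A bG sm(2) p(1)] ndvd by (intro notI) simp
  then have "{C \<in> rcosets A. C #> s [^] m = C} \<noteq> {}" by (metis card.empty)
  then obtain x where x: "x \<in> carrier G" "A #> x #> s [^] m = A #> x"
    by (auto simp: RCOSETS_def)
  then have "x \<otimes> s [^] m \<otimes> inv x \<in> A"
    using rcoset_mult_eq_iff[OF A x(1) bG] by simp
  then have "x \<otimes> s \<otimes> inv x \<in> A"
    using conjA[OF x(1) s sm(1)] by blast
  then obtain i where i: "i < n" "x \<otimes> s \<otimes> inv x = r [^] (q ^ i)"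
    using conj_sA[OF x(1)] by blast
  show ?thesis
  \<comment> \<open>In the first case \<open>y\<close> conjugates \<open>r\<close> to its power with
    exponent \<open>q ^ j\<close>, where \<open>0 < j < n\<close>. As \<open>j\<close> is invertible
    modulo the prime \<open>n\<close>, a power of \<open>y\<close> reaches the exponent
    \<open>q ^ i\<close> that belongs to the conjugate of \<open>s\<close>.\<close>
  proof (cases "\<exists>y\<in>carrier G - A. y \<otimes> a \<otimes> inv y \<in> A")
    case True
    then obtain y where y: "y \<in> carrier G" "y \<notin> A" "y \<otimes> a \<otimes> inv y \<in> A" by blast
    then have "y \<otimes> r \<otimes> inv y \<in> A"
      using conjA[OF y(1) r] rm by (simp add: a_def)
    then obtain j where j: "j < n" "y \<otimes> r \<otimes> inv y = r [^] (q ^ j)"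
      using conj_rA[OF y(1)] by blast
    have "j \<noteq> 0"
    proof
      assume "j = 0"
      then have "y \<otimes> r \<otimes> inv y = r" using j r by simp
      then show False using conj_eq_self_iff[OF y(1) r] y(1,2) unfolding A_def by blast
    qed
    then have "coprime j n"
      using j n by (metis coprime_commute dvd_imp_le gr0I linorder_not_le prime_imp_coprime)
    then obtain c where "[j * c = 1] (mod n)"
      using cong_solve_coprime_nat[of j n] by auto
    then have "[j * (c * i) = i] (mod n)"
      using cong_scalar_right[of "j * c" 1 n i] by (simp add: mult.assoc)
    then have "(j * (c * i)) mod n = i" using i by (simp add: cong_def)
    then have dec: "j * (c * i) = i + n * (j * (c * i) div n)"
      by (metis mult.commute mod_div_mult_eq)
    have iter: "y [^] k \<otimes> r \<otimes> inv (y [^] k) = r [^] (q ^ (j * k))" for k :: nat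
    proof (induction k)
      case (Suc k)
      have "y [^] Suc k = y \<otimes> y [^] k" by (rule nat_pow_Suc2[OF y(1)])
      then have "y [^] Suc k \<otimes> r \<otimes> inv (y [^] Suc k) = y \<otimes> (y [^] k \<otimes> r \<otimes> inv (y [^] k)) \<otimes> inv y"
        using y(1) r conj_conj[of y "y [^] k" r] by (simp del: nat_pow_Suc)
      also have "\<dots> = (y \<otimes> r \<otimes> inv y) [^] (q ^ (j * k))"
        using Suc y(1) r conj_nat_pow by simp
      also have "\<dots> = r [^] (q ^ (j * Suc k))"
        using j r by (simp add: nat_pow_pow power_add)
      finally show ?case .
    qed (use r in simp)
    let ?k = "c * i"
    have "y [^] ?k \<otimes> r \<otimes> inv (y [^] ?k) = r [^] (q ^ i)"
      using iter[of ?k] pow_power_periodic[OF r per, of i "j * (c * i) div n"] dec by simp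
    then have e: "y [^] ?k \<otimes> r \<otimes> inv (y [^] ?k) = x \<otimes> s \<otimes> inv x" using i by simp
    have "(inv x \<otimes> y [^] ?k) \<otimes> r \<otimes> inv (inv x \<otimes> y [^] ?k) = inv x \<otimes> (x \<otimes> s \<otimes> inv x) \<otimes> inv (inv x)"
      unfolding e[symmetric] using x y r conj_conj[of "inv x" "y [^] ?k" r] by simp
    also have "\<dots> = s"
      using x s by (simp add: m_assoc inv_mult_cancel_left)
    finally show ?thesis using x y by (metis inv_closed m_closed nat_pow_closed)
  next
    case False
    \<comment> \<open>If \<open>t\<close> carries some nontrivial \<open>y\<close> of
      \<open>A\<close> into \<open>A\<close>, then the conjugate of \<open>a\<close> commutes with
      that of \<open>y\<close> and so lies in \<open>A\<close> too. It is thus enough that no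
      \<open>t\<close> outside \<open>A\<close> does this for \<open>a\<close>.\<close>
    have TI: "\<forall>t\<in>carrier G - A. \<forall>y\<in>A. t \<otimes> y \<otimes> inv t \<in> A \<longrightarrow> y = \<one>"
    proof (intro ballI impI, rule ccontr)
      fix t y assume t: "t \<in> carrier G - A" and y: "y \<in> A" and tA: "t \<otimes> y \<otimes> inv t \<in> A" and y1: "y \<noteq> \<one>"
      have "t \<otimes> y \<otimes> inv t \<noteq> \<one>"
        using conj_inj[of t y \<one>] t y y1 by auto
      moreover have "(t \<otimes> a \<otimes> inv t) \<otimes> (t \<otimes> y \<otimes> inv t) = (t \<otimes> y \<otimes> inv t) \<otimes> (t \<otimes> a \<otimes> inv t)"
        using t y aA comm[of a y] conj_mult[of t a y] conj_mult[of t y a] by simp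
      ultimately have "t \<otimes> a \<otimes> inv t \<in> A"
        using memA[OF tA] t aG by auto
      then show False using False t by blast
    qed
    show ?thesis
    proof (cases "A = carrier G")
      case True
      then show ?thesis using comm r s by blast
    next
      case False
      show ?thesis
      proof (rule malnormal_centralizer_invariant_p_subgroup[OF fin p(1) A comm TI aA a1 False])
        fix B l k assume "Factorial_Ring.prime (l::nat)" "subgroup B G" "card B = l ^ k" "k > 0"
          "\<forall>x\<in>B. \<forall>y\<in>B. x \<otimes> y = y \<otimes> x" "(\<lambda>y. a \<otimes> y \<otimes> inv a) ` B \<subseteq> B"
          "\<forall>y\<in>B. a \<otimes> y = y \<otimes> a \<longrightarrow> y = \<one>"
        then show ?thesis using no_B[of l B k] by (simp add: a_def)
      qed
    qed
  qed
qed

section \<open>Frobenius conjugate eigenvectors\<close>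

lemma prime_CHAR_finite: "Factorial_Ring.prime (CHAR('a :: {finite,field}))"
  using finite_imp_CHAR_pos[where 'a = 'a] prime_CHAR_semidom[where 'a = 'a] by simp

text \<open>If a prime \<open>l\<close> other than the characteristic divided the order, a Sylow
  subgroup of the additive group would contain a nonzero element killed by a power of
  \<open>l\<close>, and the characteristic would divide that power.\<close>

lemma finite_field_card:
  obtains k where "k > 0" "CARD('a :: {finite,field}) = CHAR('a) ^ k"
proof -
  let ?p = "CHAR('a)"
  let ?G = "\<lparr>carrier = UNIV :: 'a set, monoid.mult = (+), one = 0\<rparr>"
  interpret G: group ?G
    by (rule groupI) (auto simp: add.assoc intro: exI[of _ "- x" for x])
  have pow: "x [^]\<^bsub>?G\<^esub> (i::nat) = of_nat i * x" for x i
    by (induction i) (auto simp: algebra_simps)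
  have "l = ?p" if l: "Factorial_Ring.prime l" "l dvd CARD('a)" for l
  proof (rule ccontr)
    assume "l \<noteq> ?p"
    have "CARD('a) \<noteq> 0" by simp
    then obtain m k where m: "CARD('a) = l ^ k * m" "\<not> l dvd m"
      using multiplicity_decompose'[of "CARD('a)" l] l(1) by (metis not_prime_unit)
    have "k > 0" using m l by (cases k) auto
    obtain S where S: "subgroup S ?G" "card S = l ^ k"
      using sylow_thm[OF l(1) G.is_group, of k m] m by (auto simp: order_def)
    have "card S > 1" using S(2) one_less_power[OF prime_gt_1_nat[OF l(1)] \<open>k > 0\<close>] by simp
    then have "\<not> S \<subseteq> {0}"
      using card_mono[of "{0}" S] by auto
    then obtain x where x: "x \<in> S" "x \<noteq> 0" by blast
    interpret S: group "?G\<lparr>carrier := S\<rparr>" using S(1) G.is_group by (rule subgroup.subgroup_is_group)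
    have "x [^]\<^bsub>?G\<lparr>carrier := S\<rparr>\<^esub> (l ^ k) = 0"
      using S.pow_order_eq_1[of x] x S(2) by (simp add: order_def)
    then have "of_nat (l ^ k) * x = 0" using pow[of x] by (simp add: nat_pow_def)
    then have "?p dvd l ^ k"
      using x of_nat_eq_0_iff_char_dvd[where 'a = 'a, of "l ^ k"] by auto
    then have "?p dvd l" using prime_CHAR_finite prime_dvd_power by blast
    then show False
      using \<open>l \<noteq> ?p\<close> l(1) prime_CHAR_finite primes_dvd_imp_eq by blast
  qed
  note unique = this
  have "CARD('a) \<noteq> 0" by simp
  then obtain m k where m: "CARD('a) = ?p ^ k * m" "\<not> ?p dvd m"
    using multiplicity_decompose'[of "CARD('a)" ?p] prime_CHAR_finite[where 'a = 'a] by (metis not_prime_unit)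
  have "m = 1"
  proof (rule ccontr)
    assume "m \<noteq> 1"
    then obtain l where l: "Factorial_Ring.prime l" "l dvd m" by (metis prime_factor_nat)
    then have "l = ?p" using unique[of l] m(1) by simp
    then show False using l m by simp
  qed
  then have k: "CARD('a) = ?p ^ k" using m by simp
  have "CARD('a) \<noteq> 1"
    by (metis card_1_singletonE UNIV_I singletonD zero_neq_one)
  then have "k > 0" using k by (cases k) auto
  then show ?thesis using k that by blast
qed

text \<open>Multiplication by a nonzero \<open>c\<close> permutes the nonzero elements and so
  preserves their product.\<close>

lemma finite_field_power_card: "(c :: 'a :: {finite,field}) ^ CARD('a) = c"
proof (cases "c = 0")
  case False
  have "(\<Prod>x\<in>UNIV - {0}. x) = (\<Prod>x\<in>UNIV - {0}. c * x)"
    by (rule prod.reindex_bij_witness[of _ "\<lambda>x. c * x" "\<lambda>x. x / c"]) (use False in auto)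
  also have "\<dots> = c ^ (CARD('a) - 1) * (\<Prod>x\<in>UNIV - {0}. x)"
    by (simp add: prod.distrib)
  finally have "c ^ (CARD('a) - 1) = 1"
    by simp
  moreover have "CARD('a) = Suc (CARD('a) - 1)"
    by simp
  ultimately show ?thesis by (metis mult.right_neutral power_Suc)
qed (simp add: power_0_left)

lemma frobenius_sum:
  "(\<Sum>i\<in>I. f i :: 'a :: {finite,field} alg_closure) ^ (CARD('a) ^ k) = (\<Sum>i\<in>I. f i ^ (CARD('a) ^ k))"
proof -
  obtain m where m: "CARD('a) = CHAR('a) ^ m" using finite_field_card[where 'a = 'a] by blast
  show ?thesis
    by (rule freshmans_dream_sum'[where n = "m * k"]) (simp_all add: prime_CHAR_finite m power_mult)
qed

lemma frobenius_to_ac: "to_ac (c :: 'a :: {finite,field}) ^ (CARD('a) ^ k) = to_ac c"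
proof (induction k)
  case (Suc k)
  then show ?case
    by (simp add: power_mult mult.commute finite_field_power_card flip: to_ac_power)
qed simp

text \<open>The polynomial X^q - X has at most q roots in the closure, and the image of
  \<open>to_ac\<close> already supplies q of them.\<close>

lemma frobenius_fixed_imp_range:
  fixes x :: "'a :: {finite,field} alg_closure"
  assumes "x ^ CARD('a) = x"
  obtains c where "x = to_ac c"
proof -
  let ?q = "CARD('a)"
  let ?p = "Polynomial.monom 1 ?q - Polynomial.monom 1 1 :: 'a alg_closure poly"
  have q: "?q > 1"
    using card_mono[of "UNIV :: 'a set" "{0,1}"] by simp
  have "Polynomial.coeff ?p ?q = 1" using q by simp
  then have p0: "?p \<noteq> 0" by (metis coeff_0 zero_neq_one)
  have deg: "Polynomial.degree ?p \<le> ?q"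
    using q by (intro degree_diff_le) (auto simp: degree_monom_eq)
  have roots: "poly ?p y = y ^ ?q - y" for y by (simp add: poly_monom)
  have fin: "finite {y. poly ?p y = 0}" using p0 by (rule poly_roots_finite)
  have "card {y. poly ?p y = 0} \<le> ?q" using card_poly_roots_bound[OF p0] deg by simp
  moreover have "card (range (to_ac :: 'a \<Rightarrow> _)) = ?q"
    by (simp add: card_image inj_to_ac)
  moreover have "range (to_ac :: 'a \<Rightarrow> _) \<subseteq> {y. poly ?p y = 0}"
  proof (rule image_subsetI)
    fix c :: 'a
    show "to_ac c \<in> {y. poly ?p y = 0}"
      unfolding mem_Collect_eq roots using frobenius_to_ac[of c 1] by simp
  qed
  ultimately have "range (to_ac :: 'a \<Rightarrow> _) = {y. poly ?p y = 0}"
    using fin by (intro card_seteq) auto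
  moreover have "x \<in> {y. poly ?p y = 0}"
    unfolding mem_Collect_eq roots using assms by simp
  ultimately have "x \<in> range to_ac" by blast
  then show ?thesis using that by auto
qed

text \<open>Bezout gives \<open>k * a = n * b + 1\<close>, and fixed exponents may be multiplied.
  For prime \<open>n\<close> every \<open>k\<close> with \<open>0 < k < n\<close> qualifies, so an
  eigenvalue outside the base field differs from its first \<open>n - 1\<close> Frobenius
  conjugates.\<close>

lemma coprime_frobenius_fixed:
  fixes x :: "'b :: comm_monoid_mult"
  assumes n: "x ^ (q ^ n) = x" and k: "x ^ (q ^ k) = x" and cop: "coprime k n" and "k > 0"
  shows "x ^ q = x"
proof -
  have pow: "x ^ (q ^ (m * i)) = x" if "x ^ (q ^ m) = x" for m i :: nat
    by (induction i) (simp_all add: that power_add power_mult)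
  obtain a b where "k * a = n * b + 1"
    using bezout_nat[of k n] cop \<open>k > 0\<close> by auto
  then have "x = x ^ (q ^ (n * b + 1))"
    using pow[OF k, of a] by simp
  also have "q ^ (n * b + 1) = q ^ (n * b) * q" by simp
  also have "x ^ (q ^ (n * b) * q) = (x ^ (q ^ (n * b))) ^ q" by (rule power_mult)
  finally show ?thesis using pow[OF n] by simp
qed

section \<open>Matrices over the closure and the torus of a frame\<close>

interpretation to_ac: field_hom "to_ac :: 'a :: field \<Rightarrow> 'a alg_closure"
  by unfold_locales auto

abbreviation ac_mat :: "'a :: field mat \<Rightarrow> 'a alg_closure mat" where
  "ac_mat \<equiv> map_mat to_ac"

lemma ac_mat_inj: "ac_mat A = ac_mat B \<Longrightarrow> A = B"
  using to_ac.mat_hom_inj .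

lemma obtain_inverse_mat:
  fixes g :: "'b :: field mat"
  assumes "g \<in> carrier_mat n n" "det g \<noteq> 0"
  obtains h where "h \<in> carrier_mat n n" "g * h = 1\<^sub>m n" "h * g = 1\<^sub>m n"
  using det_non_zero_imp_unit[OF assms, of "()"] by (auto simp: Units_def ring_mat_def)

lemma mat_assoc: "dim_col A = dim_row B \<Longrightarrow> dim_col B = dim_row C \<Longrightarrow> A * B * C = A * (B * C)"
  for A :: "'b :: semiring_0 mat"
  by (rule assoc_mult_mat[of _ "dim_row A" "dim_col A" _ "dim_col B" _ "dim_col C"]) auto

lemma one_smult_mat: "1 \<cdot>\<^sub>m A = (A :: 'a :: comm_ring_1 mat)"
  by (rule eq_matI) auto

lemma mat_right_cancel:
  fixes g :: "'b :: field mat"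
  assumes c: "A \<in> carrier_mat m n" "B \<in> carrier_mat m n" "g \<in> carrier_mat n n" and "det g \<noteq> 0" "A * g = B * g"
  shows "A = B"
proof -
  obtain h where h: "h \<in> carrier_mat n n" "g * h = 1\<^sub>m n"
    using obtain_inverse_mat[OF assms(3,4)] by metis
  note d = c[THEN carrier_matD(1)] c[THEN carrier_matD(2)] h(1)[THEN carrier_matD(1)]
  have "A * g * h = B * g * h" using assms(5) by simp
  then show ?thesis using d h(2) c by (simp add: mat_assoc del: assoc_mult_mat)
qed

lemma mat_left_cancel:
  fixes g :: "'b :: field mat"
  assumes c: "A \<in> carrier_mat n m" "B \<in> carrier_mat n m" "g \<in> carrier_mat n n" and "det g \<noteq> 0" "g * A = g * B"
  shows "A = B"
proof -
  obtain h where h: "h \<in> carrier_mat n n" "h * g = 1\<^sub>m n"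
    using obtain_inverse_mat[OF assms(3,4)] by metis
  note d = c[THEN carrier_matD(1)] c[THEN carrier_matD(2)] h(1)[THEN carrier_matD(2)]
  have "h * (g * A) = h * (g * B)" using assms(5) by simp
  then have "h * g * A = h * g * B" using d by (simp add: mat_assoc del: assoc_mult_mat)
  then show ?thesis using h(2) c by simp
qed

text \<open>For \<open>\<mu>\<close> in the extension of degree \<open>n\<close> this is
  multiplication by \<open>\<mu>\<close> on that extension, diagonalized over the closure.\<close>

definition frob_diag :: "nat \<Rightarrow> 'a :: {finite,field} alg_closure \<Rightarrow> 'a alg_closure mat" where
  "frob_diag n \<mu> = mat n n (\<lambda>(i, j). if i = j then \<mu> ^ (CARD('a) ^ i) else 0)"

text \<open>The columns of a frame are the Frobenius conjugates of a common eigenvector of the torus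
  \<open>\<F>\<^sub>q\<^sub>n\<^sup>\<times>\<close>; the torus itself consists of the matrices over \<open>\<F>\<^sub>q\<close> that have an eigenvalue in the sense
  of \<open>eigenvalue_in\<close>.\<close>

definition frame :: "nat \<Rightarrow> 'a :: {finite,field} alg_closure mat \<Rightarrow> bool" where
  "frame n g \<longleftrightarrow> g \<in> carrier_mat n n \<and> det g \<noteq> 0 \<and>
     (\<forall>i<n. \<forall>k<n. g $$ (k, i) = g $$ (k, 0) ^ (CARD('a) ^ i)) \<and>
     (\<exists>\<gamma>. \<forall>k<n. g $$ (k, 0) ^ (CARD('a) ^ n) = \<gamma> * g $$ (k, 0))"

definition eigenvalue_in :: "nat \<Rightarrow> 'a :: {finite,field} alg_closure mat \<Rightarrow> 'a mat \<Rightarrow> 'a alg_closure \<Rightarrow> bool" where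
  "eigenvalue_in n g Y \<mu> \<longleftrightarrow> Y \<in> carrier_mat n n \<and> ac_mat Y * g = g * frob_diag n \<mu>"

lemma frob_diag_carrier [simp]: "frob_diag n \<mu> \<in> carrier_mat n n"
  and frob_diag_dim [simp]: "dim_row (frob_diag n \<mu>) = n" "dim_col (frob_diag n \<mu>) = n"
  by (simp_all add: frob_diag_def)

lemma index_mult_frob_diag:
  fixes g :: "'a :: {finite,field} alg_closure mat"
  assumes "g \<in> carrier_mat n n" "k < n" "i < n"
  shows "(g * frob_diag n \<mu>) $$ (k, i) = g $$ (k, i) * \<mu> ^ (CARD('a) ^ i)"
    and "(frob_diag n \<mu> * g) $$ (k, i) = \<mu> ^ (CARD('a) ^ k) * g $$ (k, i)"
  using assms by (auto simp: frob_diag_def scalar_prod_def if_distrib if_distribR sum.delta sum.delta' cong: if_cong)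

lemma frob_diag_mult: "frob_diag n \<mu> * frob_diag n \<nu> = frob_diag n (\<mu> * \<nu>)"
proof (rule eq_matI)
  fix i j assume "i < dim_row (frob_diag n (\<mu> * \<nu>))" "j < dim_col (frob_diag n (\<mu> * \<nu>))"
  then have ij: "i < n" "j < n" by simp_all
  then show "(frob_diag n \<mu> * frob_diag n \<nu>) $$ (i, j) = frob_diag n (\<mu> * \<nu>) $$ (i, j)"
    by (subst index_mult_frob_diag(1)[OF frob_diag_carrier ij]) (simp add: frob_diag_def power_mult_distrib)
qed simp_all

lemma det_frob_diag:
  fixes \<mu> :: "'a :: {finite,field} alg_closure"
  shows "det (frob_diag n \<mu>) = \<mu> ^ (\<Sum>i<n. CARD('a) ^ i)"
proof -
  have "det (frob_diag n \<mu>) = prod_list (diag_mat (frob_diag n \<mu>))"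
    by (rule det_upper_triangular[of _ n]) (auto simp: frob_diag_def)
  also have "\<dots> = (\<Prod>i = 0..<n. \<mu> ^ (CARD('a) ^ i))"
    by (simp add: prod_list_diag_prod frob_diag_def)
  finally show ?thesis by (simp add: power_sum atLeast0LessThan)
qed

context
  fixes n :: nat and g :: "'a :: {finite,field} alg_closure mat"
  assumes g: "frame n g"
begin

lemma frame_carrier: "g \<in> carrier_mat n n" and frame_det: "det g \<noteq> 0"
  using g by (auto simp: frame_def)

lemma frame_dim: "dim_row g = n" "dim_col g = n"
  using frame_carrier by auto

lemma frame_col: "i < n \<Longrightarrow> k < n \<Longrightarrow> g $$ (k, i) = g $$ (k, 0) ^ (CARD('a) ^ i)"
  using g unfolding frame_def by blast

text \<open>Only the first column of \<open>g\<close> has to be tested: \<open>Y\<close> has entries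
  in the base field, so the \<open>q ^ i\<close>-th power of the equation is the equation for column
  \<open>i\<close>.\<close>

lemma eigenvalue_inI:
  assumes Y: "Y \<in> carrier_mat n n"
    and eq: "\<And>k. k < n \<Longrightarrow> (\<Sum>j<n. to_ac (Y $$ (k, j)) * g $$ (j, 0)) = \<mu> * g $$ (k, 0)"
  shows "eigenvalue_in n g Y \<mu>"
proof -
  have "ac_mat Y * g = g * frob_diag n \<mu>"
  proof (rule eq_matI)
    fix k i assume "k < dim_row (g * frob_diag n \<mu>)" "i < dim_col (g * frob_diag n \<mu>)"
    then have ki: "k < n" "i < n" using frame_carrier frob_diag_carrier[of n \<mu>] by auto
    have "(ac_mat Y * g) $$ (k, i) = (\<Sum>j<n. to_ac (Y $$ (k, j)) * g $$ (j, i))"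
      using ki Y frame_carrier by (simp add: scalar_prod_def atLeast0LessThan)
    also have "\<dots> = (\<Sum>j<n. (to_ac (Y $$ (k, j)) * g $$ (j, 0)) ^ (CARD('a) ^ i))"
      using ki(1) by (intro sum.cong) (simp_all add: frame_col[OF ki(2)] power_mult_distrib frobenius_to_ac)
    also have "\<dots> = (\<Sum>j<n. to_ac (Y $$ (k, j)) * g $$ (j, 0)) ^ (CARD('a) ^ i)"
      by (rule frobenius_sum[symmetric])
    also have "\<dots> = g $$ (k, i) * \<mu> ^ (CARD('a) ^ i)"
      unfolding eq[OF ki(1)] using ki frame_col[of i k] by (simp add: power_mult_distrib mult.commute)
    finally show "(ac_mat Y * g) $$ (k, i) = (g * frob_diag n \<mu>) $$ (k, i)"
      by (simp only: index_mult_frob_diag(1)[OF frame_carrier ki])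
  qed (use Y frame_carrier frob_diag_carrier[of n \<mu>] in auto)
  then show ?thesis using Y by (simp add: eigenvalue_in_def)
qed

lemma eigenvalue_in_index:
  assumes "eigenvalue_in n g Y \<mu>" "k < n" "0 < n"
  shows "(\<Sum>j<n. to_ac (Y $$ (k, j)) * g $$ (j, 0)) = \<mu> * g $$ (k, 0)"
proof -
  have Y: "Y \<in> carrier_mat n n" and e: "ac_mat Y * g = g * frob_diag n \<mu>"
    using assms by (auto simp: eigenvalue_in_def)
  have "(\<Sum>j<n. to_ac (Y $$ (k, j)) * g $$ (j, 0)) = (ac_mat Y * g) $$ (k, 0)"
    using assms Y frame_carrier by (simp add: scalar_prod_def atLeast0LessThan)
  also have "\<dots> = \<mu> * g $$ (k, 0)"
    unfolding e using assms by (subst index_mult_frob_diag(1)[OF frame_carrier]) (simp_all add: mult.commute)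
  finally show ?thesis .
qed

text \<open>Since \<open>g\<close> is invertible, \<open>Y\<close> is determined by
  \<open>\<mu>\<close>. Identities between torus elements, such as commutativity, are proved from
  here on by comparing eigenvalues.\<close>

lemma eigenvalue_in_unique:
  assumes "eigenvalue_in n g Y \<mu>" "eigenvalue_in n g Z \<mu>"
  shows "Y = Z"
proof -
  have "ac_mat Y = ac_mat Z"
    by (rule mat_right_cancel[OF _ _ frame_carrier frame_det]) (use assms in \<open>auto simp: eigenvalue_in_def\<close>)
  then show ?thesis by (rule ac_mat_inj)
qed

lemma eigenvalue_in_eq:
  assumes "eigenvalue_in n g Y \<mu>" "eigenvalue_in n g Y \<nu>" "0 < n"
  shows "\<mu> = \<nu>"
proof -
  have "g * frob_diag n \<mu> = g * frob_diag n \<nu>"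
    using assms(1,2) by (simp add: eigenvalue_in_def)
  from mat_left_cancel[OF frob_diag_carrier frob_diag_carrier frame_carrier frame_det this]
  have "frob_diag n \<mu> $$ (0, 0) = frob_diag n \<nu> $$ (0, 0)" by simp
  then show ?thesis using assms(3) by (simp add: frob_diag_def)
qed

lemma eigenvalue_in_mult:
  assumes "eigenvalue_in n g Y \<mu>" "eigenvalue_in n g Z \<nu>"
  shows "eigenvalue_in n g (Y * Z) (\<mu> * \<nu>)"
proof -
  have c: "Y \<in> carrier_mat n n" "Z \<in> carrier_mat n n" "ac_mat Y \<in> carrier_mat n n" "ac_mat Z \<in> carrier_mat n n"
    and e: "ac_mat Y * g = g * frob_diag n \<mu>" "ac_mat Z * g = g * frob_diag n \<nu>"
    using assms by (auto simp: eigenvalue_in_def)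
  note d = c[THEN carrier_matD(1)] c[THEN carrier_matD(2)] frame_dim
  have "ac_mat (Y * Z) * g = ac_mat Y * (ac_mat Z * g)"
    using c d by (simp add: to_ac.mat_hom_mult[of _ n n _ n] mat_assoc del: assoc_mult_mat)
  also have "\<dots> = (ac_mat Y * g) * frob_diag n \<nu>"
    unfolding e(2) using d by (simp add: mat_assoc del: assoc_mult_mat)
  also have "\<dots> = g * frob_diag n (\<mu> * \<nu>)"
    unfolding e(1) using d by (simp add: frob_diag_mult[symmetric] mat_assoc del: assoc_mult_mat)
  finally show ?thesis using c by (simp add: eigenvalue_in_def)
qed

lemma eigenvalue_in_smult_one: "eigenvalue_in n g (c \<cdot>\<^sub>m 1\<^sub>m n) (to_ac c)"
proof (rule eigenvalue_inI)
  fix k assume "k < n"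
  then have "(\<Sum>j<n. to_ac ((c \<cdot>\<^sub>m 1\<^sub>m n) $$ (k, j)) * g $$ (j, 0)) = (\<Sum>j<n. if j = k then to_ac c * g $$ (k, 0) else 0)"
    by (intro sum.cong) auto
  then show "(\<Sum>j<n. to_ac ((c \<cdot>\<^sub>m 1\<^sub>m n) $$ (k, j)) * g $$ (j, 0)) = to_ac c * g $$ (k, 0)"
    using \<open>k < n\<close> by simp
qed simp

lemma eigenvalue_in_one: "eigenvalue_in n g (1\<^sub>m n) 1"
proof -
  show ?thesis using eigenvalue_in_smult_one[of 1] by (simp add: one_smult_mat)
qed

lemma eigenvalue_in_pow:
  assumes "eigenvalue_in n g Y \<mu>"
  shows "eigenvalue_in n g (Y ^\<^sub>m k) (\<mu> ^ k)"
proof (induction k)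
  case 0
  then show ?case using eigenvalue_in_one assms by (auto simp: eigenvalue_in_def)
next
  case (Suc k)
  then show ?case using eigenvalue_in_mult[OF Suc assms] by (simp add: mult.commute)
qed

lemma eigenvalue_in_fixed_imp_scalar:
  assumes "eigenvalue_in n g Y \<mu>" "\<mu> ^ CARD('a) = \<mu>"
  obtains c where "Y = c \<cdot>\<^sub>m 1\<^sub>m n" "\<mu> = to_ac c"
proof -
  obtain c where c: "\<mu> = to_ac c" using frobenius_fixed_imp_range[OF assms(2)] by blast
  then have "Y = c \<cdot>\<^sub>m 1\<^sub>m n"
    using eigenvalue_in_unique[OF assms(1)] eigenvalue_in_smult_one[of c] by simp
  then show ?thesis using that c by blast
qed

text \<open>The exponent is (q^n - 1)/(q - 1): the determinant is the norm of \<open>\<mu>\<close>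
  to the base field.\<close>

lemma det_eigenvalue_in:
  assumes "eigenvalue_in n g Y \<mu>"
  shows "to_ac (det Y) = \<mu> ^ (\<Sum>i<n. CARD('a) ^ i)"
proof -
  have "det (ac_mat Y) * det g = det (ac_mat Y * g)"
    by (rule det_mult[symmetric]) (use assms frame_carrier in \<open>auto simp: eigenvalue_in_def\<close>)
  also have "ac_mat Y * g = g * frob_diag n \<mu>"
    using assms by (simp add: eigenvalue_in_def)
  also have "det \<dots> = det g * det (frob_diag n \<mu>)"
    by (rule det_mult[OF frame_carrier frob_diag_carrier])
  finally have "det (ac_mat Y) * det g = det (frob_diag n \<mu>) * det g"
    by (simp only: mult.commute)
  then have "det (ac_mat Y) = det (frob_diag n \<mu>)" using frame_det by (metis mult_right_cancel)
  then show ?thesis by (simp add: det_frob_diag)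
qed

lemma det_eigenvalue_in_nonzero:
  assumes "eigenvalue_in n g Y \<mu>" "Y \<noteq> 0\<^sub>m n n"
  shows "det Y \<noteq> 0"
proof
  assume "det Y = 0"
  then have "\<mu> = 0" using det_eigenvalue_in[OF assms(1)] by (auto simp: power_0_left split: if_splits)
  moreover have "eigenvalue_in n g (0\<^sub>m n n) 0"
    by (rule eigenvalue_inI) auto
  ultimately show False using eigenvalue_in_unique assms by blast
qed

text \<open>The \<open>q ^ n\<close>-th power multiplies every coordinate of the eigenvector by the
  factor \<gamma> of \<open>frame\<close> and leaves the entries of \<open>Y\<close> alone; \<gamma>
  then cancels at a nonzero coordinate.\<close>

lemma eigenvalue_in_periodic:
  assumes "eigenvalue_in n g Y \<mu>" "0 < n"
  shows "\<mu> ^ (CARD('a) ^ n) = \<mu>"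
proof -
  let ?Q = "CARD('a) ^ n"
  obtain \<gamma> where \<gamma>: "\<And>k. k < n \<Longrightarrow> g $$ (k, 0) ^ ?Q = \<gamma> * g $$ (k, 0)"
    using g unfolding frame_def by blast
  have "\<exists>k<n. g $$ (k, 0) \<noteq> 0"
  proof (rule ccontr)
    assume *: "\<not> (\<exists>k<n. g $$ (k, 0) \<noteq> 0)"
    have "eigenvalue_in n g (0\<^sub>m n n) 0" "eigenvalue_in n g (1\<^sub>m n) 0"
      using * by (auto intro!: eigenvalue_inI sum.neutral)
    then have "1\<^sub>m n = (0\<^sub>m n n :: 'a mat)" using eigenvalue_in_unique by blast
    then have "(1\<^sub>m n :: 'a mat) $$ (0, 0) = 0\<^sub>m n n $$ (0, 0)" by simp
    then show False using assms(2) by simp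
  qed
  then obtain k where k: "k < n" "g $$ (k, 0) \<noteq> 0" by blast
  then have \<gamma>0: "\<gamma> \<noteq> 0" using \<gamma>[OF k(1)] by auto
  have "\<mu> ^ ?Q * (\<gamma> * g $$ (k, 0)) = (\<mu> * g $$ (k, 0)) ^ ?Q"
    using \<gamma>[OF k(1)] by (simp add: power_mult_distrib)
  also have "\<dots> = (\<Sum>j<n. to_ac (Y $$ (k, j)) * g $$ (j, 0)) ^ ?Q"
    using eigenvalue_in_index[OF assms(1) k(1) assms(2)] by simp
  also have "\<dots> = (\<Sum>j<n. to_ac (Y $$ (k, j)) * (\<gamma> * g $$ (j, 0)))"
    unfolding frobenius_sum using \<gamma> by (intro sum.cong) (auto simp: power_mult_distrib frobenius_to_ac)
  also have "\<dots> = \<gamma> * (\<Sum>j<n. to_ac (Y $$ (k, j)) * g $$ (j, 0))"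
    by (simp add: sum_distrib_left mult_ac)
  also have "\<dots> = \<mu> * (\<gamma> * g $$ (k, 0))"
    using eigenvalue_in_index[OF assms(1) k(1) assms(2)] by (simp add: mult_ac)
  finally show ?thesis using k \<gamma>0 by simp
qed

text \<open>\<open>C\<close> is the matrix of \<open>Z\<close> in the eigenbasis. There
  \<open>Y\<close> and \<open>W\<close> are diagonal, so a nonzero entry of \<open>C\<close> forces
  a conjugate of \<open>\<mu>\<close> to equal a conjugate of \<open>\<nu>\<close>.\<close>

lemma eigenvalue_in_intertwiner:
  assumes Y: "eigenvalue_in n g Y \<mu>" and W: "eigenvalue_in n g W \<nu>"
    and Z: "Z \<in> carrier_mat n n" and eq: "Z * Y = W * Z"
  obtains C where "C \<in> carrier_mat n n" "ac_mat Z * g = g * C"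
    "\<And>k i. k < n \<Longrightarrow> i < n \<Longrightarrow> C $$ (k, i) * \<mu> ^ (CARD('a) ^ i) = \<nu> ^ (CARD('a) ^ k) * C $$ (k, i)"
proof -
  obtain h where h: "h \<in> carrier_mat n n" "g * h = 1\<^sub>m n" "h * g = 1\<^sub>m n"
    using obtain_inverse_mat[OF frame_carrier frame_det] by metis
  define C where "C = h * (ac_mat Z * g)"
  have c: "ac_mat Z \<in> carrier_mat n n" "ac_mat Y \<in> carrier_mat n n" "ac_mat W \<in> carrier_mat n n"
    "Y \<in> carrier_mat n n" "W \<in> carrier_mat n n"
    using Y Z W by (auto simp: eigenvalue_in_def)
  have C: "C \<in> carrier_mat n n" unfolding C_def by (rule mult_carrier_mat[OF h(1) mult_carrier_mat[OF c(1) frame_carrier]])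
  note d = c[THEN carrier_matD(1)] c[THEN carrier_matD(2)] frame_dim carrier_matD[OF C] carrier_matD[OF Z]
  have "g * C = (g * h) * (ac_mat Z * g)"
    unfolding C_def by (rule assoc_mult_mat[symmetric]) (use h c frame_carrier in auto)
  then have gC: "ac_mat Z * g = g * C"
    using h c frame_carrier by simp
  have "g * (C * frob_diag n \<mu>) = (g * C) * frob_diag n \<mu>"
    using d by (simp add: mat_assoc del: assoc_mult_mat)
  also have "\<dots> = ac_mat Z * (g * frob_diag n \<mu>)"
    unfolding gC[symmetric] using d by (simp add: mat_assoc del: assoc_mult_mat)
  also have "\<dots> = ac_mat Z * (ac_mat Y * g)"
    using Y by (simp add: eigenvalue_in_def)
  also have "\<dots> = ac_mat (Z * Y) * g"
    using c Z d by (simp add: to_ac.mat_hom_mult[of _ n n _ n] mat_assoc del: assoc_mult_mat)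
  also have "\<dots> = ac_mat W * (ac_mat Z * g)"
    unfolding eq using c Z d by (simp add: to_ac.mat_hom_mult[of _ n n _ n] mat_assoc del: assoc_mult_mat)
  also have "\<dots> = (ac_mat W * g) * C"
    unfolding gC using d by (simp add: mat_assoc del: assoc_mult_mat)
  also have "\<dots> = g * (frob_diag n \<nu> * C)"
    using W d by (simp add: eigenvalue_in_def mat_assoc del: assoc_mult_mat)
  finally have "g * (C * frob_diag n \<mu>) = g * (frob_diag n \<nu> * C)" .
  from mat_left_cancel[OF _ _ frame_carrier frame_det this, of n]
  have CD: "C * frob_diag n \<mu> = frob_diag n \<nu> * C"
    using mult_carrier_mat[OF C frob_diag_carrier] mult_carrier_mat[OF frob_diag_carrier C] by blast
  show ?thesis
  proof
    fix k i assume ki: "k < n" "i < n"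
    have "(C * frob_diag n \<mu>) $$ (k, i) = (frob_diag n \<nu> * C) $$ (k, i)" using CD by simp
    then show "C $$ (k, i) * \<mu> ^ (CARD('a) ^ i) = \<nu> ^ (CARD('a) ^ k) * C $$ (k, i)"
      using index_mult_frob_diag[OF C ki] by simp
  qed (use C gC in auto)
qed

text \<open>Take \<open>W = Y\<close> in the intertwining relation. As \<open>n\<close> is prime,
  \<open>\<mu>\<close> differs from its conjugates of index \<open>0 < k < n\<close>, so column 0 of
  \<open>C\<close> vanishes below the diagonal and the first column of \<open>g\<close> is an
  eigenvector of \<open>Z\<close>.\<close>

lemma eigenvalue_in_commute:
  assumes n: "Factorial_Ring.prime n" and Y: "eigenvalue_in n g Y \<mu>" "\<mu> ^ CARD('a) \<noteq> \<mu>"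
    and Z: "Z \<in> carrier_mat n n" and comm: "Z * Y = Y * Z"
  obtains \<nu> where "eigenvalue_in n g Z \<nu>"
proof -
  have n0: "0 < n" using n by (rule prime_gt_0_nat)
  obtain C where C: "C \<in> carrier_mat n n" "ac_mat Z * g = g * C"
    and eq: "\<And>k i. k < n \<Longrightarrow> i < n \<Longrightarrow> C $$ (k, i) * \<mu> ^ (CARD('a) ^ i) = \<mu> ^ (CARD('a) ^ k) * C $$ (k, i)"
    using eigenvalue_in_intertwiner[OF Y(1) Y(1) Z comm] by metis
  have C0: "C $$ (k, 0) = 0" if k: "k < n" "k \<noteq> 0" for k
  proof (rule ccontr)
    assume "C $$ (k, 0) \<noteq> 0"
    then have "\<mu> ^ (CARD('a) ^ k) = \<mu>" using eq[OF k(1) n0] by simp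
    moreover have "coprime k n"
      using k n by (metis coprime_commute dvd_imp_le gr0I linorder_not_le prime_imp_coprime)
    ultimately show False
      using coprime_frobenius_fixed[OF eigenvalue_in_periodic[OF Y(1) n0]] k Y(2) by blast
  qed
  have "eigenvalue_in n g Z (C $$ (0, 0))"
  proof (rule eigenvalue_inI[OF Z])
    fix k assume k: "k < n"
    have "(\<Sum>j<n. to_ac (Z $$ (k, j)) * g $$ (j, 0)) = (ac_mat Z * g) $$ (k, 0)"
      using k n0 Z frame_carrier by (simp add: scalar_prod_def atLeast0LessThan)
    also have "\<dots> = (\<Sum>j<n. g $$ (k, j) * C $$ (j, 0))"
      unfolding C(2) using k n0 C(1) frame_carrier by (simp add: scalar_prod_def atLeast0LessThan)
    also have "\<dots> = (\<Sum>j<n. if j = 0 then g $$ (k, 0) * C $$ (0, 0) else 0)"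
      using C0 by (intro sum.cong) auto
    also have "\<dots> = C $$ (0, 0) * g $$ (k, 0)" using n0 by simp
    finally show "(\<Sum>j<n. to_ac (Z $$ (k, j)) * g $$ (j, 0)) = C $$ (0, 0) * g $$ (k, 0)" .
  qed
  then show ?thesis using that by blast
qed

text \<open>The invertible \<open>C\<close> has a nonzero entry in row 0, and the index of its
  column is the required \<open>i\<close>.\<close>

lemma eigenvalue_in_conj:
  assumes n: "0 < n" and Y: "eigenvalue_in n g Y \<mu>" and W: "eigenvalue_in n g W \<nu>"
    and Z: "Z \<in> carrier_mat n n" "det Z \<noteq> 0" and eq: "Z * Y = W * Z"
  obtains i where "i < n" "\<nu> = \<mu> ^ (CARD('a) ^ i)"
proof -
  obtain C where C: "C \<in> carrier_mat n n" "ac_mat Z * g = g * C"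
    and e: "\<And>k i. k < n \<Longrightarrow> i < n \<Longrightarrow> C $$ (k, i) * \<mu> ^ (CARD('a) ^ i) = \<nu> ^ (CARD('a) ^ k) * C $$ (k, i)"
    using eigenvalue_in_intertwiner[OF Y W Z(1) eq] by metis
  have "det (ac_mat Z) * det g = det (ac_mat Z * g)"
    by (rule det_mult[symmetric]) (use Z frame_carrier in auto)
  also have "\<dots> = det g * det C"
    unfolding C(2) by (rule det_mult[OF frame_carrier C(1)])
  finally have "det (ac_mat Z) * det g = det g * det C" .
  then have "det C \<noteq> 0" using Z(2) frame_det by auto
  have "\<exists>i<n. C $$ (0, i) \<noteq> 0"
  proof (rule ccontr)
    assume *: "\<not> (\<exists>i<n. C $$ (0, i) \<noteq> 0)"
    obtain h where h: "h \<in> carrier_mat n n" "C * h = 1\<^sub>m n"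
      using obtain_inverse_mat[OF C(1) \<open>det C \<noteq> 0\<close>] by metis
    have "(C * h) $$ (0, 0) = 0"
      using * n C(1) h(1) by (auto simp: scalar_prod_def intro!: sum.neutral)
    then show False using h(2) n by simp
  qed
  then obtain i where "i < n" "C $$ (0, i) \<noteq> 0" by blast
  then show ?thesis using that e[OF n, of i] by auto
qed

end

section \<open>Elements of norm one\<close>

lemma power_eq_1_coprime:
  fixes x :: "'b :: comm_monoid_mult"
  assumes "x ^ a = 1" "x ^ b = 1" "coprime a b" "0 < a"
  shows "x = 1"
proof -
  obtain u v where "a * u = b * v + 1"
    using bezout_nat[of a b] assms(3,4) by auto
  then have "(x ^ a) ^ u = (x ^ b) ^ v * x"
    by (metis power_add power_mult power_one_right)
  then show ?thesis using assms by simp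
qed

text \<open>Each \<open>q ^ i\<close> is 1 plus a multiple of \<open>q - 1\<close>. The cofactor is
  kept explicit because \<open>norm_one_fixed\<close> reduces it modulo \<open>n\<close>.\<close>

lemma geometric_sum_expansion:
  fixes q :: nat
  assumes "q > 0"
  shows "(\<Sum>i<n. q ^ i) = n + (q - 1) * (\<Sum>i<n. \<Sum>j<i. q ^ j)"
proof -
  have "q ^ i = 1 + (q - 1) * (\<Sum>j<i. q ^ j)" for i
  proof (induction i)
    case (Suc i)
    have "q ^ Suc i = q ^ i + (q - 1) * q ^ i"
      using assms by (cases q) auto
    then show ?case using Suc by (simp add: algebra_simps)
  qed simp
  then have "(\<Sum>i<n. q ^ i) = (\<Sum>i<n. 1 + (q - 1) * (\<Sum>j<i. q ^ j))"
    by (intro sum.cong refl)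
  then show ?thesis by (simp only: sum.distrib sum_distrib_left) simp
qed

text \<open>Let z = x^(q-1); then z^n = 1, and z = 1 is to be shown. If n divides q - 1, the norm is
  x^n z^M with M congruent to 0 + 1 + ... + (n - 1) modulo n, which is 0 as n is odd; so x^n = 1 and
  z = 1. Otherwise Fermat shows that n does not divide q^n - 1, so the norm exponent is prime to n,
  and z is killed by both.\<close>

lemma norm_one_fixed:
  fixes x :: "'b :: field"
  assumes n: "Factorial_Ring.prime (n::nat)" "odd n" and q: "q > 1"
    and norm: "x ^ (\<Sum>i<n. q ^ i) = 1" and xn: "(x ^ n) ^ (q - 1) = 1"
  shows "x ^ q = x"
proof -
  let ?z = "x ^ (q - 1)" and ?N = "\<Sum>i<n. q ^ i"
  have zn: "?z ^ n = 1" using xn by (simp add: mult.commute flip: power_mult)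
  have "?z = 1"
  proof (cases "n dvd q - 1")
    case True
    let ?M = "\<Sum>i<n. \<Sum>j<i. q ^ j"
    have q1: "[q = 1] (mod n)"
      using True q by (simp add: cong_altdef_nat cong_sym_eq)
    have "[?M = (\<Sum>i<n. \<Sum>j<i. 1 ^ j)] (mod n)"
      by (intro cong_sum cong_pow q1)
    also have "(\<Sum>i<n. \<Sum>j<i. 1 ^ j) = (\<Sum>i<n. i)" by simp
    also have "\<dots> = n * ((n - 1) div 2)"
      using n(2) Sum_Ico_nat[of 0 n] by (auto simp: atLeast0LessThan elim!: oddE)
    finally have "n dvd ?M" by (simp add: cong_0_iff cong_dvd_iff)
    then obtain m where m: "?M = n * m" by auto
    have "x ^ ?N = x ^ n * (?z ^ n) ^ m"
      using geometric_sum_expansion[of q n] q by (simp add: m power_add power_mult)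
    then have "x ^ n = 1" using norm zn by simp
    then show ?thesis using True by (auto simp: power_mult elim!: dvdE)
  next
    case False
    have "(q - 1) * ?N = q ^ n - 1"
    proof -
      have "int ((q - 1) * ?N) = int (q ^ n - 1)"
        using power_diff_1_eq[of "int q" n] q by (simp add: of_nat_diff one_le_power)
      then show ?thesis by linarith
    qed
    moreover have "\<not> n dvd q ^ n - 1"
    proof
      assume "n dvd q ^ n - 1"
      then have qn: "[q ^ n = 1] (mod n)"
        using q by (simp add: cong_altdef_nat one_le_power cong_sym_eq[of _ 1])
      have "\<not> n dvd q"
      proof
        assume "n dvd q"
        then have "n dvd q ^ n" using prime_gt_0_nat[OF n(1)] by (cases n) auto
        then have "n dvd 1" using cong_dvd_iff[OF qn] by simp
        then show False using n(1) by simp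
      qed
      then have "[q ^ (n - 1) * q = 1 * q] (mod n)"
        by (rule cong_scalar_right[OF fermat_theorem[OF n(1)]])
      moreover have "q ^ (n - 1) * q = q ^ n"
        using prime_gt_0_nat[OF n(1)] by (cases n) auto
      ultimately have "[q = 1] (mod n)" using cong_trans[OF cong_sym] qn by (simp add: cong_def)
      then show False using False q by (simp add: cong_altdef_nat)
    qed
    ultimately have "\<not> n dvd ?N" by (metis dvd_mult)
    then have "coprime n ?N" using n(1) prime_imp_coprime by blast
    moreover have "?z ^ ?N = 1"
      using norm by (metis power_mult mult.commute power_one)
    ultimately show ?thesis
      using power_eq_1_coprime[OF zn] prime_gt_0_nat[OF n(1)] by blast
  qed
  moreover have "x ^ q = x * ?z"
    using q by (cases q) auto
  ultimately show ?thesis by simp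
qed

section \<open>Coxeter tori\<close>

lemma carrier_GL: "carrier (GL n :: 'a :: field mat monoid) = {A \<in> carrier_mat n n. det A \<noteq> 0}"
  using unit_imp_det_non_zero[of _ n "()"] det_non_zero_imp_unit[of _ n "()"]
  by (auto simp: GL_def units_of_def) (auto simp: Units_def ring_mat_def)

lemma mult_GL [simp]: "A \<otimes>\<^bsub>GL n\<^esub> B = A * B"
  and one_GL [simp]: "\<one>\<^bsub>GL n\<^esub> = 1\<^sub>m n"
  by (simp_all add: GL_def units_of_def ring_mat_def)

lemma group_GL: "group (GL n :: 'a :: field mat monoid)"
proof -
  interpret ring "ring_mat TYPE('a) n ()" by (rule ring_mat)
  show ?thesis unfolding GL_def by (rule units_group)
qed

lemma n_cycle_orbit:
  assumes w: "n_cycle n w" and n: "0 < n"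
  shows "(\<lambda>i. (w ^^ i) 0) ` {..<n} = {..<n}" and "(w ^^ n) 0 = 0"
proof -
  have cyc: "cyclic_on w {..<n}"
    using w by (auto simp: n_cycle_def)
  have orb: "Orbits.orbit w 0 = {..<n}"
    using cyc n by (simp add: cyclic_on_alldef)
  then have self: "0 \<in> Orbits.orbit w 0" using n by simp
  let ?d = "funpow_dist1 w 0 0"
  have "card (Orbits.orbit w 0) = card {0..<?d}"
    using orbit_conv_funpow_dist1[OF self] inj_on_funpow_dist1[OF self] by (simp add: card_image)
  then have d: "?d = n" using orb by simp
  show "(\<lambda>i. (w ^^ i) 0) ` {..<n} = {..<n}"
    using orbit_conv_funpow_dist1[OF self] orb unfolding d by (simp add: atLeast0LessThan)
  show "(w ^^ n) 0 = 0"
    using funpow_dist1_prop[OF self] unfolding d .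
qed

text \<open>That h^-1 F(h) is monomial means that Frobenius takes column \<open>j\<close> of
  \<open>h\<close> to a multiple of column \<open>w j\<close>. As \<open>w\<close> is an n-cycle,
  the conjugates of column 0 run through all columns up to scalars and return to column 0 after
  \<open>n\<close> steps, so they form a frame.\<close>

lemma coxeter_torus_frame:
  fixes x :: "'a :: {finite,field} mat"
  assumes T: "coxeter_torus_GL n T" and x: "x \<in> T" and n: "0 < n"
  obtains g \<mu> where "frame n g" "eigenvalue_in n g x \<mu>"
proof -
  let ?q = "CARD('a)"
  obtain w S where w: "n_cycle n w" and S: "F_stable_torus_of_type n w S" and TS: "T = rational_points n S"
    using T by (auto simp: coxeter_torus_GL_def)
  obtain h where h: "h \<in> carrier (GL n)" and Sh: "S = conj_torus n h"
    and mono: "monomial_mat n w (inv\<^bsub>GL n\<^esub> h \<otimes>\<^bsub>GL n\<^esub> frobenius h)"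
    using S by (auto simp: F_stable_torus_of_type_def)
  interpret GL: group "GL n :: 'a alg_closure mat monoid" by (rule group_GL)
  have hc: "h \<in> carrier_mat n n" "det h \<noteq> 0" using h by (auto simp: carrier_GL)
  have ic: "inv\<^bsub>GL n\<^esub> h \<in> carrier_mat n n" using GL.inv_closed[OF h] by (auto simp: carrier_GL)
  have xc: "x \<in> carrier_mat n n" and "ac_mat x \<in> S"
    using x by (auto simp: TS rational_points_def carrier_GL)
  then obtain t where t: "t \<in> carrier_mat n n" "diagonal_mat t" and xt: "ac_mat x = h * t * inv\<^bsub>GL n\<^esub> h"
    by (auto simp: Sh conj_torus_def diagonal_torus_def carrier_GL)
  have hi: "h * inv\<^bsub>GL n\<^esub> h = 1\<^sub>m n" "inv\<^bsub>GL n\<^esub> h * h = 1\<^sub>m n"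
    using GL.r_inv[OF h] GL.l_inv[OF h] by simp_all
  note d = carrier_matD[OF hc(1)] carrier_matD[OF ic] carrier_matD[OF t(1)] carrier_matD[OF xc]
  have xh: "ac_mat x * h = h * t"
    unfolding xt using d hi t(1) by (simp add: mat_assoc del: assoc_mult_mat)
  define M where "M = inv\<^bsub>GL n\<^esub> h * frobenius h"
  have Fc: "frobenius h \<in> carrier_mat n n" using hc by (simp add: frobenius_def)
  have Mc: "M \<in> carrier_mat n n" using ic Fc by (simp add: M_def)
  have hM: "h * M = frobenius h"
  proof -
    have "h * M = (h * inv\<^bsub>GL n\<^esub> h) * frobenius h"
      unfolding M_def using d Fc by (simp add: mat_assoc del: assoc_mult_mat)
    then show ?thesis using hi Fc by simp
  qed
  have M: "M $$ (i, j) \<noteq> 0 \<longleftrightarrow> i = w j" if "i < n" "j < n" for i j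
    using mono that by (auto simp: monomial_mat_def M_def)
  have perm: "w permutes {..<n}" using w by (simp add: n_cycle_def)
  have wlt: "w j < n" if "j < n" for j using permutes_in_image[OF perm, of j] that by simp
  have F: "h $$ (k, j) ^ ?q = M $$ (w j, j) * h $$ (k, w j)" if kj: "k < n" "j < n" for k j
  proof -
    have "h $$ (k, j) ^ ?q = frobenius h $$ (k, j)" using kj hc by (simp add: frobenius_def)
    also have "\<dots> = (\<Sum>l<n. h $$ (k, l) * M $$ (l, j))"
      using kj hc Mc by (simp add: hM[symmetric] scalar_prod_def atLeast0LessThan)
    also have "\<dots> = (\<Sum>l<n. if l = w j then h $$ (k, w j) * M $$ (w j, j) else 0)"
      using M[OF _ kj(2)] by (intro sum.cong) auto
    also have "\<dots> = M $$ (w j, j) * h $$ (k, w j)"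
      using wlt[OF kj(2)] by simp
    finally show ?thesis .
  qed
  have wi: "(w ^^ i) 0 < n" for i
    by (induction i) (use n wlt in auto)
  have ex: "\<exists>c. c \<noteq> 0 \<and> (\<forall>k<n. h $$ (k, 0) ^ (?q ^ i) = c * h $$ (k, (w ^^ i) 0))" for i
  proof (induction i)
    case 0
    then show ?case by (intro exI[of _ 1]) simp
  next
    case (Suc i)
    then obtain c where c: "c \<noteq> 0" "\<And>k. k < n \<Longrightarrow> h $$ (k, 0) ^ (?q ^ i) = c * h $$ (k, (w ^^ i) 0)" by blast
    let ?j = "(w ^^ i) 0"
    have "h $$ (k, 0) ^ (?q ^ Suc i) = (c ^ ?q * M $$ (w ?j, ?j)) * h $$ (k, (w ^^ Suc i) 0)" if k: "k < n" for k
    proof -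
      have "h $$ (k, 0) ^ (?q ^ Suc i) = (h $$ (k, 0) ^ (?q ^ i)) ^ ?q"
        by (simp add: mult.commute flip: power_mult)
      then show ?thesis using c(2)[OF k] F[OF k wi] by (simp add: power_mult_distrib)
    qed
    moreover have "c ^ ?q * M $$ (w ?j, ?j) \<noteq> 0" using c(1) M[OF wlt[OF wi] wi] by simp
    ultimately show ?case by blast
  qed
  define g where "g = mat n n (\<lambda>(k, i). h $$ (k, 0) ^ (?q ^ i))"
  have gc: "g \<in> carrier_mat n n" by (simp add: g_def)
  \<comment> \<open>A vector orthogonal to all columns of \<open>g\<close> is orthogonal to all
    columns of \<open>h\<close>, since these are the same up to nonzero scalars and order.\<close>
  have "det g \<noteq> 0"
  proof
    assume "det g = 0"
    then have "det (transpose_mat g) = 0" using det_transpose[OF gc] by simp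
    then obtain y where y: "y \<in> carrier_vec n" "y \<noteq> 0\<^sub>v n" "transpose_mat g *\<^sub>v y = 0\<^sub>v n"
      using det_0_iff_vec_prod_zero[of "transpose_mat g" n] gc by auto
    have 1: "(\<Sum>k<n. h $$ (k, 0) ^ (?q ^ i) * y $ k) = 0" if "i < n" for i
    proof -
      have "(\<Sum>k<n. h $$ (k, 0) ^ (?q ^ i) * y $ k) = (transpose_mat g *\<^sub>v y) $ i"
        using that y(1) by (simp add: g_def scalar_prod_def atLeast0LessThan)
      then show ?thesis using y(3) that by simp
    qed
    have "(\<Sum>k<n. h $$ (k, j) * y $ k) = 0" if "j < n" for j
    proof -
      obtain i where i: "i < n" "j = (w ^^ i) 0" using n_cycle_orbit(1)[OF w n] \<open>j < n\<close> by blast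
      obtain c where c: "c \<noteq> 0" "\<forall>k<n. h $$ (k, 0) ^ (?q ^ i) = c * h $$ (k, j)" using ex[of i] i by blast
      have "c * (\<Sum>k<n. h $$ (k, j) * y $ k) = (\<Sum>k<n. h $$ (k, 0) ^ (?q ^ i) * y $ k)"
        unfolding sum_distrib_left using c(2) by (intro sum.cong) (auto simp: mult_ac)
      then show ?thesis using 1[OF i(1)] c(1) by simp
    qed
    then have "transpose_mat h *\<^sub>v y = 0\<^sub>v n"
      using hc y(1) by (intro eq_vecI) (auto simp: scalar_prod_def atLeast0LessThan)
    then have "det (transpose_mat h) = 0"
      using det_0_iff_vec_prod_zero[of "transpose_mat h" n] hc y by auto
    then show False using hc det_transpose[OF hc(1)] by simp
  qed
  moreover obtain \<gamma> where "\<forall>k<n. h $$ (k, 0) ^ (?q ^ n) = \<gamma> * h $$ (k, 0)"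
    using ex[of n] n_cycle_orbit(2)[OF w n] by auto
  ultimately have fr: "frame n g"
    using gc n unfolding frame_def by (auto simp: g_def)
  have "eigenvalue_in n g x (t $$ (0, 0))"
  proof (rule eigenvalue_inI[OF fr xc])
    fix k assume k: "k < n"
    have "(\<Sum>j<n. to_ac (x $$ (k, j)) * g $$ (j, 0)) = (ac_mat x * h) $$ (k, 0)"
      using k n xc hc by (simp add: g_def scalar_prod_def atLeast0LessThan)
    also have "\<dots> = (\<Sum>j<n. h $$ (k, j) * t $$ (j, 0))"
      unfolding xh using k n t hc by (simp add: scalar_prod_def atLeast0LessThan)
    also have "\<dots> = (\<Sum>j<n. if j = 0 then h $$ (k, 0) * t $$ (0, 0) else 0)"
      using t n by (intro sum.cong) (auto simp: diagonal_mat_def)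
    also have "\<dots> = t $$ (0, 0) * g $$ (k, 0)" using n k by (simp add: g_def)
    finally show "(\<Sum>j<n. to_ac (x $$ (k, j)) * g $$ (j, 0)) = t $$ (0, 0) * g $$ (k, 0)" .
  qed
  then show ?thesis using that fr by blast
qed

text \<open>The characteristic polynomial is a power of a linear factor. Consequently an irreducible
  torus element has its eigenvalue outside the base field.\<close>

lemma not_irreducible_scalar_mat:
  assumes "n > 1"
  shows "\<not> irreducible_matrix (c \<cdot>\<^sub>m 1\<^sub>m n :: 'a :: field mat)"
proof -
  let ?A = "c \<cdot>\<^sub>m 1\<^sub>m n :: 'a mat"
  have "char_poly ?A = (\<Prod>a\<leftarrow>diag_mat ?A. [:- a, 1:])"
    by (rule char_poly_upper_triangular[of _ n]) auto
  also have "diag_mat ?A = replicate n c"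
    by (auto simp: diag_mat_def intro!: nth_equalityI)
  finally have "char_poly ?A = [:- c, 1:] ^ n" by simp
  moreover have "[:- c, 1:] ^ n = [:- c, 1:] * [:- c, 1:] ^ (n - 1)"
    using assms by (cases n) auto
  moreover have "\<not> [:- c, 1:] dvd 1" by (simp add: is_unit_poly_iff)
  moreover have "\<not> [:- c, 1:] ^ (n - 1) dvd 1"
  proof
    assume "[:- c, 1:] ^ (n - 1) dvd 1"
    then have "Polynomial.degree ([:- c, 1:] ^ (n - 1)) = 0" by (simp only: poly_dvd_1)
    then show False using assms by (simp only: degree_linear_power)
  qed
  ultimately show ?thesis
    unfolding irreducible_matrix_def by (metis Factorial_Ring.irreducible_multD)
qed

lemma field_card_gt_1: "CARD('a :: {finite,field}) > 1"
  using card_mono[of "UNIV :: 'a set" "{0,1}"] by simp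

lemma smult_mat_eq_mult:
  fixes Y :: "'b :: comm_ring_1 mat"
  assumes "Y \<in> carrier_mat n n"
  shows "c \<cdot>\<^sub>m Y = (c \<cdot>\<^sub>m 1\<^sub>m n) * Y"
  using mult_smult_assoc_mat[of "1\<^sub>m n" n n Y n c] assms by simp

section \<open>Torus elements of determinant one\<close>

context
  fixes n :: nat and g :: "'a :: {finite,field} alg_closure mat"
  assumes g: "frame n g" and n: "Factorial_Ring.prime n" "n > 2"
begin

lemma odd_n: "odd n"
  using n prime_odd_nat by blast

lemma n_pos: "0 < n"
  using n by simp

lemma eigenvalue_in_det_1:
  assumes "eigenvalue_in n g Y \<mu>" "det Y = 1"
  shows "\<mu> ^ (\<Sum>i<n. CARD('a) ^ i) = 1" "\<mu> \<noteq> 0"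
proof -
  show *: "\<mu> ^ (\<Sum>i<n. CARD('a) ^ i) = 1"
    using det_eigenvalue_in[OF g assms(1)] assms(2) by simp
  have "(\<Sum>i<n. CARD('a) ^ i) \<noteq> 0" using n_pos by (auto intro!: exI[of _ 0])
  then show "\<mu> \<noteq> 0" using * by (metis power_0_left zero_neq_one)
qed

lemma det_1_power_scalar_fixed:
  assumes Y: "eigenvalue_in n g Y \<mu>" "det Y = 1" and fixed: "(\<mu> ^ n) ^ CARD('a) = \<mu> ^ n"
  shows "\<mu> ^ CARD('a) = \<mu>"
proof (rule norm_one_fixed[OF n(1) odd_n field_card_gt_1])
  show "\<mu> ^ (\<Sum>i<n. CARD('a) ^ i) = 1"
    by (rule eigenvalue_in_det_1(1)[OF Y])
  have "\<mu> ^ n * (\<mu> ^ n) ^ (CARD('a) - 1) = (\<mu> ^ n) ^ CARD('a)"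
    using field_card_gt_1[where 'a = 'a] by (cases "CARD('a)") auto
  then have "\<mu> ^ n * (\<mu> ^ n) ^ (CARD('a) - 1) = \<mu> ^ n * 1" using fixed by simp
  then show "(\<mu> ^ n) ^ (CARD('a) - 1) = 1"
    using eigenvalue_in_det_1(2)[OF Y] by (metis mult_left_cancel power_not_zero)
qed

text \<open>Lifts of commuting elements of PSL satisfy such an equation. It makes \<open>Y\<close>
  conjugate to \<open>z \<cdot>\<^sub>m Y\<close>, so z \<mu> = \<mu>^(q^i) for some i < n. Taking
  n-th powers removes z, and for i \<noteq> 0 it follows that \<mu>^n, and then \<mu>, is in the
  base field.\<close>

lemma eigenvalue_in_twisted_commute:
  assumes Y: "eigenvalue_in n g Y \<mu>" "\<mu> ^ CARD('a) \<noteq> \<mu>" "det Y = 1"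
    and Z: "Z \<in> carrier_mat n n" "det Z \<noteq> 0" and z: "z ^ n = 1" and eq: "Z * Y = z \<cdot>\<^sub>m (Y * Z)"
  shows "z = 1"
proof -
  let ?q = "CARD('a)"
  have Yc: "Y \<in> carrier_mat n n" using Y(1) by (simp add: eigenvalue_in_def)
  have W: "eigenvalue_in n g (z \<cdot>\<^sub>m Y) (to_ac z * \<mu>)"
    unfolding smult_mat_eq_mult[OF Yc] by (rule eigenvalue_in_mult[OF g eigenvalue_in_smult_one[OF g] Y(1)])
  have "Z * Y = (z \<cdot>\<^sub>m Y) * Z"
    using eq mult_smult_assoc_mat[OF Yc Z(1)] by simp
  from eigenvalue_in_conj[OF g n_pos Y(1) W Z this]
  obtain i where i: "i < n" "to_ac z * \<mu> = \<mu> ^ (?q ^ i)" by blast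
  have \<mu>0: "\<mu> \<noteq> 0" by (rule eigenvalue_in_det_1(2)[OF Y(1,3)])
  show ?thesis
  proof (cases "i = 0")
    case True
    then show ?thesis using i \<mu>0 by simp
  next
    case False
    have "(\<mu> ^ n) ^ (?q ^ i) = (\<mu> ^ (?q ^ i)) ^ n"
      by (simp add: mult.commute flip: power_mult)
    also have "\<dots> = to_ac z ^ n * \<mu> ^ n"
      unfolding i(2)[symmetric] by (rule power_mult_distrib)
    also have "to_ac z ^ n = 1" using z by (simp flip: to_ac_power)
    finally have 1: "(\<mu> ^ n) ^ (?q ^ i) = \<mu> ^ n" by simp
    have "(\<mu> ^ n) ^ (?q ^ n) = (\<mu> ^ (?q ^ n)) ^ n"
      by (simp add: mult.commute flip: power_mult)
    then have 2: "(\<mu> ^ n) ^ (?q ^ n) = \<mu> ^ n"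
      using eigenvalue_in_periodic[OF g Y(1) n_pos] by simp
    have "coprime i n"
      using False i n by (metis coprime_commute dvd_imp_le gr0I linorder_not_le prime_imp_coprime)
    then have "(\<mu> ^ n) ^ ?q = \<mu> ^ n"
      using coprime_frobenius_fixed[OF 2 1] False by simp
    then show ?thesis
      using det_1_power_scalar_fixed[OF Y(1,3)] Y(2) by blast
  qed
qed

text \<open>\<open>A\<close> has order \<open>p\<close> modulo scalars. Since q has order n modulo
  p, n divides p - 1, and the quotient is neither 0 nor 1: for quotient 1 the prime p = n + 1 would
  be even and larger than 2.\<close>

lemma prime_order_eigenvalue_in:
  assumes A: "eigenvalue_in n g A \<mu>" "\<mu> ^ CARD('a) \<noteq> \<mu>" "det A = 1"
    and p: "Factorial_Ring.prime p" and Ap: "A ^\<^sub>m p = z \<cdot>\<^sub>m 1\<^sub>m n" and z: "z ^ n = 1"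
  obtains m where "p > n + 1" "[m = 1] (mod p)" "A ^\<^sub>m (m * p) = 1\<^sub>m n" "\<mu> ^ (m * p) = 1" "(\<mu> ^ m) ^ CARD('a) \<noteq> \<mu> ^ m"
    "\<not> p dvd CARD('a)"
proof -
  let ?q = "CARD('a)"
  have \<mu>0: "\<mu> \<noteq> 0" by (rule eigenvalue_in_det_1(2)[OF A(1,3)])
  have \<mu>p: "\<mu> ^ p = to_ac z"
    using eigenvalue_in_eq[OF g eigenvalue_in_pow[OF g A(1), of p], of "to_ac z"] eigenvalue_in_smult_one[OF g, of z] Ap n_pos
    by simp
  \<comment> \<open>For \<open>p = n\<close> the power \<mu>^n would be in the base field, which the
    norm condition excludes.\<close>
  have "p \<noteq> n"
  proof
    assume "p = n"
    then have "(\<mu> ^ n) ^ ?q = \<mu> ^ n" using \<mu>p frobenius_to_ac[of z 1] by simp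
    then show False using det_1_power_scalar_fixed[OF A(1,3)] A(2) by blast
  qed
  then have "coprime n p" using primes_coprime n(1) p by blast
  then obtain n' where "[n * n' = 1] (mod p)" using cong_solve_coprime_nat[of n p] by auto
  \<comment> \<open>A multiple of \<open>n\<close> that is 1 modulo \<open>p\<close>: raising to the
    power \<open>m\<close> kills the scalar \<open>z\<close> but does not change the image of
    \<open>A\<close> modulo scalars.\<close>
  define m where "m = n * n'"
  have m1: "[m = 1] (mod p)" using \<open>[n * n' = 1] (mod p)\<close> by (simp add: m_def)
  have "m \<noteq> 0"
  proof
    assume "m = 0"
    then have "[0 = 1] (mod p)" using m1 by simp
    then show False using prime_gt_1_nat[OF p] by (simp add: cong_def)
  qed
  have "p dvd m - 1" using m1 \<open>m \<noteq> 0\<close> by (simp add: cong_altdef_nat)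
  then obtain j where "m - 1 = p * j" by auto
  then have j: "m = 1 + p * j" using \<open>m \<noteq> 0\<close> by simp
  have zm: "z ^ m = 1" using z by (simp add: m_def power_mult)
  have \<mu>mp: "(\<mu> ^ m) ^ p = 1"
  proof -
    have "(\<mu> ^ m) ^ p = (\<mu> ^ p) ^ m" by (simp add: mult.commute flip: power_mult)
    also have "\<dots> = 1" unfolding \<mu>p using zm by (simp flip: to_ac_power)
    finally show ?thesis .
  qed
  have Amp: "A ^\<^sub>m (m * p) = 1\<^sub>m n"
    using eigenvalue_in_unique[OF g eigenvalue_in_pow[OF g A(1), of "m * p"]] eigenvalue_in_one[OF g] \<mu>mp
    by (simp add: power_mult)
  have nfix: "(\<mu> ^ m) ^ ?q \<noteq> \<mu> ^ m"
  proof
    assume *: "(\<mu> ^ m) ^ ?q = \<mu> ^ m"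
    have e: "\<mu> ^ m = \<mu> * to_ac z ^ j" unfolding j by (simp add: power_add power_mult \<mu>p)
    have "to_ac z ^ j \<noteq> 0" using \<mu>0 \<mu>p by (metis power_not_zero)
    moreover have "(to_ac z ^ j) ^ ?q = to_ac z ^ j"
      using frobenius_to_ac[of "z ^ j" 1] by simp
    then have "\<mu> ^ ?q * to_ac z ^ j = \<mu> * to_ac z ^ j"
      using * unfolding e by (simp add: power_mult_distrib)
    ultimately show False using A(2) by simp
  qed
  then have \<mu>m1: "\<mu> ^ m \<noteq> 1" by auto
  have q1: "?q > 1" by (rule field_card_gt_1)
  have "(\<mu> ^ m) ^ (?q ^ n - 1) = 1"
  proof -
    have "(\<mu> ^ m) * (\<mu> ^ m) ^ (?q ^ n - 1) = (\<mu> ^ m) ^ (?q ^ n)"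
      using power_minus_mult[of "?q ^ n" "\<mu> ^ m"] q1 by (simp add: mult.commute)
    also have "\<dots> = (\<mu> ^ (?q ^ n)) ^ m" by (simp add: mult.commute flip: power_mult)
    also have "\<dots> = \<mu> ^ m * 1" using eigenvalue_in_periodic[OF g A(1) n_pos] by simp
    finally show ?thesis using mult_left_cancel[OF power_not_zero[OF \<mu>0]] by blast
  qed
  then have "p dvd ?q ^ n - 1"
    using power_eq_1_coprime[OF \<mu>mp, of "?q ^ n - 1"] \<mu>m1 prime_imp_coprime[OF p, of "?q ^ n - 1"] prime_gt_0_nat[OF p]
    by (cases "p dvd ?q ^ n - 1") simp_all
  then have qn: "[?q ^ n = 1] (mod p)"
    using q1 by (simp add: cong_altdef_nat one_le_power)
  have "\<not> [?q = 1] (mod p)"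
  proof
    assume "[?q = 1] (mod p)"
    then have "p dvd ?q - 1" using q1 by (simp add: cong_altdef_nat)
    then have "(\<mu> ^ m) ^ (?q - 1) = 1" using \<mu>mp by (auto simp: power_mult elim!: dvdE)
    then have "(\<mu> ^ m) ^ ?q = \<mu> ^ m" using power_minus_mult[of ?q "\<mu> ^ m"] q1 by simp
    then show False using nfix by blast
  qed
  moreover have "ord p ?q dvd n" using qn ord_divides by blast
  \<comment> \<open>The order divides the prime \<open>n\<close>, and it is not 1 because
    \<open>\<mu> ^ m\<close> is a \<open>p\<close>-th root of unity outside the base field.\<close>
  ultimately have "ord p ?q = n"
    using n(1) ord_divides[of ?q 1 p] by (auto simp: prime_nat_iff)
  have pq: "\<not> p dvd ?q"
  proof
    assume "p dvd ?q"
    then have "p dvd ?q ^ n" using n_pos by (cases n) auto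
    then show False using cong_dvd_iff[OF qn] p by simp
  qed
  then have "coprime p ?q" using p prime_imp_coprime by blast
  then have "n dvd totient p"
    using order_divides_totient[of p ?q] \<open>ord p ?q = n\<close> by simp
  then have "n dvd p - 1" using p by (simp add: totient_prime)
  then obtain i where i: "p - 1 = n * i" by auto
  have "i \<noteq> 0" using i prime_gt_1_nat[OF p] by (intro notI) simp
  have "i \<noteq> 1"
  proof
    assume "i = 1"
    then have "p = n + 1" using i prime_gt_1_nat[OF p] by simp
    then have "even p" using odd_n by simp
    then have "p = 2" using p primes_dvd_imp_eq[OF two_is_prime_nat p] by simp
    then show False using \<open>p = n + 1\<close> n(2) by simp
  qed
  then have "p - 1 \<ge> n * 2" using i \<open>i \<noteq> 0\<close> by simp
  then have "p > n + 1" using n_pos by simp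
  moreover have "\<mu> ^ (m * p) = 1" using \<mu>mp by (simp add: power_mult)
  ultimately show ?thesis using that m1 Amp nfix pq by blast
qed

end

section \<open>Fixed-point-free subgroups of the special linear group\<close>

lemma carrier_SL: "carrier (SL n :: 'a :: field mat monoid) = {A \<in> carrier_mat n n. det A = 1}"
  by (auto simp: SL_def carrier_GL)

lemma mult_SL [simp]: "A \<otimes>\<^bsub>SL n\<^esub> B = A * B"
  and one_SL [simp]: "\<one>\<^bsub>SL n\<^esub> = 1\<^sub>m n"
  by (simp_all add: SL_def)

lemma subgroup_SL: "subgroup (carrier (SL n)) (GL n :: 'a :: field mat monoid)"
proof -
  interpret GL: group "GL n :: 'a mat monoid" by (rule group_GL)
  show ?thesis
  proof (rule GL.subgroupI)
    show "carrier (SL n :: 'a mat monoid) \<noteq> {}"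
      by (auto simp: carrier_SL intro!: exI[of _ "1\<^sub>m n"])
    fix A :: "'a mat" assume A: "A \<in> carrier (SL n)"
    then have AG: "A \<in> carrier (GL n)" by (auto simp: SL_def)
    then have "inv\<^bsub>GL n\<^esub> A \<in> carrier (GL n)" and "inv\<^bsub>GL n\<^esub> A * A = 1\<^sub>m n"
      using GL.inv_closed[OF AG] GL.l_inv[OF AG] by auto
    moreover from this have "det (inv\<^bsub>GL n\<^esub> A) * det A = 1"
      using A det_mult[of "inv\<^bsub>GL n\<^esub> A" n A] by (simp add: carrier_GL carrier_SL)
    ultimately show "inv\<^bsub>GL n\<^esub> A \<in> carrier (SL n)"
      using A by (auto simp: carrier_SL carrier_GL)
    fix B :: "'a mat" assume "B \<in> carrier (SL n)"
    then show "A \<otimes>\<^bsub>GL n\<^esub> B \<in> carrier (SL n)"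
      using A by (auto simp: carrier_SL det_mult[of _ n])
  qed (auto simp: SL_def)
qed

lemma group_SL: "group (SL n :: 'a :: field mat monoid)"
proof -
  have "SL n = (GL n :: 'a mat monoid)\<lparr>carrier := carrier (SL n)\<rparr>"
    by (simp add: SL_def)
  then show ?thesis
    using group.subgroup_imp_group[OF group_GL subgroup_SL] by metis
qed

lemma pow_SL: "A [^]\<^bsub>SL n\<^esub> (k::nat) = A ^\<^sub>m k" if "A \<in> carrier_mat n n" for A :: "'a :: field mat"
proof (induction k)
  case 0
  then show ?case using that by (simp add: nat_pow_def)
next
  case (Suc k)
  then show ?case by (simp add: nat_pow_def)
qed

section \<open>Counting, summing and tracing matrices\<close>

lemma finite_carrier_mat: "finite (carrier_mat m n :: 'a :: finite mat set)"
  and card_carrier_mat: "card (carrier_mat m n :: 'a :: finite mat set) = CARD('a) ^ (m * n)"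
proof -
  have bij: "bij_betw (\<lambda>f. mat m n f) (({..<m} \<times> {..<n}) \<rightarrow>\<^sub>E UNIV) (carrier_mat m n :: 'a mat set)"
  proof (rule bij_betw_byWitness[where f' = "\<lambda>A. restrict (\<lambda>ij. A $$ ij) ({..<m} \<times> {..<n})"])
    show "\<forall>f\<in>({..<m} \<times> {..<n}) \<rightarrow>\<^sub>E UNIV. restrict (\<lambda>ij. mat m n f $$ ij) ({..<m} \<times> {..<n}) = f"
      by (auto simp: fun_eq_iff PiE_def extensional_def)
    show "\<forall>A\<in>carrier_mat m n. mat m n (restrict (\<lambda>ij. A $$ ij) ({..<m} \<times> {..<n})) = (A :: 'a mat)"
      by (auto intro!: eq_matI)
  qed (auto split: if_splits)
  then show "finite (carrier_mat m n :: 'a mat set)"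
    using bij_betw_finite[OF bij] by (simp add: finite_PiE)
  show "card (carrier_mat m n :: 'a mat set) = CARD('a) ^ (m * n)"
    using bij_betw_same_card[OF bij] by (simp add: card_PiE card_cartesian_product)
qed

lemma finite_SL: "finite (carrier (SL n :: 'a :: {finite,field} mat monoid))"
  by (rule finite_subset[OF _ finite_carrier_mat[of n n]]) (auto simp: carrier_SL)

text \<open>The size of a matrix is not part of its type; the argument \<open>n\<close> fixes it,
  also for the empty sum.\<close>

definition mat_sum :: "nat \<Rightarrow> 'i set \<Rightarrow> ('i \<Rightarrow> 'a :: comm_ring_1 mat) \<Rightarrow> 'a mat" where
  "mat_sum n I f = mat n n (\<lambda>ij. \<Sum>i\<in>I. f i $$ ij)"

lemma mat_sum_carrier [simp]: "mat_sum n I f \<in> carrier_mat n n"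
  and mat_sum_dim [simp]: "dim_row (mat_sum n I f) = n" "dim_col (mat_sum n I f) = n"
  by (simp_all add: mat_sum_def)

lemma mat_sum_cong: "(\<And>i. i \<in> I \<Longrightarrow> f i = h i) \<Longrightarrow> mat_sum n I f = mat_sum n I h"
  by (simp add: mat_sum_def)

lemma mat_sum_reindex:
  assumes "bij_betw h I J"
  shows "mat_sum n J f = mat_sum n I (\<lambda>i. f (h i))"
proof -
  have "(\<Sum>j\<in>J. f j $$ ij) = (\<Sum>i\<in>I. f (h i) $$ ij)" for ij
    by (rule sum.reindex_bij_betw[OF assms, symmetric])
  then show ?thesis by (simp add: mat_sum_def)
qed

lemma mat_sum_swap:
  "mat_sum n I (\<lambda>i. mat_sum n J (f i)) = mat_sum n J (\<lambda>j. mat_sum n I (\<lambda>i. f i j))"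
proof (rule eq_matI)
  fix r c assume "r < dim_row (mat_sum n J (\<lambda>j. mat_sum n I (\<lambda>i. f i j)))"
    "c < dim_col (mat_sum n J (\<lambda>j. mat_sum n I (\<lambda>i. f i j)))"
  then have rc: "r < n" "c < n" by simp_all
  show "mat_sum n I (\<lambda>i. mat_sum n J (f i)) $$ (r, c) = mat_sum n J (\<lambda>j. mat_sum n I (\<lambda>i. f i j)) $$ (r, c)"
    using rc sum.swap[of "\<lambda>i j. f i j $$ (r, c)" J I] by (simp add: mat_sum_def)
qed simp_all

lemma mult_mat_sum:
  assumes "A \<in> carrier_mat n n" "\<And>i. i \<in> I \<Longrightarrow> f i \<in> carrier_mat n n"
  shows "A * mat_sum n I f = mat_sum n I (\<lambda>i. A * f i)"
proof (rule eq_matI)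
  fix r c assume "r < dim_row (mat_sum n I (\<lambda>i. A * f i))" "c < dim_col (mat_sum n I (\<lambda>i. A * f i))"
  then have rc: "r < n" "c < n" by simp_all
  have "(A * mat_sum n I f) $$ (r, c) = (\<Sum>k = 0..<n. A $$ (r, k) * (\<Sum>i\<in>I. f i $$ (k, c)))"
    using rc assms(1) by (simp add: scalar_prod_def mat_sum_def)
  also have "\<dots> = (\<Sum>i\<in>I. \<Sum>k = 0..<n. A $$ (r, k) * f i $$ (k, c))"
    unfolding sum_distrib_left by (rule sum.swap)
  also have "\<dots> = (\<Sum>i\<in>I. (A * f i) $$ (r, c))"
  proof (rule sum.cong[OF refl])
    fix i assume i: "i \<in> I"
    show "(\<Sum>k = 0..<n. A $$ (r, k) * f i $$ (k, c)) = (A * f i) $$ (r, c)"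
      using rc assms(1) assms(2)[OF i] by (simp add: scalar_prod_def)
  qed
  finally show "(A * mat_sum n I f) $$ (r, c) = mat_sum n I (\<lambda>i. A * f i) $$ (r, c)"
    using rc by (simp add: mat_sum_def)
qed (use assms in auto)

lemma mat_sum_mult:
  assumes "A \<in> carrier_mat n n" "\<And>i. i \<in> I \<Longrightarrow> f i \<in> carrier_mat n n"
  shows "mat_sum n I f * A = mat_sum n I (\<lambda>i. f i * A)"
proof (rule eq_matI)
  fix r c assume "r < dim_row (mat_sum n I (\<lambda>i. f i * A))" "c < dim_col (mat_sum n I (\<lambda>i. f i * A))"
  then have rc: "r < n" "c < n" by simp_all
  have "(mat_sum n I f * A) $$ (r, c) = (\<Sum>k = 0..<n. (\<Sum>i\<in>I. f i $$ (r, k)) * A $$ (k, c))"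
    using rc assms(1) by (simp add: scalar_prod_def mat_sum_def)
  also have "\<dots> = (\<Sum>i\<in>I. \<Sum>k = 0..<n. f i $$ (r, k) * A $$ (k, c))"
    unfolding sum_distrib_right by (rule sum.swap)
  also have "\<dots> = (\<Sum>i\<in>I. (f i * A) $$ (r, c))"
  proof (rule sum.cong[OF refl])
    fix i assume i: "i \<in> I"
    show "(\<Sum>k = 0..<n. f i $$ (r, k) * A $$ (k, c)) = (f i * A) $$ (r, c)"
      using rc assms(1) assms(2)[OF i] by (simp add: scalar_prod_def)
  qed
  finally show "(mat_sum n I f * A) $$ (r, c) = mat_sum n I (\<lambda>i. f i * A) $$ (r, c)"
    using rc by (simp add: mat_sum_def)
qed (use assms in auto)

definition trace :: "'a :: comm_ring_1 mat \<Rightarrow> 'a" where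
  "trace A = (\<Sum>i<dim_row A. A $$ (i, i))"

lemma trace_mult_commute:
  assumes "A \<in> carrier_mat n n" "B \<in> carrier_mat n n"
  shows "trace (A * B) = trace (B * A)"
proof -
  have "trace (A * B) = (\<Sum>i<n. \<Sum>j<n. A $$ (i, j) * B $$ (j, i))"
    using assms by (simp add: trace_def scalar_prod_def atLeast0LessThan)
  also have "\<dots> = (\<Sum>j<n. \<Sum>i<n. B $$ (j, i) * A $$ (i, j))"
    by (subst sum.swap) (simp add: mult.commute)
  also have "\<dots> = trace (B * A)"
    using assms by (simp add: trace_def scalar_prod_def atLeast0LessThan)
  finally show ?thesis .
qed

lemma trace_mat_sum:
  assumes "\<And>i. i \<in> I \<Longrightarrow> f i \<in> carrier_mat n n"
  shows "trace (mat_sum n I f) = (\<Sum>i\<in>I. trace (f i))"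
proof -
  have "trace (mat_sum n I f) = (\<Sum>k<n. \<Sum>i\<in>I. f i $$ (k, k))"
    by (simp add: trace_def mat_sum_def)
  also have "\<dots> = (\<Sum>i\<in>I. \<Sum>k<n. f i $$ (k, k))" by (rule sum.swap)
  also have "\<dots> = (\<Sum>i\<in>I. trace (f i))"
    using assms by (intro sum.cong) (auto simp: trace_def)
  finally show ?thesis .
qed

text \<open>As \<open>k\<close> is invertible modulo \<open>p\<close>, \<open>a\<close> is itself a
  power of \<open>a [^] k\<close>.\<close>

lemma (in group) prime_order_commute:
  assumes a: "a \<in> carrier G" "a [^] p = \<one>" and p: "Factorial_Ring.prime (p::nat)" and k: "0 < k" "k < p"
    and d: "d \<in> carrier G" "d \<otimes> a [^] k = a [^] k \<otimes> d"
  shows "d \<otimes> a = a \<otimes> d"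
proof -
  have "coprime k p"
    using k p by (metis coprime_commute dvd_imp_le linorder_not_le prime_imp_coprime)
  then obtain l j where l: "k * l = p * j + 1" using bezout_nat[of k p] k by auto
  have "d \<otimes> (a [^] k) [^] i = (a [^] k) [^] i \<otimes> d" for i :: nat
  proof (induction i)
    case (Suc i)
    then show ?case using commute_mult[of "(a [^] k) [^] i" "a [^] k" d] a d by simp
  qed (use d in simp)
  moreover have "(a [^] k) [^] l = a"
  proof -
    have "(a [^] k) [^] l = a [^] (p * j + 1)"
      using a l by (simp add: nat_pow_pow)
    also have "\<dots> = (a [^] p) [^] j \<otimes> a"
      using a(1) nat_pow_mult[of a "p * j" 1] by (simp add: nat_pow_pow)
    finally show ?thesis using a by simp
  qed
  ultimately show ?thesis by metis
qed

lemma mat_sum_shift: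
  assumes "f p = f 0"
  shows "mat_sum n {..<p} (\<lambda>k. f (Suc k)) = mat_sum n {..<p} f"
proof -
  have "(\<Sum>k<p. f (Suc k) $$ ij) = (\<Sum>k<p. f k $$ ij)" for ij
  proof -
    have "f 0 $$ ij + (\<Sum>k<p. f (Suc k) $$ ij) = (\<Sum>k<p. f k $$ ij) + f p $$ ij"
      using sum.lessThan_Suc[of "\<lambda>k. f k $$ ij" p] sum.lessThan_Suc_shift[of "\<lambda>k. f k $$ ij" p] by simp
    then show ?thesis using assms by simp
  qed
  then show ?thesis by (simp add: mat_sum_def)
qed

lemma mat_sum_const:
  assumes "A \<in> carrier_mat n n"
  shows "mat_sum n I (\<lambda>_. A) = of_nat (card I) \<cdot>\<^sub>m A"
  by (rule eq_matI) (use assms in \<open>auto simp: mat_sum_def\<close>)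

section \<open>Linear groups normalized by a torus element of prime order\<close>

context
  fixes n :: nat and g :: "'a :: {finite,field} alg_closure mat" and a :: "'a mat" and \<mu> and p :: nat
  assumes g: "frame n g" and n: "Factorial_Ring.prime n" "n > 2"
    and a: "eigenvalue_in n g a \<mu>" "\<mu> ^ CARD('a) \<noteq> \<mu>" "a \<in> carrier (SL n)"
    and p: "Factorial_Ring.prime p" "a [^]\<^bsub>SL n\<^esub> p = 1\<^sub>m n" "\<not> p dvd CARD('a)"
begin

lemma SL_carrier_mat: "A \<in> carrier (SL n) \<Longrightarrow> A \<in> carrier_mat n n" for A :: "'a mat"
  by (simp add: carrier_SL)

lemma of_nat_p_nonzero: "of_nat p \<noteq> (0 :: 'a)"
proof
  assume "of_nat p = (0 :: 'a)"
  then have "CHAR('a) dvd p" by (simp add: of_nat_eq_0_iff_char_dvd)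
  then have "CHAR('a) = p"
    using p(1) prime_CHAR_finite[where 'a = 'a] primes_dvd_imp_eq by blast
  then show False using p(3) CHAR_dvd_CARD[where 'a = 'a] by simp
qed

lemma commuting_det_nonzero:
  assumes "Z \<in> carrier_mat n n" "Z * a = a * Z" "Z \<noteq> 0\<^sub>m n n"
  shows "det Z \<noteq> 0"
proof -
  obtain \<nu> where "eigenvalue_in n g Z \<nu>"
    using eigenvalue_in_commute[OF g n(1) a(1,2) assms(1,2)] by blast
  then show ?thesis using det_eigenvalue_in_nonzero[OF g _ assms(3)] by blast
qed

text \<open>Averaging over the powers of \<open>a\<close> turns \<open>Y\<close> into a nonzero fixed matrix that commutes with \<open>a\<close>,
  and such a matrix is invertible.\<close>

lemma trivial_of_fixed_matrix:
  assumes D: "D \<subseteq> carrier (SL n)" and aD: "\<And>d. d \<in> D \<Longrightarrow> \<exists>d'\<in>D. d * a = a * d'"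
    and Y: "Y \<in> carrier_mat n n" "Y \<noteq> 0\<^sub>m n n" and fixed: "\<And>d. d \<in> D \<Longrightarrow> d * Y = Y"
    and d: "d \<in> D"
  shows "d = 1\<^sub>m n"
proof -
  interpret SL: group "SL n :: 'a mat monoid" by (rule group_SL)
  have aG: "a \<in> carrier (SL n)" by (rule a(3))
  have "\<exists>i<n. \<exists>j<n. Y $$ (i, j) \<noteq> 0"
  proof (rule ccontr)
    assume "\<not> ?thesis"
    then have "Y = 0\<^sub>m n n" using Y(1) by (intro eq_matI) auto
    then show False using Y(2) by blast
  qed
  then obtain i j where ij: "i < n" "j < n" "Y $$ (i, j) \<noteq> 0" by blast
  \<comment> \<open>A matrix unit for which the trace of \<open>Y * U\<close> is the nonzero entry
    \<open>(i, j)\<close> of \<open>Y\<close>. Conjugation preserves the trace, so the sum of the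
    \<open>p\<close> conjugates has \<open>p\<close> times this trace, which is nonzero as
    \<open>p\<close> is not the characteristic.\<close>
  define U :: "'a mat" where "U = mat n n (\<lambda>(r, c). if r = j \<and> c = i then 1 else 0)"
  have Uc: "U \<in> carrier_mat n n" by (simp add: U_def)
  have trYU: "trace (Y * U) = Y $$ (i, j)"
  proof -
    have "(Y * U) $$ (k, k) = (if k = i then Y $$ (i, j) else 0)" if "k < n" for k
    proof -
      have "(Y * U) $$ (k, k) = (\<Sum>l = 0..<n. Y $$ (k, l) * U $$ (l, k))"
        using that Y(1) Uc by (simp add: scalar_prod_def)
      also have "\<dots> = (\<Sum>l = 0..<n. if l = j then (if k = i then Y $$ (k, j) else 0) else 0)"
        using that by (intro sum.cong) (auto simp: U_def)
      finally have "(Y * U) $$ (k, k) = (\<Sum>l = 0..<n. if l = j then (if k = i then Y $$ (k, j) else 0) else 0)" .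
      then show ?thesis using ij by simp
    qed
    then have "trace (Y * U) = (\<Sum>k<n. if k = i then Y $$ (i, j) else 0)"
      using Y(1) by (simp add: trace_def)
    then show ?thesis using ij by simp
  qed
  define P where "P k = a [^]\<^bsub>SL n\<^esub> (k::nat)" for k
  define Q where "Q k = (inv\<^bsub>SL n\<^esub> a) [^]\<^bsub>SL n\<^esub> (k::nat)" for k
  have PG: "P k \<in> carrier (SL n)" and QG: "Q k \<in> carrier (SL n)" for k
    using aG by (simp_all add: P_def Q_def)
  note Pc = SL_carrier_mat[OF PG] and Qc = SL_carrier_mat[OF QG]
  have ac: "a \<in> carrier_mat n n" by (rule SL_carrier_mat[OF aG])
  have QP: "Q k * P k = 1\<^sub>m n" for k
    using SL.l_inv[OF PG[of k]] aG by (simp add: P_def Q_def SL.nat_pow_inv)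
  have PS: "P (Suc k) = a * P k" and QS: "Q (Suc k) * a = Q k" for k
  proof -
    show "P (Suc k) = a * P k" using SL.nat_pow_Suc2[OF aG, of k] by (simp add: P_def)
    have "Q (Suc k) \<otimes>\<^bsub>SL n\<^esub> a = Q k \<otimes>\<^bsub>SL n\<^esub> (inv\<^bsub>SL n\<^esub> a \<otimes>\<^bsub>SL n\<^esub> a)"
      using aG QG[of k] by (simp add: Q_def SL.m_assoc del: mult_SL)
    then show "Q (Suc k) * a = Q k" using SL.l_inv[OF aG] SL.r_one[OF QG[of k]] by simp
  qed
  have P0: "P p = P 0" "Q p = Q 0"
    using p(2) aG SL.inv_one by (simp_all add: P_def Q_def SL.nat_pow_inv)
  define f where "f k = P k * (Y * U) * Q k" for k
  have YUc: "Y * U \<in> carrier_mat n n" using Y(1) Uc by simp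
  have fc: "f k \<in> carrier_mat n n" for k
    unfolding f_def by (intro mult_carrier_mat[OF mult_carrier_mat[OF Pc YUc] Qc])
  define S where "S = mat_sum n {..<p} f"
  note dims = carrier_matD[OF Pc] carrier_matD[OF Qc] carrier_matD[OF ac] carrier_matD[OF Y(1)] carrier_matD[OF Uc]
  have shift: "a * f k = f (Suc k) * a" for k
  proof -
    have "f (Suc k) * a = P (Suc k) * (Y * U) * (Q (Suc k) * a)"
      unfolding f_def using dims by (simp add: mat_assoc del: assoc_mult_mat)
    also have "\<dots> = a * f k"
      unfolding PS QS f_def using dims by (simp add: mat_assoc del: assoc_mult_mat)
    finally show ?thesis by simp
  qed
  have "S * a = a * S"
  proof -
    have "a * S = mat_sum n {..<p} (\<lambda>k. f (Suc k) * a)"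
      unfolding S_def by (subst mult_mat_sum[OF ac fc]) (simp add: shift)
    also have "\<dots> = mat_sum n {..<p} (\<lambda>k. f (Suc k)) * a"
      by (rule mat_sum_mult[OF ac fc, symmetric])
    also have "\<dots> = S * a"
      unfolding S_def using P0 by (subst mat_sum_shift) (simp_all add: f_def)
    finally show ?thesis by simp
  qed
  moreover have "trace S \<noteq> 0"
  proof -
    have "trace (f k) = trace (Y * U)" for k
    proof -
      have "trace (f k) = trace (Q k * (P k * (Y * U)))"
        unfolding f_def by (rule trace_mult_commute[OF mult_carrier_mat[OF Pc YUc] Qc])
      also have "Q k * (P k * (Y * U)) = (Q k * P k) * (Y * U)"
        using dims by (simp add: mat_assoc del: assoc_mult_mat)
      finally show ?thesis unfolding QP left_mult_one_mat[OF YUc] .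
    qed
    then have "trace S = of_nat p * Y $$ (i, j)"
      unfolding S_def by (subst trace_mat_sum[OF fc]) (simp add: trYU)
    then show ?thesis using of_nat_p_nonzero ij by simp
  qed
  then have "S \<noteq> 0\<^sub>m n n" by (auto simp: trace_def)
  ultimately have detS: "det S \<noteq> 0"
    using commuting_det_nonzero[of S] by (simp add: S_def)
  \<comment> \<open>Elements of \<open>D\<close> can be moved past the powers of \<open>a\<close>,
    so \<open>d\<close> acts on each conjugate of \<open>Y * U\<close> through some element of
    \<open>D\<close> acting on \<open>Y\<close>.\<close>
  have dP: "\<exists>d'\<in>D. d * P k = P k * d'" if "d \<in> D" for d k
    using that
  proof (induction k arbitrary: d)
    case 0
    then have "d \<in> carrier_mat n n" using D SL_carrier_mat by blast
    then show ?case using 0 by (intro bexI[of _ d]) (auto simp: P_def)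
  next
    case (Suc k)
    obtain e where e: "e \<in> D" "d * a = a * e" using aD Suc.prems by blast
    obtain h where h: "h \<in> D" "e * P k = P k * h" using Suc.IH e(1) by blast
    have c: "d \<in> carrier_mat n n" "e \<in> carrier_mat n n" "h \<in> carrier_mat n n"
      using D SL_carrier_mat Suc.prems e h by blast+
    note d = c[THEN carrier_matD(1)] c[THEN carrier_matD(2)] dims
    have "d * P (Suc k) = (d * a) * P k"
      unfolding PS using d by (simp add: mat_assoc del: assoc_mult_mat)
    also have "\<dots> = a * (e * P k)"
      unfolding e(2) using d by (simp add: mat_assoc del: assoc_mult_mat)
    also have "\<dots> = P (Suc k) * h"
      unfolding h(2) PS using d by (simp add: mat_assoc del: assoc_mult_mat)
    finally show ?case using h(1) by blast
  qed
  have dc: "d \<in> carrier_mat n n" using D SL_carrier_mat d by blast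
  have "d * f k = f k" for k
  proof -
    obtain e where e: "e \<in> D" "d * P k = P k * e" using dP[OF d] by blast
    have ec: "e \<in> carrier_mat n n" using D SL_carrier_mat e by blast
    note dd = dims carrier_matD[OF dc] carrier_matD[OF ec]
    have "d * f k = (d * P k) * (Y * U * Q k)"
      unfolding f_def using dd by (simp add: mat_assoc del: assoc_mult_mat)
    also have "\<dots> = P k * ((e * Y) * (U * Q k))"
      unfolding e(2) using dd by (simp add: mat_assoc del: assoc_mult_mat)
    also have "\<dots> = f k"
      unfolding fixed[OF e(1)] f_def using dd by (simp add: mat_assoc del: assoc_mult_mat)
    finally show ?thesis .
  qed
  then have "d * S = S"
    unfolding S_def by (subst mult_mat_sum[OF dc fc]) simp
  then have "d * S = 1\<^sub>m n * S" by (simp add: S_def)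
  then show ?thesis
    by (intro mat_right_cancel[OF dc _ _ detS]) (auto simp: S_def)
qed

text \<open>The double sum of \<open>d a\<^sup>k d\<^sup>-\<^sup>1\<close> over \<open>d \<in> D\<close> and \<open>k < p\<close> is zero because the powers of \<open>a\<close> sum to zero. For
  \<open>0 < k < p\<close> the commutators \<open>d a\<^sup>k d\<^sup>-\<^sup>1 a\<^sup>-\<^sup>k\<close> run through \<open>D\<close>, whose elements also sum to zero, and so only
  the term \<open>card D\<close> for \<open>k = 0\<close> is left.\<close>

lemma char_dvd_card_fixed_point_free:
  assumes D: "subgroup D (SL n)" and aD: "\<And>d. d \<in> D \<Longrightarrow> \<exists>d'\<in>D. d * a = a * d'" "\<And>d. d \<in> D \<Longrightarrow> a * d * inv\<^bsub>SL n\<^esub> a \<in> D"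
    and fpf: "\<And>d. d \<in> D \<Longrightarrow> d * a = a * d \<Longrightarrow> d = 1\<^sub>m n" and nontriv: "D \<noteq> {1\<^sub>m n}"
  shows "of_nat (card D) = (0 :: 'a)"
proof -
  interpret SL: group "SL n :: 'a mat monoid" by (rule group_SL)
  interpret D: subgroup D "SL n :: 'a mat monoid" by (rule D)
  have aG: "a \<in> carrier (SL n)" by (rule a(3))
  have ac: "a \<in> carrier_mat n n" by (rule SL_carrier_mat[OF aG])
  have Dc: "d \<in> carrier_mat n n" if "d \<in> D" for d using that D.subset SL_carrier_mat by blast
  have finD: "finite D" using finite_SL D.subset finite_subset by blast
  have oneD: "1\<^sub>m n \<in> D" using D.one_closed by simp
  define S where "S = mat_sum n D (\<lambda>d. d)"
  \<comment> \<open>Left multiplication by an element of \<open>D\<close> permutes the summands, so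
    \<open>S\<close> is fixed by \<open>D\<close>; if it were nonzero, \<open>D\<close> would be
    trivial.\<close>
  have S0: "S = 0\<^sub>m n n"
  proof (rule ccontr)
    assume S: "S \<noteq> 0\<^sub>m n n"
    have "d * S = S" if d: "d \<in> D" for d
    proof -
      have "bij_betw (\<lambda>e. d \<otimes>\<^bsub>SL n\<^esub> e) D D"
        by (rule bij_betw_byWitness[where f' = "\<lambda>e. inv\<^bsub>SL n\<^esub> d \<otimes>\<^bsub>SL n\<^esub> e"])
           (use d D.subset in \<open>auto simp: SL.inv_mult_cancel_left subset_iff simp del: mult_SL\<close>)
      from mat_sum_reindex[OF this, of n "\<lambda>d. d"] show ?thesis
        unfolding S_def by (subst mult_mat_sum[OF Dc[OF d] Dc]) simp_all
    qed
    then have "d = 1\<^sub>m n" if "d \<in> D" for d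
      using trivial_of_fixed_matrix[OF D.subset aD(1), of S d] S that by (simp add: S_def)
    then show False using nontriv oneD by blast
  qed
  define P where "P k = a [^]\<^bsub>SL n\<^esub> (k::nat)" for k
  have PG: "P k \<in> carrier (SL n)" for k
    using aG by (simp add: P_def)
  note Pc = SL_carrier_mat[OF PG]
  define N where "N = mat_sum n {..<p} P"
  have "a * N = N"
  proof -
    have "a * N = mat_sum n {..<p} (\<lambda>k. P (Suc k))"
      unfolding N_def using SL.nat_pow_Suc2[OF aG] by (subst mult_mat_sum[OF ac Pc]) (simp add: P_def)
    also have "\<dots> = N"
      unfolding N_def using p(2) by (intro mat_sum_shift) (simp add: P_def)
    finally show ?thesis .
  qed
  have "N * a = a * N"
    unfolding N_def using SL.nat_pow_Suc2[OF aG]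
    by (subst mult_mat_sum[OF ac Pc], subst mat_sum_mult[OF ac Pc]) (simp add: P_def)
  \<comment> \<open>\<open>N\<close> commutes with \<open>a\<close>, so it is invertible unless it
    is zero; then \<open>a * N = N\<close> would make \<open>a\<close> the identity, whose
    eigenvalue is in the base field.\<close>
  have N0: "N = 0\<^sub>m n n"
  proof (rule ccontr)
    assume "N \<noteq> 0\<^sub>m n n"
    then have detN: "det N \<noteq> 0"
      using commuting_det_nonzero[of N] \<open>N * a = a * N\<close> by (simp add: N_def)
    have "a * N = 1\<^sub>m n * N" using \<open>a * N = N\<close> by (simp add: N_def)
    then have "a = 1\<^sub>m n"
      by (intro mat_right_cancel[OF ac _ _ detN]) (auto simp: N_def)
    then have "eigenvalue_in n g a 1" using eigenvalue_in_one[OF g] by simp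
    then have "\<mu> = 1" using eigenvalue_in_eq[OF g a(1)] n by simp
    then show False using a(2) by simp
  qed
  have invc: "inv\<^bsub>SL n\<^esub> d \<in> carrier_mat n n" if "d \<in> D" for d
    using that Dc D.m_inv_closed by blast
  define F where "F d k = d * P k * inv\<^bsub>SL n\<^esub> d" for d k
  have "mat_sum n {..<p} (F d) = 0\<^sub>m n n" if d: "d \<in> D" for d
  proof -
    have "mat_sum n {..<p} (F d) = d * N * inv\<^bsub>SL n\<^esub> d"
      unfolding N_def F_def mult_mat_sum[OF Dc[OF d] Pc]
      by (rule mat_sum_mult[OF invc[OF d] mult_carrier_mat[OF Dc[OF d] Pc], symmetric])
    then show ?thesis using Dc[OF d] invc[OF d] by (simp add: N0)
  qed
  then have "0\<^sub>m n n = mat_sum n D (\<lambda>d. mat_sum n {..<p} (F d))"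
    by (subst mat_sum_cong[of D _ "\<lambda>_. 0\<^sub>m n n"]) (auto simp: mat_sum_def intro!: eq_matI)
  also have "\<dots> = mat_sum n {..<p} (\<lambda>k. mat_sum n D (\<lambda>d. F d k))"
    by (rule mat_sum_swap)
  also have "\<dots> = mat_sum n {..<p} (\<lambda>k. if k = 0 then of_nat (card D) \<cdot>\<^sub>m 1\<^sub>m n else 0\<^sub>m n n)"
  proof (rule mat_sum_cong)
    fix k assume k: "k \<in> {..<p}"
    show "mat_sum n D (\<lambda>d. F d k) = (if k = 0 then of_nat (card D) \<cdot>\<^sub>m 1\<^sub>m n else 0\<^sub>m n n)"
    proof (cases "k = 0")
      case True
      have "F d 0 = 1\<^sub>m n" if d: "d \<in> D" for d
        using SL.r_inv[of d] d D.subset Dc[OF d] by (auto simp: F_def P_def)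
      then show ?thesis using True mat_sum_const[of "1\<^sub>m n" n D] by (simp cong: mat_sum_cong)
    next
      case False
      let ?h = "\<lambda>d. d \<otimes>\<^bsub>SL n\<^esub> (P k \<otimes>\<^bsub>SL n\<^esub> inv\<^bsub>SL n\<^esub> d \<otimes>\<^bsub>SL n\<^esub> inv\<^bsub>SL n\<^esub> P k)"
      have PD: "P i \<otimes>\<^bsub>SL n\<^esub> d \<otimes>\<^bsub>SL n\<^esub> inv\<^bsub>SL n\<^esub> P i \<in> D" if d: "d \<in> D" for d i
      proof (induction i)
        case 0
        then show ?case using d D.subset by (auto simp: P_def simp del: mult_SL one_SL)
      next
        case (Suc i)
        have "P (Suc i) = a \<otimes>\<^bsub>SL n\<^esub> P i" unfolding P_def by (rule SL.nat_pow_Suc2[OF aG])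
        then show ?case
          using aD(2)[OF Suc] SL.conj_conj[OF aG PG[of i], of d] d D.subset by auto
      qed
      have maps: "?h d \<in> D" if "d \<in> D" for d
        using that PD[OF D.m_inv_closed[OF that]] D.m_closed by blast
      \<comment> \<open>If \<open>d\<close> and \<open>e\<close> have equal commutators with
        \<open>P k\<close>, then \<open>e^-1 d\<close> commutes with \<open>P k\<close>, hence with
        \<open>a\<close>, and so is trivial.\<close>
      have inj: "inj_on ?h D"
      proof (rule inj_onI)
        fix d e assume d: "d \<in> D" and e: "e \<in> D" and eq: "?h d = ?h e"
        have dG: "d \<in> carrier (SL n)" and eG: "e \<in> carrier (SL n)" using d e D.subset by auto
        have h: "?h d = (d \<otimes>\<^bsub>SL n\<^esub> P k \<otimes>\<^bsub>SL n\<^esub> inv\<^bsub>SL n\<^esub> d) \<otimes>\<^bsub>SL n\<^esub> inv\<^bsub>SL n\<^esub> P k" if "d \<in> carrier (SL n)" for d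
          using that PG[of k] by (simp add: SL.m_assoc del: mult_SL one_SL)
        have e1: "d \<otimes>\<^bsub>SL n\<^esub> P k \<otimes>\<^bsub>SL n\<^esub> inv\<^bsub>SL n\<^esub> d = e \<otimes>\<^bsub>SL n\<^esub> P k \<otimes>\<^bsub>SL n\<^esub> inv\<^bsub>SL n\<^esub> e"
          using eq dG eG PG[of k] unfolding h[OF dG] h[OF eG] by (simp del: mult_SL)
        have "(inv\<^bsub>SL n\<^esub> e \<otimes>\<^bsub>SL n\<^esub> d) \<otimes>\<^bsub>SL n\<^esub> P k = inv\<^bsub>SL n\<^esub> e \<otimes>\<^bsub>SL n\<^esub> (d \<otimes>\<^bsub>SL n\<^esub> P k \<otimes>\<^bsub>SL n\<^esub> inv\<^bsub>SL n\<^esub> d) \<otimes>\<^bsub>SL n\<^esub> d"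
          using dG eG PG[of k] by (simp add: SL.m_assoc del: mult_SL one_SL)
        also have "\<dots> = P k \<otimes>\<^bsub>SL n\<^esub> (inv\<^bsub>SL n\<^esub> e \<otimes>\<^bsub>SL n\<^esub> d)"
          unfolding e1 using dG eG PG[of k] by (simp add: SL.m_assoc SL.inv_mult_cancel_left del: mult_SL one_SL)
        finally have c: "(inv\<^bsub>SL n\<^esub> e \<otimes>\<^bsub>SL n\<^esub> d) \<otimes>\<^bsub>SL n\<^esub> P k = P k \<otimes>\<^bsub>SL n\<^esub> (inv\<^bsub>SL n\<^esub> e \<otimes>\<^bsub>SL n\<^esub> d)" .
        have ed: "inv\<^bsub>SL n\<^esub> e \<otimes>\<^bsub>SL n\<^esub> d \<in> carrier (SL n)"
          using dG eG by (simp del: mult_SL)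
        have "(inv\<^bsub>SL n\<^esub> e \<otimes>\<^bsub>SL n\<^esub> d) \<otimes>\<^bsub>SL n\<^esub> a = a \<otimes>\<^bsub>SL n\<^esub> (inv\<^bsub>SL n\<^esub> e \<otimes>\<^bsub>SL n\<^esub> d)"
          by (rule SL.prime_order_commute[OF aG _ p(1) _ _ ed])
             (use p(2) k False c in \<open>simp_all add: P_def\<close>)
        then have "inv\<^bsub>SL n\<^esub> e \<otimes>\<^bsub>SL n\<^esub> d = \<one>\<^bsub>SL n\<^esub>"
          using fpf[of "inv\<^bsub>SL n\<^esub> e \<otimes>\<^bsub>SL n\<^esub> d"] D.m_closed[OF D.m_inv_closed[OF e] d] by simp
        then have "e \<otimes>\<^bsub>SL n\<^esub> (inv\<^bsub>SL n\<^esub> e \<otimes>\<^bsub>SL n\<^esub> d) = e \<otimes>\<^bsub>SL n\<^esub> \<one>\<^bsub>SL n\<^esub>" by simp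
        then show "d = e" using dG eG by (simp add: SL.inv_mult_cancel_left del: mult_SL one_SL)
      qed
      have bij: "bij_betw ?h D D"
        using inj endo_inj_surj[OF finD _ inj] maps by (simp add: bij_betw_def image_subset_iff del: mult_SL)
      have "F d k = ?h d * P k" if d: "d \<in> D" for d
      proof -
        have "?h d \<otimes>\<^bsub>SL n\<^esub> P k = d \<otimes>\<^bsub>SL n\<^esub> P k \<otimes>\<^bsub>SL n\<^esub> inv\<^bsub>SL n\<^esub> d"
          using d D.subset PG[of k] by (auto simp: SL.m_assoc simp del: mult_SL one_SL)
        then show ?thesis by (simp add: F_def)
      qed
      then have "mat_sum n D (\<lambda>d. F d k) = mat_sum n D (\<lambda>d. ?h d * P k)"
        by (rule mat_sum_cong)
      also have "\<dots> = mat_sum n D ?h * P k"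
        using maps Dc by (intro mat_sum_mult[OF Pc, symmetric]) blast
      also have "mat_sum n D ?h = S"
        unfolding S_def by (rule mat_sum_reindex[OF bij, symmetric])
      finally show ?thesis using False Pc[of k] by (simp add: S0)
    qed
  qed
  also have "\<dots> $$ (0, 0) = of_nat (card D)"
  proof -
    have "\<dots> $$ (0, 0) = (\<Sum>k<p. if k = 0 then of_nat (card D) else (0 :: 'a))"
    proof -
      have "(if k = 0 then of_nat (card D) \<cdot>\<^sub>m 1\<^sub>m n else 0\<^sub>m n n) $$ (0, 0) = (if k = 0 then of_nat (card D) else (0 :: 'a))"
        for k :: nat using n by simp
      then show ?thesis using n by (simp add: mat_sum_def)
    qed
    then show ?thesis using prime_gt_0_nat[OF p(1)] by simp
  qed
  finally show ?thesis using n by simp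
qed

end

section \<open>The projective special linear group\<close>

lemma (in group) center_normal: "center G \<lhd> G"
proof -
  have mem: "z \<in> carrier G" "\<And>g. g \<in> carrier G \<Longrightarrow> g \<otimes> z = z \<otimes> g" if "z \<in> center G" for z
    using that by (auto simp: center_def)
  have "subgroup (center G) G"
  proof (rule subgroupI)
    show "center G \<subseteq> carrier G" by (auto simp: center_def)
    have "\<one> \<in> center G" by (auto simp: center_def)
    then show "center G \<noteq> {}" by blast
    fix z assume z: "z \<in> center G"
    show "inv z \<in> center G"
      using commute_inv[OF mem(1)[OF z] _ mem(2)[OF z]] mem(1)[OF z] by (simp add: center_def)
    fix w assume w: "w \<in> center G"
    have "g \<otimes> (z \<otimes> w) = (z \<otimes> w) \<otimes> g" if "g \<in> carrier G" for g
      by (rule commute_mult[OF mem(1)[OF z] mem(1)[OF w] that mem(2)[OF z that] mem(2)[OF w that]])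
    then show "z \<otimes> w \<in> center G"
      using mem(1)[OF z] mem(1)[OF w] by (simp add: center_def)
  qed
  then show ?thesis
  proof (rule normal_invI)
    fix g z assume g: "g \<in> carrier G" and z: "z \<in> center G"
    have "g \<otimes> z \<otimes> inv g = z"
      using conj_eq_self_iff[OF g mem(1)[OF z]] mem(2)[OF z g] by simp
    then show "g \<otimes> z \<otimes> inv g \<in> center G" using z by simp
  qed
qed

text \<open>For abelian \<open>C\<close> the set [C, a] is the image of an endomorphism of
  \<open>C\<close>, which moreover commutes with conjugation by \<open>a\<close>.\<close>

lemma (in group) abelian_commutators_subgroup:
  assumes C: "subgroup C G" and comm: "\<And>x y. x \<in> C \<Longrightarrow> y \<in> C \<Longrightarrow> x \<otimes> y = y \<otimes> x"
    and a: "a \<in> carrier G" and aC: "\<And>c. c \<in> C \<Longrightarrow> a \<otimes> c \<otimes> inv a \<in> C"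
  defines "D \<equiv> (\<lambda>c. c \<otimes> (a \<otimes> inv c \<otimes> inv a)) ` C"
  shows "subgroup D G" "\<And>d. d \<in> D \<Longrightarrow> a \<otimes> d \<otimes> inv a \<in> D"
proof -
  interpret C: subgroup C G by (rule C)
  let ?s = "\<lambda>c. a \<otimes> c \<otimes> inv a"
  have sC: "?s (inv c) \<in> C" if "c \<in> C" for c using aC that by blast
  have s_inv: "inv (?s c) = ?s (inv c)" if "c \<in> carrier G" for c
    using a that by (simp add: inv_mult_group m_assoc)
  show "subgroup D G"
  proof (rule subgroupI)
    show "D \<subseteq> carrier G" using a by (auto simp: D_def)
    show "D \<noteq> {}" using C.one_closed unfolding D_def by blast
    fix d assume "d \<in> D"
    then obtain c where c: "c \<in> C" "d = c \<otimes> ?s (inv c)" by (auto simp: D_def)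
    have "inv d = inv (?s (inv c)) \<otimes> inv c"
      unfolding c(2) using c(1) a by (simp add: inv_mult_group)
    also have "inv (?s (inv c)) = ?s (inv (inv c))"
      using s_inv[of "inv c"] c(1) by simp
    also have "?s (inv (inv c)) \<otimes> inv c = inv c \<otimes> ?s (inv (inv c))"
      by (rule comm[OF sC[OF C.m_inv_closed[OF c(1)]] C.m_inv_closed[OF c(1)]])
    finally show "inv d \<in> D" using c(1) unfolding D_def by blast
    fix e assume "e \<in> D"
    then obtain b where b: "b \<in> C" "e = b \<otimes> ?s (inv b)" by (auto simp: D_def)
    have "d \<otimes> e = c \<otimes> (?s (inv c) \<otimes> (b \<otimes> ?s (inv b)))"
      using b(1) c(1) a unfolding b(2) c(2) by (simp add: m_assoc)
    also have "?s (inv c) \<otimes> (b \<otimes> ?s (inv b)) = (b \<otimes> ?s (inv b)) \<otimes> ?s (inv c)"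
      by (rule comm[OF sC[OF c(1)] C.m_closed[OF b(1) sC[OF b(1)]]])
    also have "c \<otimes> ((b \<otimes> ?s (inv b)) \<otimes> ?s (inv c)) = (c \<otimes> b) \<otimes> ?s (inv (c \<otimes> b))"
      using b(1) c(1) a by (simp add: m_assoc inv_mult_group inv_mult_cancel_left)
    finally show "d \<otimes> e \<in> D" using c(1) b(1) unfolding D_def by blast
  qed
  fix d assume "d \<in> D"
  then obtain c where c: "c \<in> C" "d = c \<otimes> ?s (inv c)" by (auto simp: D_def)
  have "?s d = ?s c \<otimes> ?s (?s (inv c))"
    unfolding c(2) by (rule conj_mult) (use a c(1) in auto)
  also have "?s (inv c) = inv (?s c)" using s_inv c(1) by simp
  finally have "?s d = ?s c \<otimes> ?s (inv (?s c))" .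
  then show "?s d \<in> D" using aC[OF c(1)] unfolding D_def by blast
qed

text \<open>A central \<open>z\<close> commutes with \<open>a\<close>, so it lies in the torus. If
  its eigenvalue were outside the base field, all matrices commuting with \<open>z\<close> would be
  in the torus, among them the transvection 1 + E_01, whose eigenvalue would have to be 1 although
  it is not the identity.\<close>

lemma center_SL_scalar:
  fixes g :: "'a :: {finite,field} alg_closure mat"
  assumes g: "frame n g" and n: "Factorial_Ring.prime n"
    and a: "eigenvalue_in n g a \<mu>" "\<mu> ^ CARD('a) \<noteq> \<mu>" "a \<in> carrier (SL n)" and z: "(z :: 'a mat) \<in> center (SL n)"
  obtains c where "z = c \<cdot>\<^sub>m 1\<^sub>m n" "c ^ n = 1"
proof -
  have n1: "n > 1" using n by (rule prime_gt_1_nat)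
  have zS: "z \<in> carrier (SL n)" and zcomm: "\<And>h. h \<in> carrier (SL n) \<Longrightarrow> z * h = h * z"
    using z by (auto simp: center_def)
  have zc: "z \<in> carrier_mat n n" and detz: "det z = 1" using zS by (auto simp: carrier_SL)
  obtain \<nu> where \<nu>: "eigenvalue_in n g z \<nu>"
    using eigenvalue_in_commute[OF g n a(1,2) zc zcomm[OF a(3)]] by blast
  have "\<nu> ^ CARD('a) = \<nu>"
  proof (rule ccontr)
    assume nf: "\<nu> ^ CARD('a) \<noteq> \<nu>"
    define u :: "'a mat" where "u = mat n n (\<lambda>(i, j). if i = j \<or> i = 0 \<and> j = 1 then 1 else 0)"
    have uc: "u \<in> carrier_mat n n" by (simp add: u_def)
    have "det u = prod_list (diag_mat u)"
      by (rule det_upper_triangular[OF _ uc]) (auto simp: u_def)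
    then have "det u = 1" by (simp add: prod_list_diag_prod u_def)
    then have "u \<in> carrier (SL n)" using uc by (simp add: carrier_SL)
    then obtain \<tau> where \<tau>: "eigenvalue_in n g u \<tau>"
      using eigenvalue_in_commute[OF g n \<nu> nf uc] zcomm by metis
    have row: "(\<Sum>j<n. to_ac (u $$ (k, j)) * g $$ (j, 0)) = (if k = 0 then g $$ (0, 0) + g $$ (1, 0) else g $$ (k, 0))"
      if k: "k < n" for k
    proof -
      have "(\<Sum>j<n. to_ac (u $$ (k, j)) * g $$ (j, 0)) =
        (\<Sum>j<n. (if j = k then g $$ (j, 0) else 0) + (if j = 1 then (if k = 0 then g $$ (1, 0) else 0) else 0))"
        using k by (intro sum.cong) (auto simp: u_def)
      also have "\<dots> = g $$ (k, 0) + (if k = 0 then g $$ (1, 0) else 0)"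
        unfolding sum.distrib using k n1 by simp
      finally show ?thesis by simp
    qed
    have "eigenvalue_in n g u 1"
    \<comment> \<open>Row 1 of \<open>u\<close> is that of the identity, which gives
      \<open>\<tau> = 1\<close> if \<open>g $$ (1, 0)\<close> is nonzero. If it is zero,
      \<open>u\<close> fixes the eigenvector outright.\<close>
    proof (cases "g $$ (1, 0) = 0")
      case True
      then show ?thesis using row by (intro eigenvalue_inI[OF g uc]) simp
    next
      case False
      have "g $$ (1, 0) = \<tau> * g $$ (1, 0)"
        using eigenvalue_in_index[OF g \<tau> n1] row[OF n1] n1 by simp
      then show ?thesis using \<tau> False by simp
    qed
    then have "u = 1\<^sub>m n" using eigenvalue_in_unique[OF g _ eigenvalue_in_one[OF g]] by blast
    then have "u $$ (0, 1) = (1\<^sub>m n :: 'a mat) $$ (0, 1)" by simp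
    then show False using n1 by (simp add: u_def)
  qed
  then obtain c where c: "z = c \<cdot>\<^sub>m 1\<^sub>m n" using eigenvalue_in_fixed_imp_scalar[OF g \<nu>] by metis
  then have "c ^ n = 1" using detz by simp
  then show ?thesis using that c by blast
qed

lemma PSL_image_hom: "group_hom (SL n) (PSL n) (PSL_image n :: 'a :: field mat \<Rightarrow> _)"
proof -
  interpret SL: group "SL n :: 'a mat monoid" by (rule group_SL)
  interpret N: normal "center (SL n)" "SL n :: 'a mat monoid" by (rule SL.center_normal)
  have "(PSL_image n :: 'a mat \<Rightarrow> _) = (\<lambda>a. center (SL n) #>\<^bsub>SL n\<^esub> a)"
    by (simp add: fun_eq_iff PSL_image_def)
  then show ?thesis
    unfolding PSL_def using N.r_coset_hom_Mod N.factorgroup_is_group SL.is_group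
    by (auto intro!: group_hom.intro group_hom_axioms.intro)
qed

lemma carrier_PSL: "carrier (PSL n) = PSL_image n ` carrier (SL n :: 'a :: field mat monoid)"
  by (auto simp: PSL_def PSL_image_def FactGroup_def RCOSETS_def)

lemma PSL_image_eq_iff:
  fixes A B :: "'a :: field mat"
  assumes "A \<in> carrier (SL n)" "B \<in> carrier (SL n)"
  shows "PSL_image n A = PSL_image n B \<longleftrightarrow> (\<exists>z\<in>center (SL n). A = z * B)"
proof -
  interpret SL: group "SL n :: 'a mat monoid" by (rule group_SL)
  interpret N: normal "center (SL n)" "SL n :: 'a mat monoid" by (rule SL.center_normal)
  show ?thesis
  proof
    assume "PSL_image n A = PSL_image n B"
    then have "A \<in> center (SL n) #>\<^bsub>SL n\<^esub> B"
      using SL.rcos_self[OF assms(1) N.subgroup_axioms] by (simp add: PSL_image_def)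
    then show "\<exists>z\<in>center (SL n). A = z * B" by (auto simp: r_coset_def)
  next
    assume "\<exists>z\<in>center (SL n). A = z * B"
    then have "A \<in> center (SL n) #>\<^bsub>SL n\<^esub> B" by (auto simp: r_coset_def)
    then show "PSL_image n A = PSL_image n B"
      using SL.repr_independence[OF _ assms(2) N.subgroup_axioms] by (simp add: PSL_image_def)
  qed
qed

lemma PSL_image_eq_one_iff:
  fixes A :: "'a :: field mat"
  assumes "A \<in> carrier (SL n)"
  shows "PSL_image n A = \<one>\<^bsub>PSL n\<^esub> \<longleftrightarrow> A \<in> center (SL n)"
proof -
  interpret \<pi>: group_hom "SL n" "PSL n" "PSL_image n :: 'a mat \<Rightarrow> _" by (rule PSL_image_hom)
  have "PSL_image n A = \<one>\<^bsub>PSL n\<^esub> \<longleftrightarrow> PSL_image n A = PSL_image n (1\<^sub>m n)"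
    using \<pi>.hom_one by simp
  also have "\<dots> \<longleftrightarrow> (\<exists>z\<in>center (SL n). A = z * 1\<^sub>m n)"
    using \<pi>.G.one_closed by (intro PSL_image_eq_iff[OF assms]) simp
  also have "\<dots> \<longleftrightarrow> A \<in> center (SL n)"
    using assms by (auto simp: center_def carrier_SL)
  finally show ?thesis .
qed

lemma finite_PSL: "finite (carrier (PSL n :: 'a :: {finite,field} mat set monoid))"
  unfolding carrier_PSL by (rule finite_imageI[OF finite_SL])

section \<open>Trace orthogonality and the numerical contradiction\<close>

lemma trace_smult: "A \<in> carrier_mat n n \<Longrightarrow> trace (c \<cdot>\<^sub>m A) = c * trace A"
  by (simp add: trace_def sum_distrib_left)

lemma trace_one: "trace (1\<^sub>m n :: 'a :: comm_ring_1 mat) = of_nat n"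
  by (simp add: trace_def)

lemma smult_smult_mat: "c \<cdot>\<^sub>m (d \<cdot>\<^sub>m A) = (c * d) \<cdot>\<^sub>m (A :: 'a :: comm_ring_1 mat)"
  by (rule eq_matI) (auto simp: mult_ac)

lemma smult_one_mult:
  fixes A :: "'a :: comm_ring_1 mat"
  assumes "A \<in> carrier_mat n n"
  shows "(c \<cdot>\<^sub>m 1\<^sub>m n) * A = c \<cdot>\<^sub>m A" "A * (c \<cdot>\<^sub>m 1\<^sub>m n) = c \<cdot>\<^sub>m A"
  using smult_mat_eq_mult[OF assms, of c] mult_smult_distrib[of A n n "1\<^sub>m n" n c] assms by simp_all

text \<open>Traces against the dual family \<open>M\<close> recover the coefficients of a linear
  combination of the \<open>L b\<close>. The dimension bound is obtained by counting: q^(card B)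
  combinations inject into q^(n n) matrices.\<close>

lemma card_le_of_trace_orthogonal:
  fixes L :: "'b \<Rightarrow> 'a :: {finite,field} mat"
  assumes fin: "finite B" and L: "\<And>b. b \<in> B \<Longrightarrow> L b \<in> carrier_mat n n"
    and M: "\<And>b. b \<in> B \<Longrightarrow> M b \<in> carrier_mat n n"
    and orth: "\<And>b c. b \<in> B \<Longrightarrow> c \<in> B \<Longrightarrow> b \<noteq> c \<Longrightarrow> trace (L b * M c) = 0"
    and diag: "\<And>b. b \<in> B \<Longrightarrow> trace (L b * M b) \<noteq> 0"
  shows "card B \<le> n * n"
proof -
  define F where "F \<alpha> = mat_sum n B (\<lambda>b. \<alpha> b \<cdot>\<^sub>m L b)" for \<alpha> :: "'b \<Rightarrow> 'a"
  have tr: "trace (F \<alpha> * M c) = \<alpha> c * trace (L c * M c)" if c: "c \<in> B" for \<alpha> c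
  proof -
    have "trace (F \<alpha> * M c) = (\<Sum>b\<in>B. trace (\<alpha> b \<cdot>\<^sub>m L b * M c))"
      unfolding F_def using L M c by (subst mat_sum_mult[OF M[OF c]], simp) (rule trace_mat_sum, simp add: mult_carrier_mat[of _ n n])
    also have "\<dots> = (\<Sum>b\<in>B. if b = c then \<alpha> c * trace (L c * M c) else 0)"
    proof (rule sum.cong[OF refl])
      fix b assume b: "b \<in> B"
      have "trace (\<alpha> b \<cdot>\<^sub>m L b * M c) = \<alpha> b * trace (L b * M c)"
        using mult_smult_assoc_mat[OF L[OF b] M[OF c]] trace_smult[OF mult_carrier_mat[OF L[OF b] M[OF c]]] by simp
      then show "trace (\<alpha> b \<cdot>\<^sub>m L b * M c) = (if b = c then \<alpha> c * trace (L c * M c) else 0)"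
        using orth[OF b c] by auto
    qed
    also have "\<dots> = \<alpha> c * trace (L c * M c)" using c fin by simp
    finally show ?thesis .
  qed
  have "inj_on F (B \<rightarrow>\<^sub>E UNIV)"
  proof (rule inj_onI)
    fix \<alpha> \<beta> assume \<alpha>: "\<alpha> \<in> B \<rightarrow>\<^sub>E UNIV" and \<beta>: "\<beta> \<in> B \<rightarrow>\<^sub>E UNIV" and eq: "F \<alpha> = F \<beta>"
    have "\<alpha> c = \<beta> c" if "c \<in> B" for c
      using tr[OF that, of \<alpha>] tr[OF that, of \<beta>] diag[OF that] eq by simp
    then show "\<alpha> = \<beta>" by (rule PiE_ext[OF \<alpha> \<beta>])
  qed
  then have "card (B \<rightarrow>\<^sub>E (UNIV :: 'a set)) \<le> card (carrier_mat n n :: 'a mat set)"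
    by (rule card_inj_on_le) (auto simp: F_def finite_carrier_mat)
  then have "CARD('a) ^ card B \<le> CARD('a) ^ (n * n)"
    using fin by (simp add: card_PiE card_carrier_mat)
  then show ?thesis using field_card_gt_1[where 'a = 'a] power_le_imp_le_exp by blast
qed

text \<open>The size bound leaves \<open>n\<close> and \<open>n ^ 2\<close>. The former is not 1
  modulo \<open>p\<close> as 1 < n < p, the latter because \<open>p\<close> exceeds both factors of
  (n - 1)(n + 1).\<close>

lemma prime_power_le_square:
  fixes n p l k :: nat
  assumes n: "Factorial_Ring.prime n" "n > 2" and p: "Factorial_Ring.prime p" "p > n + 1"
    and le: "n ^ k \<le> n * n" and k: "k > 0" and mod: "n ^ k mod p = 1"
  shows False
proof -
  have "n ^ k \<le> n ^ 2" using le by (simp add: power2_eq_square)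
  then have "k \<le> 2" using n(2) power_le_imp_le_exp[of n k 2] by simp
  then consider "k = 1" | "k = 2" using k by linarith
  then show False
  proof cases
    case 1
    then show False using mod p(2) n(2) by simp
  next
    case 2
    have "[n ^ 2 = 1] (mod p)"
      using mod 2 prime_gt_1_nat[OF p(1)] by (simp add: cong_def)
    then have "p dvd n ^ 2 - 1" using n(2) by (simp add: cong_altdef_nat one_le_power)
    moreover have "n ^ 2 - 1 = (n - 1) * (n + 1)"
      using n(2) by (cases n) (auto simp: power2_eq_square)
    ultimately have "p dvd (n - 1) * (n + 1)" by (simp only:)
    then have "p dvd n - 1 \<or> p dvd n + 1" using prime_dvd_mult_iff[OF p(1)] by blast
    then have "p \<le> n + 1" using dvd_imp_le[of p "n - 1"] dvd_imp_le[of p "n + 1"] n(2) by auto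
    then show False using p(2) by simp
  qed
qed

text \<open>In characteristic \<open>n\<close> the equation z^n = 1 reads (z - 1)^n = 0. The result
  makes the trace of the identity nonzero.\<close>

lemma of_nat_nonzero_of_root_of_unity:
  fixes z :: "'a :: {finite,field}"
  assumes n: "Factorial_Ring.prime n" and z: "z ^ n = 1" "z \<noteq> 1"
  shows "of_nat n \<noteq> (0 :: 'a)"
proof
  assume "of_nat n = (0 :: 'a)"
  then have "CHAR('a) dvd n" by (simp add: of_nat_eq_0_iff_char_dvd)
  then have ch: "n = CHAR('a)"
    using n prime_CHAR_finite[where 'a = 'a] primes_dvd_imp_eq by metis
  have "((z - 1) + 1) ^ n = (z - 1) ^ n + 1 ^ n"
    by (rule freshmans_dream[OF prime_CHAR_finite ch])
  then have "(z - 1) ^ n = 0" using z(1) by simp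
  then show False using z(2) by simp
qed

section \<open>Invariant abelian subgroups of prime power order in PSL\<close>

context
  fixes n :: nat and g :: "'a :: {finite,field} alg_closure mat" and a :: "'a mat" and \<mu> and p :: nat
  assumes g: "frame n g" and n: "Factorial_Ring.prime n" "n > 2"
    and a: "eigenvalue_in n g a \<mu>" "\<mu> ^ CARD('a) \<noteq> \<mu>" "a \<in> carrier (SL n)"
    and p: "Factorial_Ring.prime p" "a [^]\<^bsub>SL n\<^esub> p = 1\<^sub>m n" "\<not> p dvd CARD('a)" "p > n + 1"
begin

text \<open>By \<open>char_dvd_card_fixed_point_free\<close> a nontrivial \<open>D\<close> forces
  \<open>l\<close> to be the characteristic. Then \<open>D\<close> is an \<open>l\<close>-group
  acting by left multiplication on all matrices, whose number is divisible by \<open>l\<close>, so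
  it fixes a nonzero one and \<open>trivial_of_fixed_matrix\<close> applies.\<close>

lemma no_fixed_point_free_p_subgroup:
  assumes D: "subgroup D (SL n)" and aD: "\<And>d. d \<in> D \<Longrightarrow> a * d * inv\<^bsub>SL n\<^esub> a \<in> D"
    and fpf: "\<And>d. d \<in> D \<Longrightarrow> d * a = a * d \<Longrightarrow> d = 1\<^sub>m n"
    and l: "Factorial_Ring.prime l" and card: "card D = l ^ i"
  shows "D = {1\<^sub>m n}"
proof (rule ccontr)
  assume nontriv: "D \<noteq> {1\<^sub>m n}"
  interpret SL: group "SL n :: 'a mat monoid" by (rule group_SL)
  interpret D: subgroup D "SL n :: 'a mat monoid" by (rule D)
  have Dc: "d \<in> carrier_mat n n" if "d \<in> D" for d using that D.subset by (auto simp: carrier_SL)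
  have finD: "finite D" using finite_SL D.subset finite_subset by blast
  \<comment> \<open>Conjugation by \<open>a\<close> is injective on the finite \<open>D\<close> and
    thus maps it onto itself.\<close>
  have aD': "\<exists>d'\<in>D. d * a = a * d'" if d: "d \<in> D" for d
  proof -
    let ?s = "\<lambda>d. a \<otimes>\<^bsub>SL n\<^esub> d \<otimes>\<^bsub>SL n\<^esub> inv\<^bsub>SL n\<^esub> a"
    have "inj_on ?s D"
      using SL.conj_inj[OF a(3)] D.subset by (intro inj_onI) blast
    then have "?s ` D = D"
      using aD by (intro endo_inj_surj[OF finD]) auto
    then obtain d' where d': "d' \<in> D" "d = ?s d'" using d by blast
    then have "d \<otimes>\<^bsub>SL n\<^esub> a = a \<otimes>\<^bsub>SL n\<^esub> d'"
      using a(3) D.subset by (auto simp: SL.m_assoc simp del: mult_SL one_SL)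
    then show ?thesis using d'(1) by auto
  qed
  have "of_nat (card D) = (0 :: 'a)"
    by (rule char_dvd_card_fixed_point_free[OF g n a p(1-3) D aD' aD fpf nontriv])
  then have "CHAR('a) dvd l ^ i" by (simp only: of_nat_eq_0_iff_char_dvd card)
  then have "CHAR('a) = l"
    using l prime_CHAR_finite[where 'a = 'a] prime_dvd_power primes_dvd_imp_eq by blast
  then have "l dvd CARD('a)" using CHAR_dvd_CARD[where 'a = 'a] by simp
  let ?E = "carrier_mat n n :: 'a mat set"
  have "card {Y \<in> ?E. \<forall>d\<in>D. d * Y = Y} mod l = card ?E mod l"
  proof (rule SL.p_group_fixed_points[OF D card l finite_carrier_mat])
    fix d e and Y :: "'a mat" assume "d \<in> D" "e \<in> D" "Y \<in> ?E"
    then show "(d \<otimes>\<^bsub>SL n\<^esub> e) * Y = d * (e * Y)"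
      using assoc_mult_mat[OF Dc Dc] by simp
  next
    fix d and Y :: "'a mat" assume "d \<in> D" "Y \<in> ?E"
    then show "d * Y \<in> ?E" using mult_carrier_mat[OF Dc] by blast
  qed simp
  also have "card ?E mod l = 0"
  proof -
    have "l dvd CARD('a) ^ (n * n)"
      using dvd_trans[OF \<open>l dvd CARD('a)\<close> dvd_power[of "n * n"]] n(2) by simp
    then show ?thesis by (simp add: card_carrier_mat)
  qed
  finally have "card {Y \<in> ?E. \<forall>d\<in>D. d * Y = Y} \<noteq> 1"
    using prime_gt_1_nat[OF l] by auto
  then have "{Y \<in> ?E. \<forall>d\<in>D. d * Y = Y} \<noteq> {0\<^sub>m n n}" by auto
  moreover have "0\<^sub>m n n \<in> {Y \<in> ?E. \<forall>d\<in>D. d * Y = Y}"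
    using right_mult_zero_mat[OF Dc] by simp
  ultimately obtain Y where "Y \<in> ?E" "\<forall>d\<in>D. d * Y = Y" "Y \<noteq> 0\<^sub>m n n" by blast
  then have "d = 1\<^sub>m n" if "d \<in> D" for d
    using trivial_of_fixed_matrix[OF g n a p(1-3) D.subset aD', of Y d] that by blast
  moreover have "1\<^sub>m n \<in> D" using D.one_closed by simp
  ultimately show False using nontriv by blast
qed

text \<open>The centre \<open>C\<close> of the preimage \<open>T\<close> of \<open>B\<close> is scalar, because the commutators of \<open>C\<close> with \<open>a\<close> form a
  fixed-point-free \<open>l\<close>-group. Hence every non-scalar \<open>t \<in> T\<close> is conjugate to a multiple \<open>z t\<close> with \<open>z \<noteq> 1\<close> and
  has trace 0, which gives \<open>card B \<le> n\<^sup>2\<close>.\<close>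

lemma no_invariant_p_subgroup:
  fixes B :: "'a mat set set"
  assumes B: "subgroup B (PSL n)" and l: "Factorial_Ring.prime l" and card: "card B = l ^ k" "k > 0"
    and comm: "\<forall>x\<in>B. \<forall>y\<in>B. x \<otimes>\<^bsub>PSL n\<^esub> y = y \<otimes>\<^bsub>PSL n\<^esub> x"
    and inv: "(\<lambda>y. PSL_image n a \<otimes>\<^bsub>PSL n\<^esub> y \<otimes>\<^bsub>PSL n\<^esub> inv\<^bsub>PSL n\<^esub> PSL_image n a) ` B \<subseteq> B"
    and fpf: "\<forall>y\<in>B. PSL_image n a \<otimes>\<^bsub>PSL n\<^esub> y = y \<otimes>\<^bsub>PSL n\<^esub> PSL_image n a \<longrightarrow> y = \<one>\<^bsub>PSL n\<^esub>"
  shows False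
proof -
  interpret \<pi>: group_hom "SL n" "PSL n" "PSL_image n :: 'a mat \<Rightarrow> _" by (rule PSL_image_hom)
  interpret B: subgroup B "PSL n :: 'a mat set monoid" by (rule B)
  let ?Z = "center (SL n) :: 'a mat set"
  have scalar: "\<exists>c. z = c \<cdot>\<^sub>m 1\<^sub>m n \<and> c ^ n = 1" if "z \<in> ?Z" for z
    by (rule center_SL_scalar[OF g n(1) a that]) blast
  have ZG: "z \<in> carrier (SL n)" "\<And>h. h \<in> carrier (SL n) \<Longrightarrow> z * h = h * z" if "z \<in> ?Z" for z
    using that by (auto simp: center_def)
  have SLc: "A \<in> carrier_mat n n" if "A \<in> carrier (SL n)" for A :: "'a mat"
    using that by (simp add: carrier_SL)
  have ac: "a \<in> carrier_mat n n" by (rule SLc[OF a(3)])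
  have finB: "finite B" using finite_PSL B.subset finite_subset by blast
  define T where "T = {A \<in> carrier (SL n). PSL_image n A \<in> B}"
  have TG: "A \<in> carrier (SL n)" "PSL_image n A \<in> B" if "A \<in> T" for A using that by (auto simp: T_def)
  have T: "subgroup T (SL n)"
  proof (rule \<pi>.G.subgroupI)
    show "T \<noteq> {}" using B.one_closed by (auto simp: T_def intro!: exI[of _ "\<one>\<^bsub>SL n\<^esub>"] simp del: one_SL)
  qed (auto simp: T_def simp del: mult_SL)
  interpret T: subgroup T "SL n :: 'a mat monoid" by (rule T)
  have aT: "a * c * inv\<^bsub>SL n\<^esub> a \<in> T" if "c \<in> T" for c
  proof -
    have "PSL_image n (a \<otimes>\<^bsub>SL n\<^esub> c \<otimes>\<^bsub>SL n\<^esub> inv\<^bsub>SL n\<^esub> a) =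
        PSL_image n a \<otimes>\<^bsub>PSL n\<^esub> PSL_image n c \<otimes>\<^bsub>PSL n\<^esub> inv\<^bsub>PSL n\<^esub> PSL_image n a"
      using a(3) TG[OF that] by (simp del: mult_SL)
    then have "PSL_image n (a \<otimes>\<^bsub>SL n\<^esub> c \<otimes>\<^bsub>SL n\<^esub> inv\<^bsub>SL n\<^esub> a) \<in> B" using inv TG[OF that] by auto
    moreover have "a \<otimes>\<^bsub>SL n\<^esub> c \<otimes>\<^bsub>SL n\<^esub> inv\<^bsub>SL n\<^esub> a \<in> carrier (SL n)"
      using a(3) TG[OF that] by (simp del: mult_SL)
    ultimately have "a \<otimes>\<^bsub>SL n\<^esub> c \<otimes>\<^bsub>SL n\<^esub> inv\<^bsub>SL n\<^esub> a \<in> T" unfolding T_def by blast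
    then show ?thesis by simp
  qed
  \<comment> \<open>The image of \<open>c\<close> lies in \<open>B\<close> and commutes with that of
    \<open>a\<close>, so it is trivial.\<close>
  have commute_a: "c \<in> ?Z" if c: "c \<in> T" "c * a = a * c" for c
  proof -
    have "PSL_image n (a \<otimes>\<^bsub>SL n\<^esub> c) = PSL_image n (c \<otimes>\<^bsub>SL n\<^esub> a)" using c(2) by simp
    then have "PSL_image n a \<otimes>\<^bsub>PSL n\<^esub> PSL_image n c = PSL_image n c \<otimes>\<^bsub>PSL n\<^esub> PSL_image n a"
      using a(3) TG[OF c(1)] by (simp del: mult_SL)
    then have "PSL_image n c = \<one>\<^bsub>PSL n\<^esub>" using fpf TG[OF c(1)] by blast
    then show ?thesis using PSL_image_eq_one_iff TG[OF c(1)] by blast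
  qed
  define C where "C = {c \<in> T. \<forall>b\<in>T. c * b = b * c}"
  have CT: "c \<in> T" and C_comm: "\<And>b. b \<in> T \<Longrightarrow> b * c = c * b" if "c \<in> C" for c
    using that by (auto simp: C_def)
  have CI: "c \<in> C" if "c \<in> T" "\<And>b. b \<in> T \<Longrightarrow> b * c = c * b" for c
    using that by (auto simp: C_def)
  have C: "subgroup C (SL n)"
  proof (rule \<pi>.G.subgroupI)
    show "C \<subseteq> carrier (SL n)" using CT TG(1) by blast
    have "1\<^sub>m n \<in> C"
    proof (rule CI)
      show "1\<^sub>m n \<in> T" using T.one_closed by simp
      fix b assume "b \<in> T"
      then have "b \<in> carrier_mat n n" using TG(1) SLc by blast
      then show "b * 1\<^sub>m n = 1\<^sub>m n * b" by simp
    qed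
    then show "C \<noteq> {}" by blast
    fix c assume c: "c \<in> C"
    show "inv\<^bsub>SL n\<^esub> c \<in> C"
    proof (rule CI)
      show "inv\<^bsub>SL n\<^esub> c \<in> T" using CT[OF c] by blast
      fix b assume b: "b \<in> T"
      show "b * inv\<^bsub>SL n\<^esub> c = inv\<^bsub>SL n\<^esub> c * b"
        using \<pi>.G.commute_inv[OF TG(1)[OF CT[OF c]] TG(1)[OF b]] C_comm[OF c b] by simp
    qed
    fix d assume d: "d \<in> C"
    show "c \<otimes>\<^bsub>SL n\<^esub> d \<in> C"
    proof (rule CI)
      show "c \<otimes>\<^bsub>SL n\<^esub> d \<in> T" using CT[OF c] CT[OF d] by blast
      fix b assume b: "b \<in> T"
      show "b * (c \<otimes>\<^bsub>SL n\<^esub> d) = c \<otimes>\<^bsub>SL n\<^esub> d * b"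
        using \<pi>.G.commute_mult[OF TG(1)[OF CT[OF c]] TG(1)[OF CT[OF d]] TG(1)[OF b]] C_comm[OF c b] C_comm[OF d b]
        by (simp only: mult_SL)
    qed
  qed
  interpret C: subgroup C "SL n :: 'a mat monoid" by (rule C)
  have aC: "a \<otimes>\<^bsub>SL n\<^esub> c \<otimes>\<^bsub>SL n\<^esub> inv\<^bsub>SL n\<^esub> a \<in> C" if c: "c \<in> C" for c
  proof (rule CI)
    show "a \<otimes>\<^bsub>SL n\<^esub> c \<otimes>\<^bsub>SL n\<^esub> inv\<^bsub>SL n\<^esub> a \<in> T" using aT[OF CT[OF c]] by simp
    fix b assume b: "b \<in> T"
    have finT: "finite T" using finite_SL T.subset finite_subset by blast
    let ?s = "\<lambda>d. a \<otimes>\<^bsub>SL n\<^esub> d \<otimes>\<^bsub>SL n\<^esub> inv\<^bsub>SL n\<^esub> a"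
    have "inj_on ?s T"
      using \<pi>.G.conj_inj[OF a(3)] T.subset by (intro inj_onI) blast
    then have "?s ` T = T"
      using aT by (intro endo_inj_surj[OF finT]) auto
    then obtain b' where b': "b' \<in> T" "b = ?s b'" using b by blast
    have "?s b' \<otimes>\<^bsub>SL n\<^esub> ?s c = ?s c \<otimes>\<^bsub>SL n\<^esub> ?s b'"
      using \<pi>.G.conj_mult[OF a(3) TG(1)[OF b'(1)] TG(1)[OF CT[OF c]]]
        \<pi>.G.conj_mult[OF a(3) TG(1)[OF CT[OF c]] TG(1)[OF b'(1)]] C_comm[OF c b'(1)] by simp
    then show "b * ?s c = ?s c * b" unfolding b'(2) by simp
  qed
  define D where "D = (\<lambda>c. c \<otimes>\<^bsub>SL n\<^esub> (a \<otimes>\<^bsub>SL n\<^esub> inv\<^bsub>SL n\<^esub> c \<otimes>\<^bsub>SL n\<^esub> inv\<^bsub>SL n\<^esub> a)) ` C"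
  have C_comm': "x \<otimes>\<^bsub>SL n\<^esub> y = y \<otimes>\<^bsub>SL n\<^esub> x" if "x \<in> C" "y \<in> C" for x y
    using C_comm[OF that(2) CT[OF that(1)]] by simp
  have D: "subgroup D (SL n)" and aD: "\<And>d. d \<in> D \<Longrightarrow> a \<otimes>\<^bsub>SL n\<^esub> d \<otimes>\<^bsub>SL n\<^esub> inv\<^bsub>SL n\<^esub> a \<in> D"
    using \<pi>.G.abelian_commutators_subgroup[OF C C_comm' a(3) aC] unfolding D_def by blast+
  interpret D: subgroup D "SL n :: 'a mat monoid" by (rule D)
  have DC: "D \<subseteq> C"
    unfolding D_def using aC C.m_inv_closed C.m_closed by blast
  have D_eq: "c * a = z * (a * c)" if "c \<in> C" "c \<otimes>\<^bsub>SL n\<^esub> (a \<otimes>\<^bsub>SL n\<^esub> inv\<^bsub>SL n\<^esub> c \<otimes>\<^bsub>SL n\<^esub> inv\<^bsub>SL n\<^esub> a) = z" "z \<in> carrier (SL n)" for c z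
  proof -
    have cG: "c \<in> carrier (SL n)" using that(1) CT TG(1) by blast
    have "z \<otimes>\<^bsub>SL n\<^esub> (a \<otimes>\<^bsub>SL n\<^esub> c) = c \<otimes>\<^bsub>SL n\<^esub> (a \<otimes>\<^bsub>SL n\<^esub> inv\<^bsub>SL n\<^esub> c \<otimes>\<^bsub>SL n\<^esub> inv\<^bsub>SL n\<^esub> a) \<otimes>\<^bsub>SL n\<^esub> (a \<otimes>\<^bsub>SL n\<^esub> c)"
      using that(2) by simp
    also have "\<dots> = c \<otimes>\<^bsub>SL n\<^esub> a"
      using cG a(3) by (simp add: \<pi>.G.m_assoc \<pi>.G.inv_mult_cancel_left del: mult_SL one_SL)
    finally show ?thesis by simp
  qed
  \<comment> \<open>An element of \<open>D\<close> commuting with \<open>a\<close> is central, hence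
    a scalar \<open>z\<close> with \<open>c * a = z \<cdot>\<^sub>m (a * c)\<close>;
    \<open>eigenvalue_in_twisted_commute\<close> gives \<open>z = 1\<close>.\<close>
  have fpfD: "d = 1\<^sub>m n" if d: "d \<in> D" "d * a = a * d" for d
  proof -
    obtain c where c: "c \<in> C" "c \<otimes>\<^bsub>SL n\<^esub> (a \<otimes>\<^bsub>SL n\<^esub> inv\<^bsub>SL n\<^esub> c \<otimes>\<^bsub>SL n\<^esub> inv\<^bsub>SL n\<^esub> a) = d" using d(1) by (auto simp: D_def)
    have "d \<in> ?Z" using commute_a[OF _ d(2)] d(1) DC CT by blast
    then obtain z where z: "d = z \<cdot>\<^sub>m 1\<^sub>m n" "z ^ n = 1" using scalar by blast
    have cG: "c \<in> carrier (SL n)" using c(1) CT TG(1) by blast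
    have dG: "d \<in> carrier (SL n)" using d(1) D.subset by blast
    have "c * a = z \<cdot>\<^sub>m (a * c)"
      using D_eq[OF c dG] smult_one_mult(1)[OF mult_carrier_mat[OF ac SLc[OF cG]], of z] by (simp add: z(1))
    then have "z = 1"
      using eigenvalue_in_twisted_commute[OF g n a(1,2) _ SLc[OF cG] _ z(2)] a(3) cG by (auto simp: carrier_SL)
    then show ?thesis using z(1) by auto
  qed
  have "D = {1\<^sub>m n}"
  proof -
    \<comment> \<open>A central element of \<open>D\<close> commutes with \<open>a\<close> and is
      trivial by \<open>fpfD\<close>. Hence \<open>D\<close> embeds into \<open>B\<close>, and its
      order is a power of \<open>l\<close>.\<close>
    have inj: "inj_on (PSL_image n) D"
    proof (rule inj_onI)
      fix d e assume d: "d \<in> D" and e: "e \<in> D" and eq: "PSL_image n d = PSL_image n e"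
      have dG: "d \<in> carrier (SL n)" and eG: "e \<in> carrier (SL n)" using d e D.subset by auto
      then obtain z where z: "z \<in> ?Z" "d = z \<otimes>\<^bsub>SL n\<^esub> e" using PSL_image_eq_iff[OF dG eG] eq by auto
      have "z = d \<otimes>\<^bsub>SL n\<^esub> inv\<^bsub>SL n\<^esub> e"
        using z(2) ZG(1)[OF z(1)] eG by (simp add: \<pi>.G.m_assoc del: mult_SL one_SL)
      then have "z \<in> D" using d e by blast
      then have "z = 1\<^sub>m n" using fpfD ZG(2)[OF z(1) a(3)] by blast
      then show "d = e" using z(2) SLc[OF eG] by simp
    qed
    have sub: "subgroup (PSL_image n ` D) (PSL n)"
      using \<pi>.subgroup_img_is_subgroup[OF D] .
    have "PSL_image n ` D \<subseteq> B" using DC CT TG(2) by blast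
    have "card (PSL_image n ` D) dvd card B"
      by (rule \<pi>.H.card_subgroup_dvd[OF sub B \<open>PSL_image n ` D \<subseteq> B\<close>])
    then have "card D dvd l ^ k" using card_image[OF inj] card(1) by simp
    then obtain i where i: "card D = l ^ i" using divides_primepow_nat[OF l] by blast
    show ?thesis
      by (rule no_fixed_point_free_p_subgroup[OF D _ fpfD l i]) (use aD in simp)
  qed
  have CZ: "c \<in> ?Z" if c: "c \<in> C" for c
  proof -
    have cG: "c \<in> carrier (SL n)" using c CT TG(1) by blast
    have "c \<otimes>\<^bsub>SL n\<^esub> (a \<otimes>\<^bsub>SL n\<^esub> inv\<^bsub>SL n\<^esub> c \<otimes>\<^bsub>SL n\<^esub> inv\<^bsub>SL n\<^esub> a) \<in> D" using c unfolding D_def by blast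
    then have "c \<otimes>\<^bsub>SL n\<^esub> (a \<otimes>\<^bsub>SL n\<^esub> inv\<^bsub>SL n\<^esub> c \<otimes>\<^bsub>SL n\<^esub> inv\<^bsub>SL n\<^esub> a) = 1\<^sub>m n" using \<open>D = {1\<^sub>m n}\<close> by blast
    from D_eq[OF c this] have "c * a = a * c"
      using \<pi>.G.one_closed left_mult_one_mat[OF mult_carrier_mat[OF ac SLc[OF cG]]] by (simp only: one_SL)
    then show ?thesis by (rule commute_a[OF CT[OF c]])
  qed
  \<comment> \<open>By \<open>CZ\<close> a noncentral \<open>t\<close> is not in the centre
    \<open>C\<close> of \<open>T\<close>, so some \<open>w\<close> fails to commute with it; as
    \<open>B\<close> is abelian, their commutator is a scalar.\<close>
  have twist: "\<exists>w\<in>T. \<exists>z. z \<noteq> 1 \<and> z ^ n = 1 \<and> t * w = z \<cdot>\<^sub>m (w * t)" if t: "t \<in> T" "t \<notin> ?Z" for t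
  proof -
    have "t \<notin> C" using CZ t(2) by blast
    then obtain w where w: "w \<in> T" "w * t \<noteq> t * w" using CI[OF t(1)] by blast
    have tG: "t \<in> carrier (SL n)" and wG: "w \<in> carrier (SL n)" using t w TG by auto
    have "PSL_image n (t \<otimes>\<^bsub>SL n\<^esub> w) = PSL_image n (w \<otimes>\<^bsub>SL n\<^esub> t)"
    proof -
      have "PSL_image n t \<otimes>\<^bsub>PSL n\<^esub> PSL_image n w = PSL_image n w \<otimes>\<^bsub>PSL n\<^esub> PSL_image n t"
        using comm TG(2)[OF t(1)] TG(2)[OF w(1)] by blast
      then show ?thesis using \<pi>.hom_mult[OF tG wG] \<pi>.hom_mult[OF wG tG] by simp
    qed
    moreover have "t \<otimes>\<^bsub>SL n\<^esub> w \<in> carrier (SL n)" "w \<otimes>\<^bsub>SL n\<^esub> t \<in> carrier (SL n)"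
      by (rule \<pi>.G.m_closed[OF tG wG], rule \<pi>.G.m_closed[OF wG tG])
    ultimately obtain z where z: "z \<in> ?Z" "t * w = z * (w * t)"
      using PSL_image_eq_iff[of "t * w" n "w * t"] by auto
    obtain c where c: "z = c \<cdot>\<^sub>m 1\<^sub>m n" "c ^ n = 1" using scalar[OF z(1)] by blast
    have wt: "w * t \<in> carrier_mat n n" by (rule mult_carrier_mat[OF SLc[OF wG] SLc[OF tG]])
    have "t * w = c \<cdot>\<^sub>m (w * t)" using z(2) smult_one_mult(1)[OF wt] by (simp add: c(1))
    moreover have "c \<noteq> 1"
    proof
      assume "c = 1"
      then have "t * w = w * t"
        using z(2) smult_one_mult(1)[OF wt, of 1] by (simp add: c(1) one_smult_mat)
      then show False using w(2) by simp
    qed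
    ultimately show ?thesis using w(1) c(2) by blast
  qed
  have tr0: "trace t = 0" if t: "t \<in> T" "t \<notin> ?Z" for t
  proof -
    obtain w z where w: "w \<in> T" and z: "z \<noteq> 1" "t * w = z \<cdot>\<^sub>m (w * t)" using twist[OF t] by blast
    have tG: "t \<in> carrier (SL n)" and wG: "w \<in> carrier (SL n)" using t w TG by auto
    have iG: "inv\<^bsub>SL n\<^esub> w \<in> carrier (SL n)" using wG by simp
    note c = SLc[OF tG] SLc[OF wG] SLc[OF iG]
    have ww: "w * inv\<^bsub>SL n\<^esub> w = 1\<^sub>m n" "inv\<^bsub>SL n\<^esub> w * w = 1\<^sub>m n" using \<pi>.G.r_inv[OF wG] \<pi>.G.l_inv[OF wG] by simp_all
    have "inv\<^bsub>SL n\<^esub> w * (w * t) = t"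
      using assoc_mult_mat[OF c(3,2,1)] left_mult_one_mat[OF c(1)] by (simp only: ww(2))
    then have "trace t = trace (inv\<^bsub>SL n\<^esub> w * (w * t))" by simp
    also have "\<dots> = trace (w * t * inv\<^bsub>SL n\<^esub> w)"
      by (rule trace_mult_commute[OF c(3) mult_carrier_mat[OF c(2,1)]])
    finally have 1: "trace t = trace (w * t * inv\<^bsub>SL n\<^esub> w)" .
    have "trace t = trace (t * (w * inv\<^bsub>SL n\<^esub> w))"
      by (simp only: ww(1) right_mult_one_mat[OF c(1)])
    also have "t * (w * inv\<^bsub>SL n\<^esub> w) = (z \<cdot>\<^sub>m (w * t)) * inv\<^bsub>SL n\<^esub> w"
      unfolding z(2)[symmetric] by (rule assoc_mult_mat[OF c, symmetric])
    also have "\<dots> = z \<cdot>\<^sub>m (w * t * inv\<^bsub>SL n\<^esub> w)"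
      by (rule mult_smult_assoc_mat[OF mult_carrier_mat[OF c(2,1)] c(3)])
    also have "trace \<dots> = z * trace t"
      unfolding 1 by (rule trace_smult[OF mult_carrier_mat[OF mult_carrier_mat[OF c(2,1)] c(3)]])
    finally have "(1 - z) * trace t = 0" by (simp add: algebra_simps)
    then show ?thesis using z(1) by simp
  qed
  have "B \<noteq> {\<one>\<^bsub>PSL n\<^esub>}"
    using card prime_gt_1_nat[OF l] one_less_power[of l k] by auto
  then obtain b where b: "b \<in> B" "b \<noteq> \<one>\<^bsub>PSL n\<^esub>" using B.one_closed by blast
  have "b \<in> carrier (PSL n)" using b(1) B.subset by blast
  then obtain t where t: "t \<in> carrier (SL n)" "b = PSL_image n t" unfolding carrier_PSL by blast
  have tT: "t \<in> T" unfolding T_def using t b(1) by blast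
  have tZ: "t \<notin> ?Z" using PSL_image_eq_one_iff[OF t(1)] t(2) b(2) by blast
  obtain w z where w: "w \<in> T" and z: "z \<noteq> 1" "z ^ n = 1" "t * w = z \<cdot>\<^sub>m (w * t)" using twist[OF tT tZ] by blast
  have wG: "w \<in> carrier (SL n)" using w TG by blast
  have n_nonzero: "of_nat n \<noteq> (0 :: 'a)"
    by (rule of_nat_nonzero_of_root_of_unity[OF n(1) z(2,1)])
  have "l = n"
  proof (rule ccontr)
    assume "l \<noteq> n"
    \<comment> \<open>Each passage of \<open>t\<close> across \<open>w\<close> costs a factor
      \<open>z\<close>. The power of \<open>t\<close> with exponent \<open>card B\<close> is
      central, so \<open>z\<close> is an \<open>l ^ k\<close>-th root of unity as well as an
      \<open>n\<close>-th one.\<close>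
    have pw: "(t [^]\<^bsub>SL n\<^esub> i) * w = z ^ i \<cdot>\<^sub>m (w * (t [^]\<^bsub>SL n\<^esub> i))" for i :: nat
    proof (induction i)
      case 0
      then show ?case using SLc[OF wG] by (simp add: one_smult_mat)
    next
      case (Suc i)
      have tiG: "t [^]\<^bsub>SL n\<^esub> i \<in> carrier (SL n)" using t by simp
      note c = SLc[OF tiG] SLc[OF t(1)] SLc[OF wG]
      have "t [^]\<^bsub>SL n\<^esub> Suc i * w = t [^]\<^bsub>SL n\<^esub> i * (t * w)"
        using assoc_mult_mat[OF c] by simp
      also have "\<dots> = z \<cdot>\<^sub>m (t [^]\<^bsub>SL n\<^esub> i * (w * t))"
        unfolding z(3) by (rule mult_smult_distrib[OF c(1) mult_carrier_mat[OF c(3,2)]])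
      also have "t [^]\<^bsub>SL n\<^esub> i * (w * t) = (t [^]\<^bsub>SL n\<^esub> i * w) * t"
        by (rule assoc_mult_mat[OF c(1,3,2), symmetric])
      also have "\<dots> = z ^ i \<cdot>\<^sub>m (w * (t [^]\<^bsub>SL n\<^esub> i) * t)"
        unfolding Suc by (rule mult_smult_assoc_mat[OF mult_carrier_mat[OF c(3,1)] c(2)])
      also have "w * (t [^]\<^bsub>SL n\<^esub> i) * t = w * (t [^]\<^bsub>SL n\<^esub> Suc i)"
        using assoc_mult_mat[OF c(3,1,2)] by simp
      finally show ?case by (simp add: smult_smult_mat)
    qed
    let ?m = "l ^ k"
    have "b [^]\<^bsub>PSL n\<^esub> ?m = \<one>\<^bsub>PSL n\<^esub>"
    proof -
      interpret PB: group "PSL n\<lparr>carrier := B\<rparr>" by (rule \<pi>.H.subgroup_imp_group[OF B])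
      have "b [^]\<^bsub>PSL n\<lparr>carrier := B\<rparr>\<^esub> ?m = \<one>\<^bsub>PSL n\<^esub>"
        using PB.pow_order_eq_1[of b] b(1) card(1) by (simp add: order_def)
      then show ?thesis by (simp add: nat_pow_def)
    qed
    then have "PSL_image n (t [^]\<^bsub>SL n\<^esub> ?m) = \<one>\<^bsub>PSL n\<^esub>"
      using t \<pi>.hom_nat_pow[OF t(1)] by simp
    moreover have tmG: "t [^]\<^bsub>SL n\<^esub> ?m \<in> carrier (SL n)" using t by simp
    ultimately have "t [^]\<^bsub>SL n\<^esub> ?m \<in> ?Z" using PSL_image_eq_one_iff by blast
    from ZG(2)[OF this wG] have "z ^ ?m \<cdot>\<^sub>m (w * t [^]\<^bsub>SL n\<^esub> ?m) = w * t [^]\<^bsub>SL n\<^esub> ?m"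
      unfolding pw .
    moreover define V where "V = w * t [^]\<^bsub>SL n\<^esub> ?m"
    ultimately have V: "z ^ ?m \<cdot>\<^sub>m V = V" by (simp only: V_def)
    have "V \<otimes>\<^bsub>SL n\<^esub> inv\<^bsub>SL n\<^esub> V = \<one>\<^bsub>SL n\<^esub>"
      using \<pi>.G.r_inv[OF \<pi>.G.m_closed[OF wG tmG]] by (simp add: V_def)
    moreover have VG: "V \<in> carrier (SL n)" using \<pi>.G.m_closed[OF wG tmG] by (simp add: V_def)
    ultimately have "z ^ ?m \<cdot>\<^sub>m 1\<^sub>m n = 1\<^sub>m n"
      using mult_smult_assoc_mat[OF SLc[OF VG] SLc[OF \<pi>.G.inv_closed[OF VG]], of "z ^ ?m"] unfolding V by (simp only: mult_SL one_SL)
    then have "(z ^ ?m \<cdot>\<^sub>m 1\<^sub>m n) $$ (0, 0) = (1\<^sub>m n :: 'a mat) $$ (0, 0)" by simp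
    then have "z ^ ?m = 1" using n(2) by simp
    moreover have "coprime n ?m" using \<open>l \<noteq> n\<close> primes_coprime[OF n(1) l] by simp
    ultimately have "z = 1" using power_eq_1_coprime[OF z(2), of ?m] prime_gt_0_nat[OF n(1)] by blast
    then show False using z(1) by blast
  qed
  have "\<exists>s. s \<in> T \<and> PSL_image n s = b" if "b \<in> B" for b
  proof -
    have "b \<in> carrier (PSL n)" using that B.subset by blast
    then obtain s where "s \<in> carrier (SL n)" "b = PSL_image n s" unfolding carrier_PSL by blast
    then show ?thesis using that unfolding T_def by blast
  qed
  then have "\<forall>b\<in>B. \<exists>s. s \<in> T \<and> PSL_image n s = b" by blast
  from bchoice[OF this] obtain L where "\<forall>b\<in>B. L b \<in> T \<and> PSL_image n (L b) = b" ..
  then have L: "\<And>b. b \<in> B \<Longrightarrow> L b \<in> T" "\<And>b. b \<in> B \<Longrightarrow> PSL_image n (L b) = b" by blast+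
  have LG: "L b \<in> carrier (SL n)" if "b \<in> B" for b using L(1)[OF that] TG(1) by blast
  have iLG: "inv\<^bsub>SL n\<^esub> L b \<in> carrier (SL n)" if "b \<in> B" for b using LG[OF that] by simp
  \<comment> \<open>The inverses of the lifts form the dual family: for \<open>b \<noteq> c\<close>
    the product of \<open>L b\<close> with the inverse of \<open>L c\<close> is a noncentral element
    of \<open>T\<close> and has trace 0, whereas for \<open>b = c\<close> the trace is
    \<open>n\<close>.\<close>
  have "card B \<le> n * n"
  proof (rule card_le_of_trace_orthogonal[of B L n "\<lambda>b. inv\<^bsub>SL n\<^esub> L b"])
    fix b c assume b: "b \<in> B" and c: "c \<in> B" and "b \<noteq> c"
    have T1: "L b \<otimes>\<^bsub>SL n\<^esub> inv\<^bsub>SL n\<^esub> L c \<in> T" using L(1) b c by blast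
    have "L b \<otimes>\<^bsub>SL n\<^esub> inv\<^bsub>SL n\<^esub> L c \<notin> ?Z"
    proof
      assume "L b \<otimes>\<^bsub>SL n\<^esub> inv\<^bsub>SL n\<^esub> L c \<in> ?Z"
      moreover have "L b = (L b \<otimes>\<^bsub>SL n\<^esub> inv\<^bsub>SL n\<^esub> L c) \<otimes>\<^bsub>SL n\<^esub> L c"
        using LG b c by (simp add: \<pi>.G.m_assoc del: mult_SL one_SL)
      ultimately have "PSL_image n (L b) = PSL_image n (L c)"
        using PSL_image_eq_iff[OF LG[OF b] LG[OF c]] unfolding mult_SL by blast
      then show False using L(2) b c \<open>b \<noteq> c\<close> by simp
    qed
    then show "trace (L b * inv\<^bsub>SL n\<^esub> L c) = 0" using tr0[OF T1] by simp
  next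
    fix b assume "b \<in> B"
    then show "trace (L b * inv\<^bsub>SL n\<^esub> L b) \<noteq> 0"
      using \<pi>.G.r_inv[OF LG] n_nonzero by (simp add: trace_one)
  qed (use finB LG iLG SLc in auto)
  then have "n ^ k \<le> n * n" using card(1) \<open>l = n\<close> by simp
  moreover have "n ^ k mod p = 1"
  proof -
    let ?a = "PSL_image n a"
    let ?s = "\<lambda>y. ?a \<otimes>\<^bsub>PSL n\<^esub> y \<otimes>\<^bsub>PSL n\<^esub> inv\<^bsub>PSL n\<^esub> ?a"
    have aG: "?a \<in> carrier (PSL n)" using a(3) by simp
    have "PSL_image n (a [^]\<^bsub>SL n\<^esub> p) = \<one>\<^bsub>PSL n\<^esub>" using p(2) \<pi>.hom_one by simp
    then have ap: "?a [^]\<^bsub>PSL n\<^esub> p = \<one>\<^bsub>PSL n\<^esub>" using \<pi>.hom_nat_pow[OF a(3)] by simp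
    \<comment> \<open>Conjugation by \<open>?a\<close> fixes only the identity of \<open>B\<close>,
      so \<open>card B\<close> is 1 modulo \<open>p\<close>.\<close>
    have "card {y \<in> B. ?s y = y} mod p = card B mod p"
    proof (rule funpow_prime_fixed_points[OF p(1) finB])
      fix y assume y: "y \<in> B"
      then show "?s y \<in> B" using inv by blast
      have "y \<in> carrier (PSL n)" using y B.subset by blast
      then show "(?s ^^ p) y = y"
        using \<pi>.H.funpow_conj[OF aG, of y p] by (simp add: ap)
    qed
    moreover have "{y \<in> B. ?s y = y} = {\<one>\<^bsub>PSL n\<^esub>}"
    proof -
      have "?s y = y \<longleftrightarrow> y = \<one>\<^bsub>PSL n\<^esub>" if "y \<in> B" for y
      proof
        assume "?s y = y"
        then show "y = \<one>\<^bsub>PSL n\<^esub>" using \<pi>.H.conj_eq_self_iff[OF aG, of y] fpf that B.subset by blast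
      qed (use aG in simp)
      then show ?thesis using B.one_closed by blast
    qed
    ultimately show ?thesis using prime_gt_1_nat[OF p(1)] card(1) \<open>l = n\<close> by simp
  qed
  ultimately show False
    using prime_power_le_square[OF n p(1,4) _ card(2)] by blast
qed

end

section \<open>Conjugate frames and centralizers in PSL\<close>

lemma frame_conj:
  fixes g :: "'a :: {finite,field} alg_closure mat"
  assumes g: "frame n g" and h: "h \<in> carrier_mat n n" "det h \<noteq> 0" and n: "0 < n"
  shows "frame n (ac_mat h * g)"
proof -
  have gc: "g \<in> carrier_mat n n" by (rule frame_carrier[OF g])
  have ix: "(ac_mat h * g) $$ (k, i) = (\<Sum>j<n. to_ac (h $$ (k, j)) * g $$ (j, i))" if "k < n" "i < n" for k i
    using that h gc by (simp add: scalar_prod_def atLeast0LessThan)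
  have pow: "(\<Sum>j<n. to_ac (h $$ (k, j)) * g $$ (j, 0)) ^ (CARD('a) ^ i) =
      (\<Sum>j<n. to_ac (h $$ (k, j)) * g $$ (j, 0) ^ (CARD('a) ^ i))" for k i
    by (simp add: frobenius_sum power_mult_distrib frobenius_to_ac)
  obtain \<gamma> where \<gamma>: "\<And>k. k < n \<Longrightarrow> g $$ (k, 0) ^ (CARD('a) ^ n) = \<gamma> * g $$ (k, 0)"
    using g unfolding frame_def by blast
  show ?thesis
    unfolding frame_def
  proof (intro conjI allI impI exI[of _ \<gamma>])
    show "ac_mat h * g \<in> carrier_mat n n" using h gc by simp
    have "det (ac_mat h * g) = det (ac_mat h) * det g"
      by (rule det_mult) (use h gc in auto)
    then show "det (ac_mat h * g) \<noteq> 0" using h(2) frame_det[OF g] by simp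
    fix i k assume "i < n" "k < n"
    then show "(ac_mat h * g) $$ (k, i) = (ac_mat h * g) $$ (k, 0) ^ (CARD('a) ^ i)"
      using n by (simp only: ix pow) (intro sum.cong refl arg_cong2[where f = times] frame_col[OF g], simp_all)
  next
    fix k assume k: "k < n"
    have "(\<Sum>j<n. to_ac (h $$ (k, j)) * g $$ (j, 0) ^ (CARD('a) ^ n)) = (\<Sum>j<n. \<gamma> * (to_ac (h $$ (k, j)) * g $$ (j, 0)))"
      by (intro sum.cong) (auto simp: \<gamma>)
    then show "(ac_mat h * g) $$ (k, 0) ^ (CARD('a) ^ n) = \<gamma> * (ac_mat h * g) $$ (k, 0)"
      using k n by (simp only: ix pow sum_distrib_left)
  qed
qed

text \<open>The frame \<open>ac_mat h * g\<close> belongs to the torus conjugated by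
  \<open>h\<close>. Any conjugate of \<open>x\<close> can thus serve as the base element, with the
  same eigenvalue.\<close>

lemma eigenvalue_in_frame_conj:
  fixes g :: "'a :: {finite,field} alg_closure mat"
  assumes g: "frame n g" and h: "h \<in> carrier_mat n n" and Y: "eigenvalue_in n g Y \<mu>"
    and Z: "Z \<in> carrier_mat n n" "Z * h = h * Y"
  shows "eigenvalue_in n (ac_mat h * g) Z \<mu>"
proof -
  have Yc: "Y \<in> carrier_mat n n" and Ye: "ac_mat Y * g = g * frob_diag n \<mu>" using Y by (auto simp: eigenvalue_in_def)
  note d = carrier_matD[OF h] carrier_matD[OF Z(1)] carrier_matD[OF Yc] frame_dim[OF g]
  have "ac_mat Z * (ac_mat h * g) = ac_mat (Z * h) * g"
    using d by (simp add: to_ac.mat_hom_mult[OF Z(1) h] mat_assoc del: assoc_mult_mat)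
  also have "\<dots> = ac_mat h * (ac_mat Y * g)"
    unfolding Z(2) using d by (simp add: to_ac.mat_hom_mult[OF h Yc] mat_assoc del: assoc_mult_mat)
  also have "\<dots> = (ac_mat h * g) * frob_diag n \<mu>"
    unfolding Ye using d by (simp add: mat_assoc del: assoc_mult_mat)
  finally show ?thesis using Z(1) by (simp add: eigenvalue_in_def)
qed

context
  fixes n :: nat and g :: "'a :: {finite,field} alg_closure mat" and R :: "'a mat" and \<mu>
  assumes g: "frame n g" and n: "Factorial_Ring.prime n" "n > 2"
    and R: "eigenvalue_in n g R \<mu>" "\<mu> ^ CARD('a) \<noteq> \<mu>" "R \<in> carrier (SL n)"
begin

lemma PSL_image_eq_one_imp_scalar:
  assumes "(A :: 'a mat) \<in> carrier (SL n)" "PSL_image n A = \<one>\<^bsub>PSL n\<^esub>"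
  obtains c where "A = c \<cdot>\<^sub>m 1\<^sub>m n" "c ^ n = 1"
proof -
  have "A \<in> center (SL n)" using PSL_image_eq_one_iff[OF assms(1)] assms(2) by blast
  from center_SL_scalar[OF g n(1) R this] show ?thesis using that by metis
qed

text \<open>The centre consists of scalars, and within the torus the scalars are the elements with
  eigenvalue in the base field.\<close>

lemma PSL_image_eq_one_iff_fixed:
  assumes A: "A \<in> carrier (SL n)" "eigenvalue_in n g A \<nu>"
  shows "PSL_image n A = \<one>\<^bsub>PSL n\<^esub> \<longleftrightarrow> \<nu> ^ CARD('a) = \<nu>"
proof
  assume "PSL_image n A = \<one>\<^bsub>PSL n\<^esub>"
  then obtain c where "A = c \<cdot>\<^sub>m 1\<^sub>m n" using PSL_image_eq_one_imp_scalar[OF A(1)] by blast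
  then have "\<nu> = to_ac c"
    using eigenvalue_in_eq[OF g A(2)] eigenvalue_in_smult_one[OF g, of c] n(2) by simp
  then show "\<nu> ^ CARD('a) = \<nu>" using frobenius_to_ac[of c 1] by simp
next
  assume "\<nu> ^ CARD('a) = \<nu>"
  then obtain c where c: "A = c \<cdot>\<^sub>m 1\<^sub>m n" using eigenvalue_in_fixed_imp_scalar[OF g A(2)] by metis
  have "A \<in> center (SL n)"
    using A(1) unfolding center_def by (auto simp: carrier_SL c smult_one_mult)
  then show "PSL_image n A = \<one>\<^bsub>PSL n\<^esub>" using PSL_image_eq_one_iff[OF A(1)] by blast
qed

text \<open>Commuting images mean that the lifts commute up to a central scalar, which
  \<open>eigenvalue_in_twisted_commute\<close> shows to be 1; and a matrix commuting with
  \<open>Y\<close> is in the torus.\<close>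

lemma PSL_commute_iff:
  assumes Y: "eigenvalue_in n g Y \<nu>" "\<nu> ^ CARD('a) \<noteq> \<nu>" "Y \<in> carrier (SL n)" and Z: "Z \<in> carrier (SL n)"
  shows "PSL_image n Z \<otimes>\<^bsub>PSL n\<^esub> PSL_image n Y = PSL_image n Y \<otimes>\<^bsub>PSL n\<^esub> PSL_image n Z \<longleftrightarrow>
    (\<exists>\<tau>. eigenvalue_in n g Z \<tau>)"
proof -
  interpret \<pi>: group_hom "SL n" "PSL n" "PSL_image n :: 'a mat \<Rightarrow> _" by (rule PSL_image_hom)
  have Yc: "Y \<in> carrier_mat n n" "det Y = 1" and Zc: "Z \<in> carrier_mat n n" "det Z = 1" using Y(3) Z by (auto simp: carrier_SL)
  have h: "PSL_image n Z \<otimes>\<^bsub>PSL n\<^esub> PSL_image n Y = PSL_image n (Z * Y)"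
    "PSL_image n Y \<otimes>\<^bsub>PSL n\<^esub> PSL_image n Z = PSL_image n (Y * Z)"
    using \<pi>.hom_mult[OF Z Y(3)] \<pi>.hom_mult[OF Y(3) Z] by simp_all
  have ZY: "Z * Y \<in> carrier (SL n)" and YZ: "Y * Z \<in> carrier (SL n)"
    using \<pi>.G.m_closed[OF Z Y(3)] \<pi>.G.m_closed[OF Y(3) Z] by simp_all
  show ?thesis
    unfolding h
  proof
    assume "PSL_image n (Z * Y) = PSL_image n (Y * Z)"
    then obtain z where z: "z \<in> center (SL n)" "Z * Y = z * (Y * Z)"
      using PSL_image_eq_iff[OF ZY YZ] by blast
    obtain c where c: "z = c \<cdot>\<^sub>m 1\<^sub>m n" "c ^ n = 1" using center_SL_scalar[OF g n(1) R z(1)] by blast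
    have e: "Z * Y = c \<cdot>\<^sub>m (Y * Z)"
      using z(2) smult_one_mult(1)[OF mult_carrier_mat[OF Yc(1) Zc(1)]] by (simp add: c(1))
    then have "c = 1"
      using eigenvalue_in_twisted_commute[OF g n Y(1,2) Yc(2) Zc(1) _ c(2)] Zc(2) by simp
    then have "Z * Y = Y * Z" using e by (simp add: one_smult_mat)
    then obtain \<tau> where "eigenvalue_in n g Z \<tau>"
      by (rule eigenvalue_in_commute[OF g n(1) Y(1,2) Zc(1)])
    then show "\<exists>\<tau>. eigenvalue_in n g Z \<tau>" by (rule exI)
  next
    assume "\<exists>\<tau>. eigenvalue_in n g Z \<tau>"
    then obtain \<tau> where \<tau>: "eigenvalue_in n g Z \<tau>" by blast
    have "Z * Y = Y * Z"
      using eigenvalue_in_unique[OF g eigenvalue_in_mult[OF g \<tau> Y(1)]] eigenvalue_in_mult[OF g Y(1) \<tau>]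
      by (simp add: mult.commute)
    then show "PSL_image n (Z * Y) = PSL_image n (Y * Z)" by simp
  qed
qed

lemma PSL_pow: "PSL_image n R [^]\<^bsub>PSL n\<^esub> (k::nat) = PSL_image n (R [^]\<^bsub>SL n\<^esub> k)"
  "eigenvalue_in n g (R [^]\<^bsub>SL n\<^esub> k) (\<mu> ^ k)" "R [^]\<^bsub>SL n\<^esub> k \<in> carrier (SL n)"
proof -
  interpret \<pi>: group_hom "SL n" "PSL n" "PSL_image n :: 'a mat \<Rightarrow> _" by (rule PSL_image_hom)
  show "PSL_image n R [^]\<^bsub>PSL n\<^esub> (k::nat) = PSL_image n (R [^]\<^bsub>SL n\<^esub> k)"
    using \<pi>.hom_nat_pow[OF R(3)] by simp
  show "eigenvalue_in n g (R [^]\<^bsub>SL n\<^esub> k) (\<mu> ^ k)"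
    using eigenvalue_in_pow[OF g R(1), of k] R(3) by (simp add: pow_SL carrier_SL)
  show "R [^]\<^bsub>SL n\<^esub> k \<in> carrier (SL n)" using R(3) by simp
qed

text \<open>A nontrivial \<open>y\<close> commuting with the image of \<open>R\<close> lifts to a
  torus element with eigenvalue outside the base field, so \<open>PSL_commute_iff\<close> describes
  both centralizers by the same condition.\<close>

lemma PSL_centralizer_eq:
  assumes y: "y \<in> carrier (PSL n)" "y \<noteq> \<one>\<^bsub>PSL n\<^esub>" and z: "z \<in> carrier (PSL n)"
    and yr: "y \<otimes>\<^bsub>PSL n\<^esub> PSL_image n R = PSL_image n R \<otimes>\<^bsub>PSL n\<^esub> y"
  shows "z \<otimes>\<^bsub>PSL n\<^esub> y = y \<otimes>\<^bsub>PSL n\<^esub> z \<longleftrightarrow> z \<otimes>\<^bsub>PSL n\<^esub> PSL_image n R = PSL_image n R \<otimes>\<^bsub>PSL n\<^esub> z"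
proof -
  obtain Y Z where Y: "Y \<in> carrier (SL n)" "y = PSL_image n Y" and Z: "Z \<in> carrier (SL n)" "z = PSL_image n Z"
    using y(1) z unfolding carrier_PSL by blast
  obtain \<nu> where \<nu>: "eigenvalue_in n g Y \<nu>"
    using yr PSL_commute_iff[OF R Y(1)] unfolding Y(2) by blast
  have "\<nu> ^ CARD('a) \<noteq> \<nu>" using PSL_image_eq_one_iff_fixed[OF Y(1) \<nu>] y(2) Y(2) by blast
  then show ?thesis
    using PSL_commute_iff[OF \<nu> _ Y(1) Z(1)] PSL_commute_iff[OF R Z(1)] unfolding Y(2) Z(2) by blast
qed

text \<open>A lift of the conjugate lies in the torus and is conjugate to \<open>R\<close>, so its
  eigenvalue is \<mu>^(q^i) for some i < n, and this is the eigenvalue of a power of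
  \<open>R\<close>.\<close>

lemma PSL_conj_power:
  assumes t: "t \<in> carrier (PSL n)"
    and comm: "(t \<otimes>\<^bsub>PSL n\<^esub> PSL_image n R \<otimes>\<^bsub>PSL n\<^esub> inv\<^bsub>PSL n\<^esub> t) \<otimes>\<^bsub>PSL n\<^esub> PSL_image n R =
      PSL_image n R \<otimes>\<^bsub>PSL n\<^esub> (t \<otimes>\<^bsub>PSL n\<^esub> PSL_image n R \<otimes>\<^bsub>PSL n\<^esub> inv\<^bsub>PSL n\<^esub> t)"
  shows "\<exists>i<n. t \<otimes>\<^bsub>PSL n\<^esub> PSL_image n R \<otimes>\<^bsub>PSL n\<^esub> inv\<^bsub>PSL n\<^esub> t = PSL_image n R [^]\<^bsub>PSL n\<^esub> (CARD('a) ^ i)"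
proof -
  interpret \<pi>: group_hom "SL n" "PSL n" "PSL_image n :: 'a mat \<Rightarrow> _" by (rule PSL_image_hom)
  obtain U where U: "U \<in> carrier (SL n)" "t = PSL_image n U"
    using t unfolding carrier_PSL by blast
  define W where "W = U \<otimes>\<^bsub>SL n\<^esub> R \<otimes>\<^bsub>SL n\<^esub> inv\<^bsub>SL n\<^esub> U"
  have WG: "W \<in> carrier (SL n)" using U R(3) by (simp add: W_def del: mult_SL)
  have tW: "t \<otimes>\<^bsub>PSL n\<^esub> PSL_image n R \<otimes>\<^bsub>PSL n\<^esub> inv\<^bsub>PSL n\<^esub> t = PSL_image n W"
    using U R(3) by (simp add: W_def del: mult_SL)
  have WU: "W \<otimes>\<^bsub>SL n\<^esub> U = U \<otimes>\<^bsub>SL n\<^esub> R"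
    using U(1) R(3) by (simp add: W_def \<pi>.G.m_assoc del: mult_SL one_SL)
  obtain \<nu> where \<nu>: "eigenvalue_in n g W \<nu>"
    using comm PSL_commute_iff[OF R WG] unfolding tW by blast
  have "U \<in> carrier_mat n n" "det U \<noteq> 0" using U(1) by (auto simp: carrier_SL)
  moreover have "U * R = W * U" using WU by simp
  ultimately obtain i where i: "i < n" "\<nu> = \<mu> ^ (CARD('a) ^ i)"
    using eigenvalue_in_conj[OF g _ R(1) \<nu>, of U] n(2) by auto
  have "W = R [^]\<^bsub>SL n\<^esub> (CARD('a) ^ i)"
    using eigenvalue_in_unique[OF g \<nu>] PSL_pow(2)[of "CARD('a) ^ i"] i(2) by simp
  then show ?thesis using i(1) tW PSL_pow(1) by auto
qed

text \<open>This supplies the data for \<open>conjugate_or_commute\<close> inside \<open>H\<close>.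
  The exponent \<open>m\<close> is the order of the image of \<open>R\<close> divided by a prime
  \<open>p\<close>, so the \<open>m\<close>-th power has order \<open>p\<close>; as \<open>s\<close>
  is a conjugate, the same numbers serve for it.\<close>

lemma PSL_subgroup_conj_or_commute:
  assumes H: "subgroup H (PSL n)" and r: "PSL_image n R \<in> H" and s: "s \<in> H"
    and u: "u \<in> carrier (PSL n)" "s = u \<otimes>\<^bsub>PSL n\<^esub> PSL_image n R \<otimes>\<^bsub>PSL n\<^esub> inv\<^bsub>PSL n\<^esub> u"
  shows "(\<exists>t\<in>H. t \<otimes>\<^bsub>PSL n\<^esub> PSL_image n R \<otimes>\<^bsub>PSL n\<^esub> inv\<^bsub>PSL n\<^esub> t = s) \<or>
    PSL_image n R \<otimes>\<^bsub>PSL n\<^esub> s = s \<otimes>\<^bsub>PSL n\<^esub> PSL_image n R"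
proof -
  let ?P = "PSL n :: 'a mat set monoid" and ?q = "CARD('a)"
  define r where "r = PSL_image n R"
  interpret \<pi>: group_hom "SL n" ?P "PSL_image n :: 'a mat \<Rightarrow> _" by (rule PSL_image_hom)
  interpret H: subgroup H ?P by (rule H)
  let ?H = "?P\<lparr>carrier := H\<rparr>"
  interpret HG: group ?H by (rule \<pi>.H.subgroup_imp_group[OF H])
  have rP: "r \<in> carrier ?P" using R(3) by (simp add: r_def)
  have rH: "r \<in> H" using assms(2) by (simp add: r_def)
  have powH: "x [^]\<^bsub>?H\<^esub> (k::nat) = x [^]\<^bsub>?P\<^esub> k" for x k by (simp add: nat_pow_def)
  have invH: "inv\<^bsub>?H\<^esub> x = inv\<^bsub>?P\<^esub> x" if "x \<in> H" for x
    using \<pi>.H.m_inv_consistent[OF H that] .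
  have r1: "r \<noteq> \<one>\<^bsub>?P\<^esub>"
    using PSL_image_eq_one_iff_fixed[OF R(3,1)] R(2) by (simp add: r_def)
  have "\<pi>.H.ord r \<noteq> 1" using r1 \<pi>.H.ord_eq_1[OF rP] by simp
  then obtain p where p: "Factorial_Ring.prime p" "p dvd \<pi>.H.ord r" by (metis prime_factor_nat)
  then obtain m where m: "\<pi>.H.ord r = p * m" by auto
  have "\<pi>.H.ord r > 0" using \<pi>.H.ord_ge_1[OF finite_PSL rP] by simp
  then have m0: "m > 0" using m by (cases m) auto
  have rm: "r [^]\<^bsub>?P\<^esub> m \<noteq> \<one>\<^bsub>?P\<^esub>" "(r [^]\<^bsub>?P\<^esub> m) [^]\<^bsub>?P\<^esub> p = \<one>\<^bsub>?P\<^esub>"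
  proof -
    show "r [^]\<^bsub>?P\<^esub> m \<noteq> \<one>\<^bsub>?P\<^esub>"
    proof
      assume "r [^]\<^bsub>?P\<^esub> m = \<one>\<^bsub>?P\<^esub>"
      then have "p * m dvd m" using \<pi>.H.pow_eq_id[OF rP, of m] m by simp
      then have "p * m \<le> m" using m0 by (rule dvd_imp_le)
      then show False using m0 prime_gt_1_nat[OF p(1)] by simp
    qed
    show "(r [^]\<^bsub>?P\<^esub> m) [^]\<^bsub>?P\<^esub> p = \<one>\<^bsub>?P\<^esub>"
      using \<pi>.H.pow_ord_eq_1[OF rP] m rP by (simp add: \<pi>.H.nat_pow_pow mult.commute)
  qed
  have sm: "s [^]\<^bsub>?P\<^esub> m \<noteq> \<one>\<^bsub>?P\<^esub>" "(s [^]\<^bsub>?P\<^esub> m) [^]\<^bsub>?P\<^esub> p = \<one>\<^bsub>?P\<^esub>"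
  proof -
    have sk: "s [^]\<^bsub>?P\<^esub> k = u \<otimes>\<^bsub>?P\<^esub> r [^]\<^bsub>?P\<^esub> k \<otimes>\<^bsub>?P\<^esub> inv\<^bsub>?P\<^esub> u" for k :: nat
      unfolding u(2) r_def[symmetric] by (rule \<pi>.H.conj_nat_pow[OF u(1) rP])
    show "s [^]\<^bsub>?P\<^esub> m \<noteq> \<one>\<^bsub>?P\<^esub>"
    proof
      assume "s [^]\<^bsub>?P\<^esub> m = \<one>\<^bsub>?P\<^esub>"
      then have "u \<otimes>\<^bsub>?P\<^esub> r [^]\<^bsub>?P\<^esub> m \<otimes>\<^bsub>?P\<^esub> inv\<^bsub>?P\<^esub> u = u \<otimes>\<^bsub>?P\<^esub> \<one>\<^bsub>?P\<^esub> \<otimes>\<^bsub>?P\<^esub> inv\<^bsub>?P\<^esub> u"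
        using sk u(1) by simp
      then show False using \<pi>.H.conj_inj[OF u(1)] rP rm(1) by blast
    qed
    have "s \<in> carrier ?P" using s by simp
    then have "(s [^]\<^bsub>?P\<^esub> m) [^]\<^bsub>?P\<^esub> p = s [^]\<^bsub>?P\<^esub> (m * p)" by (rule \<pi>.H.nat_pow_pow)
    also have "\<dots> = \<one>\<^bsub>?P\<^esub>"
      using rm(2) rP u(1) unfolding sk by (simp add: \<pi>.H.nat_pow_pow)
    finally show "(s [^]\<^bsub>?P\<^esub> m) [^]\<^bsub>?P\<^esub> p = \<one>\<^bsub>?P\<^esub>" .
  qed
  define A where "A = R [^]\<^bsub>SL n\<^esub> m"
  have A: "eigenvalue_in n g A (\<mu> ^ m)" "A \<in> carrier (SL n)" "PSL_image n A = r [^]\<^bsub>?P\<^esub> m"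
    using PSL_pow[of m] by (auto simp: A_def r_def)
  have Anf: "(\<mu> ^ m) ^ ?q \<noteq> \<mu> ^ m"
    using PSL_image_eq_one_iff_fixed[OF A(2,1)] A(3) rm(1) by simp
  have Ac: "A \<in> carrier_mat n n" "det A = 1" using A(2) by (auto simp: carrier_SL)
  have ApG: "A [^]\<^bsub>SL n\<^esub> p \<in> carrier (SL n)" using A(2) by simp
  have "PSL_image n (A [^]\<^bsub>SL n\<^esub> p) = \<one>\<^bsub>?P\<^esub>"
    using \<pi>.hom_nat_pow[OF A(2)] A(3) rm(2) by simp
  then obtain z where z: "A [^]\<^bsub>SL n\<^esub> p = z \<cdot>\<^sub>m 1\<^sub>m n" "z ^ n = 1"
    using PSL_image_eq_one_imp_scalar[OF ApG] by blast
  have Ap: "A ^\<^sub>m p = z \<cdot>\<^sub>m 1\<^sub>m n" using z(1) pow_SL[OF Ac(1)] by simp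
  obtain m' where m': "p > n + 1" "[m' = 1] (mod p)" "A ^\<^sub>m (m' * p) = 1\<^sub>m n"
    "((\<mu> ^ m) ^ m') ^ ?q \<noteq> (\<mu> ^ m) ^ m'" "\<not> p dvd ?q"
    using prime_order_eigenvalue_in[OF g n A(1) Anf Ac(2) p(1) Ap z(2)] by metis
  \<comment> \<open>A lift of \<open>r [^] m\<close> with \<open>p\<close>-th power 1 in SL; for
    \<open>A\<close> the \<open>p\<close>-th power is only known to be a scalar.\<close>
  define a where "a = A [^]\<^bsub>SL n\<^esub> m'"
  have a: "eigenvalue_in n g a ((\<mu> ^ m) ^ m')" "a \<in> carrier (SL n)"
    using eigenvalue_in_pow[OF g A(1), of m'] pow_SL[OF Ac(1), of m'] \<pi>.G.nat_pow_closed[OF A(2), of m']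
    by (simp_all only: a_def)
  have ap: "a [^]\<^bsub>SL n\<^esub> p = 1\<^sub>m n"
    using m'(3) A(2) pow_SL[OF Ac(1), of "m' * p"] by (simp add: a_def \<pi>.G.nat_pow_pow)
  have ra: "PSL_image n a = r [^]\<^bsub>?P\<^esub> m"
  proof -
    let ?b = "r [^]\<^bsub>?P\<^esub> m"
    have bP: "?b \<in> carrier ?P" using rP by simp
    have "m' \<noteq> 0"
    proof
      assume "m' = 0"
      then have "[0 = 1] (mod p)" using m'(2) by simp
      then show False using prime_gt_1_nat[OF p(1)] by (simp add: cong_def)
    qed
    then have "p dvd m' - 1" using m'(2) by (simp add: cong_altdef_nat)
    then obtain j where "m' - 1 = p * j" by auto
    then have j: "m' = p * j + 1" using \<open>m' \<noteq> 0\<close> by simp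
    have "PSL_image n a = ?b [^]\<^bsub>?P\<^esub> m'"
      using \<pi>.hom_nat_pow[OF A(2), of m'] A(3) by (simp add: a_def)
    also have "\<dots> = ?b [^]\<^bsub>?P\<^esub> (p * j) \<otimes>\<^bsub>?P\<^esub> ?b"
      unfolding j using \<pi>.H.nat_pow_mult[OF bP, of "p * j" 1] bP by simp
    also have "?b [^]\<^bsub>?P\<^esub> (p * j) = (?b [^]\<^bsub>?P\<^esub> p) [^]\<^bsub>?P\<^esub> j"
      using \<pi>.H.nat_pow_pow[OF bP, of p j] by simp
    also have "\<dots> = \<one>\<^bsub>?P\<^esub>" unfolding rm(2) by simp
    finally show ?thesis using bP by simp
  qed
  have finH: "finite (carrier ?H)"
    using finite_PSL H.subset finite_subset by auto
  have conj_pow: "\<exists>i<n. t \<otimes>\<^bsub>?P\<^esub> r \<otimes>\<^bsub>?P\<^esub> inv\<^bsub>?P\<^esub> t = r [^]\<^bsub>?P\<^esub> (?q ^ i)"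
    if "t \<in> carrier ?P" "(t \<otimes>\<^bsub>?P\<^esub> r \<otimes>\<^bsub>?P\<^esub> inv\<^bsub>?P\<^esub> t) \<otimes>\<^bsub>?P\<^esub> r = r \<otimes>\<^bsub>?P\<^esub> (t \<otimes>\<^bsub>?P\<^esub> r \<otimes>\<^bsub>?P\<^esub> inv\<^bsub>?P\<^esub> t)" for t
    using PSL_conj_power[of t] that unfolding r_def by blast
  have "(\<exists>t\<in>carrier ?H. t \<otimes>\<^bsub>?H\<^esub> r \<otimes>\<^bsub>?H\<^esub> inv\<^bsub>?H\<^esub> t = s) \<or> r \<otimes>\<^bsub>?H\<^esub> s = s \<otimes>\<^bsub>?H\<^esub> r"
  proof (rule HG.conjugate_or_commute[OF finH n(1) p(1), where m = m and q = ?q])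
    show "n < p" using m'(1) by simp
    show "r \<in> carrier ?H" "s \<in> carrier ?H" using rH s by simp_all
  next
    fix y z assume "y \<in> carrier ?H" "z \<in> carrier ?H" "y \<noteq> \<one>\<^bsub>?H\<^esub>" "y \<otimes>\<^bsub>?H\<^esub> r = r \<otimes>\<^bsub>?H\<^esub> y"
    then show "(z \<otimes>\<^bsub>?H\<^esub> y = y \<otimes>\<^bsub>?H\<^esub> z) = (z \<otimes>\<^bsub>?H\<^esub> r = r \<otimes>\<^bsub>?H\<^esub> z)"
      using PSL_centralizer_eq[of y z] H.subset unfolding r_def by auto
  next
    fix t assume t: "t \<in> carrier ?H"
      and e: "(t \<otimes>\<^bsub>?H\<^esub> r \<otimes>\<^bsub>?H\<^esub> inv\<^bsub>?H\<^esub> t) \<otimes>\<^bsub>?H\<^esub> r = r \<otimes>\<^bsub>?H\<^esub> (t \<otimes>\<^bsub>?H\<^esub> r \<otimes>\<^bsub>?H\<^esub> inv\<^bsub>?H\<^esub> t)"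
    show "\<exists>i<n. t \<otimes>\<^bsub>?H\<^esub> r \<otimes>\<^bsub>?H\<^esub> inv\<^bsub>?H\<^esub> t = r [^]\<^bsub>?H\<^esub> (?q ^ i)"
      using conj_pow[of t] t e H.subset by (simp add: invH powH subset_iff)
  next
    fix t assume t: "t \<in> carrier ?H"
      and e: "(t \<otimes>\<^bsub>?H\<^esub> s \<otimes>\<^bsub>?H\<^esub> inv\<^bsub>?H\<^esub> t) \<otimes>\<^bsub>?H\<^esub> r = r \<otimes>\<^bsub>?H\<^esub> (t \<otimes>\<^bsub>?H\<^esub> s \<otimes>\<^bsub>?H\<^esub> inv\<^bsub>?H\<^esub> t)"
    have tP: "t \<in> carrier ?P" using t H.subset by auto
    have "t \<otimes>\<^bsub>?P\<^esub> s \<otimes>\<^bsub>?P\<^esub> inv\<^bsub>?P\<^esub> t = (t \<otimes>\<^bsub>?P\<^esub> u) \<otimes>\<^bsub>?P\<^esub> r \<otimes>\<^bsub>?P\<^esub> inv\<^bsub>?P\<^esub> (t \<otimes>\<^bsub>?P\<^esub> u)"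
      unfolding u(2) r_def[symmetric] by (rule \<pi>.H.conj_conj[OF tP u(1) rP])
    then show "\<exists>i<n. t \<otimes>\<^bsub>?H\<^esub> s \<otimes>\<^bsub>?H\<^esub> inv\<^bsub>?H\<^esub> t = r [^]\<^bsub>?H\<^esub> (?q ^ i)"
      using conj_pow[of "t \<otimes>\<^bsub>?P\<^esub> u"] t e tP u(1) by (simp add: invH powH)
  next
    have "R [^]\<^bsub>SL n\<^esub> (?q ^ n) = R"
      using eigenvalue_in_unique[OF g PSL_pow(2)[of "?q ^ n"]] R(1) eigenvalue_in_periodic[OF g R(1)] n(2) by simp
    then show "r [^]\<^bsub>?H\<^esub> (?q ^ n) = r" using PSL_pow(1)[of "?q ^ n"] by (simp add: powH r_def)
  next
    show "r [^]\<^bsub>?H\<^esub> m \<noteq> \<one>\<^bsub>?H\<^esub>" "(r [^]\<^bsub>?H\<^esub> m) [^]\<^bsub>?H\<^esub> p = \<one>\<^bsub>?H\<^esub>"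
      "s [^]\<^bsub>?H\<^esub> m \<noteq> \<one>\<^bsub>?H\<^esub>" "(s [^]\<^bsub>?H\<^esub> m) [^]\<^bsub>?H\<^esub> p = \<one>\<^bsub>?H\<^esub>"
      using rm sm by (simp_all add: powH)
  next
    fix B l k
    assume l: "Factorial_Ring.prime (l::nat)" and B: "subgroup B ?H" and c: "card B = l ^ k" "k > 0"
      and comm: "\<forall>x\<in>B. \<forall>y\<in>B. x \<otimes>\<^bsub>?H\<^esub> y = y \<otimes>\<^bsub>?H\<^esub> x"
      and i: "(\<lambda>y. r [^]\<^bsub>?H\<^esub> m \<otimes>\<^bsub>?H\<^esub> y \<otimes>\<^bsub>?H\<^esub> inv\<^bsub>?H\<^esub> (r [^]\<^bsub>?H\<^esub> m)) ` B \<subseteq> B"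
      and fpf: "\<forall>y\<in>B. r [^]\<^bsub>?H\<^esub> m \<otimes>\<^bsub>?H\<^esub> y = y \<otimes>\<^bsub>?H\<^esub> r [^]\<^bsub>?H\<^esub> m \<longrightarrow> y = \<one>\<^bsub>?H\<^esub>"
    have rmH: "r [^]\<^bsub>?P\<^esub> m \<in> H"
      using HG.nat_pow_closed[of r m] rH by (simp add: powH)
    have e: "r [^]\<^bsub>?H\<^esub> m = PSL_image n a" "inv\<^bsub>?H\<^esub> PSL_image n a = inv\<^bsub>?P\<^esub> PSL_image n a"
      using invH[OF rmH] by (simp_all add: powH ra)
    show False
      by (rule no_invariant_p_subgroup[OF g n a(1) m'(4) a(2) p(1) ap m'(5,1) \<pi>.H.incl_subgroup[OF H B] l c])
         (use comm i fpf in \<open>simp_all add: e\<close>)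
  qed
  then show ?thesis unfolding r_def using invH by auto
qed

end

section \<open>The kthulhu property\<close>

lemma (in group) conj_class_eq:
  assumes H: "subgroup H G" and r: "r \<in> carrier G" and t: "t \<in> H" "t \<otimes> r \<otimes> inv t = s"
  shows "conj_class G H r = conj_class G H s"
proof -
  interpret H: subgroup H G by (rule H)
  have tG: "t \<in> carrier G" using t(1) by simp
  have *: "h \<otimes> s \<otimes> inv h = (h \<otimes> t) \<otimes> r \<otimes> inv (h \<otimes> t)" if "h \<in> H" for h
    unfolding t(2)[symmetric] using conj_conj[of h t r] that r tG by simp
  show ?thesis
  proof
    show "conj_class G H s \<subseteq> conj_class G H r"
      unfolding conj_class_def using * t(1) by blast
    show "conj_class G H r \<subseteq> conj_class G H s"
    proof
      fix y assume "y \<in> conj_class G H r"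
      then obtain h where h: "h \<in> H" "y = h \<otimes> r \<otimes> inv h" by (auto simp: conj_class_def)
      have ht: "h \<otimes> inv t \<in> H" using h(1) t(1) by blast
      have "h \<otimes> inv t \<otimes> t = h" using h(1) tG by (simp add: m_assoc)
      then have "y = (h \<otimes> inv t) \<otimes> s \<otimes> inv (h \<otimes> inv t)"
        using *[OF ht] h(2) by simp
      then show "y \<in> conj_class G H s" unfolding conj_class_def using ht by blast
    qed
  qed
qed

theorem proposition5p15:
  fixes n q :: nat
    and T :: "'a :: {finite, field} mat set"
    and x :: "'a mat"
  assumes "Factorial_Ring.prime n" and "n > 3"
    and "CARD('a) = q"
    and "coxeter_torus_SL n T"
    and "x \<in> T"
    and "irreducible_matrix x"
  shows "kthulhu (PSL n) (conj_class (PSL n) (carrier (PSL n)) (PSL_image n x))"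
proof -
  let ?P = "PSL n :: 'a mat set monoid"
  let ?O = "conj_class ?P (carrier ?P) (PSL_image n x)"
  interpret \<pi>: group_hom "SL n" ?P "PSL_image n :: 'a mat \<Rightarrow> _" by (rule PSL_image_hom)
  have n: "Factorial_Ring.prime n" "n > 2" "n > 0" using assms(1,2) by simp_all
  obtain T' where T': "coxeter_torus_GL n T'" and TT': "T = T' \<inter> carrier (SL n)"
    using assms(4) by (auto simp: coxeter_torus_SL_def)
  have xT': "x \<in> T'" and xG: "x \<in> carrier (SL n)" using assms(5) TT' by auto
  obtain g \<mu> where g: "frame n g" and x: "eigenvalue_in n g x \<mu>"
    using coxeter_torus_frame[OF T' xT' n(3)] by blast
  have nf: "\<mu> ^ CARD('a) \<noteq> \<mu>"
  proof
    assume "\<mu> ^ CARD('a) = \<mu>"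
    then obtain c where "x = c \<cdot>\<^sub>m 1\<^sub>m n" using eigenvalue_in_fixed_imp_scalar[OF g x] by metis
    then show False using not_irreducible_scalar_mat[of n c] assms(2,6) by simp
  qed
  \<comment> \<open>The frame is moved by the element that conjugates \<open>x\<close> to
    \<open>r\<close>, so that \<open>r\<close> becomes the base element and \<open>s\<close> a
    conjugate of it in the whole group.\<close>
  have key: "conj_class ?P H r = conj_class ?P H s \<or> r \<otimes>\<^bsub>?P\<^esub> s = s \<otimes>\<^bsub>?P\<^esub> r"
    if H: "subgroup H ?P" and r: "r \<in> H" "r \<in> ?O" and s: "s \<in> H" "s \<in> ?O" for H r s
  proof -
    let ?x = "PSL_image n x"
    have xP: "?x \<in> carrier ?P" using xG by simp
    obtain v where v: "v \<in> carrier ?P" "r = v \<otimes>\<^bsub>?P\<^esub> ?x \<otimes>\<^bsub>?P\<^esub> inv\<^bsub>?P\<^esub> v"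
      using r(2) by (auto simp: conj_class_def)
    obtain w where w: "w \<in> carrier ?P" "s = w \<otimes>\<^bsub>?P\<^esub> ?x \<otimes>\<^bsub>?P\<^esub> inv\<^bsub>?P\<^esub> w"
      using s(2) by (auto simp: conj_class_def)
    obtain V where V: "V \<in> carrier (SL n)" "v = PSL_image n V" using v(1) unfolding carrier_PSL by blast
    define R where "R = V \<otimes>\<^bsub>SL n\<^esub> x \<otimes>\<^bsub>SL n\<^esub> inv\<^bsub>SL n\<^esub> V"
    have RG: "R \<in> carrier (SL n)" using V(1) xG by (simp add: R_def del: mult_SL)
    have rR: "r = PSL_image n R" unfolding v(2) V(2) using V(1) xG by (simp add: R_def del: mult_SL)
    have Vc: "V \<in> carrier_mat n n" "det V \<noteq> 0" using V(1) by (auto simp: carrier_SL)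
    have "R \<otimes>\<^bsub>SL n\<^esub> V = V \<otimes>\<^bsub>SL n\<^esub> x"
      using V(1) xG by (simp add: R_def \<pi>.G.m_assoc del: mult_SL one_SL)
    then have RV: "R * V = V * x" by simp
    have fr: "frame n (ac_mat V * g)" by (rule frame_conj[OF g Vc n(3)])
    have R: "eigenvalue_in n (ac_mat V * g) R \<mu>"
      using RG by (intro eigenvalue_in_frame_conj[OF g Vc(1) x _ RV]) (simp add: carrier_SL)
    let ?u = "w \<otimes>\<^bsub>?P\<^esub> inv\<^bsub>?P\<^esub> v"
    have uP: "?u \<in> carrier ?P" using v(1) w(1) by simp
    have "?u \<otimes>\<^bsub>?P\<^esub> v = w" using v(1) w(1) by (simp add: \<pi>.H.m_assoc)
    then have "s = ?u \<otimes>\<^bsub>?P\<^esub> r \<otimes>\<^bsub>?P\<^esub> inv\<^bsub>?P\<^esub> ?u"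
      using \<pi>.H.conj_conj[OF uP v(1) xP] by (simp only: v(2) w(2))
    from PSL_subgroup_conj_or_commute[OF fr n(1,2) R nf RG H _ s(1) uP this[unfolded rR]]
    have "(\<exists>t\<in>H. t \<otimes>\<^bsub>?P\<^esub> r \<otimes>\<^bsub>?P\<^esub> inv\<^bsub>?P\<^esub> t = s) \<or> r \<otimes>\<^bsub>?P\<^esub> s = s \<otimes>\<^bsub>?P\<^esub> r"
      using r(1) unfolding rR by blast
    moreover have "r \<in> carrier ?P" using RG by (simp add: rR)
    ultimately show ?thesis using \<pi>.H.conj_class_eq[OF H] by blast
  qed
  have O_sub: "?O \<subseteq> carrier ?P"
    using xG by (auto simp: conj_class_def)
  have "\<not> type_C ?P ?O"
    unfolding type_C_def using key by blast
  moreover have "\<not> type_D ?P ?O"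
  proof
    assume "type_D ?P ?O"
    then obtain r s where rs: "r \<in> ?O" "s \<in> ?O"
      "conj_class ?P (generate ?P {r, s}) r \<noteq> conj_class ?P (generate ?P {r, s}) s"
      "(r \<otimes>\<^bsub>?P\<^esub> s) [^]\<^bsub>?P\<^esub> (2::nat) \<noteq> (s \<otimes>\<^bsub>?P\<^esub> r) [^]\<^bsub>?P\<^esub> (2::nat)"
      unfolding type_D_def by blast
    have "subgroup (generate ?P {r, s}) ?P"
      using rs(1,2) O_sub by (intro \<pi>.H.generate_is_subgroup) blast
    moreover have "r \<in> generate ?P {r, s}" "s \<in> generate ?P {r, s}"
      by (simp_all add: generate.incl)
    ultimately have "r \<otimes>\<^bsub>?P\<^esub> s = s \<otimes>\<^bsub>?P\<^esub> r" using key rs(1-3) by blast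
    then show False using rs(4) by simp
  qed
  moreover have "\<not> type_F ?P ?O"
  proof
    assume "type_F ?P ?O"
    then obtain r :: "nat \<Rightarrow> 'a mat set" where r: "r ` {1..4} \<subseteq> ?O"
      and F: "\<forall>a\<in>{1..4}. \<forall>b\<in>{1..4}. a \<noteq> b \<longrightarrow>
        conj_class ?P (generate ?P (r ` {1..4})) (r a) \<noteq> conj_class ?P (generate ?P (r ` {1..4})) (r b) \<and>
        r a \<otimes>\<^bsub>?P\<^esub> r b \<noteq> r b \<otimes>\<^bsub>?P\<^esub> r a"
      unfolding type_F_def by blast
    have mem: "(1::nat) \<in> {1..4}" "(2::nat) \<in> {1..4}" "(1::nat) \<noteq> 2" by simp_all
    have "subgroup (generate ?P (r ` {1..4})) ?P"
      using r O_sub by (intro \<pi>.H.generate_is_subgroup) blast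
    moreover have "r 1 \<in> generate ?P (r ` {1..4})" "r 2 \<in> generate ?P (r ` {1..4})"
      using mem by (auto intro!: generate.incl)
    moreover have "r 1 \<in> ?O" "r 2 \<in> ?O" using r mem(1,2) by blast+
    ultimately show False using key[of "generate ?P (r ` {1..4})" "r 1" "r 2"] F mem by blast
  qed
  ultimately show ?thesis by (simp add: kthulhu_def)
qed

end
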